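(* There is an algorithm which, given as input any $n\times n$ matrix $D$ in the pre-strict-circular-Robinson class, outputs a $PQ$-tree $\mathcal{T}$ on the leaf set $[n]$ with $S_{\mathcal{C}_R^*}(D)=\{\rho\circ\pi:\rho\in\operatorname{Dih}_n,\ \pi\in S(\mathcal{T})\}$, and which runs in $\mathcal{O}(n^2)$ time.
   Context: $[n]=\{0,\dots,n-1\}$. A dissimilarity matrix is a real $n\times n$ nonnegative symmetric matrix with zero diagonal. Elements $i,j,k,\ell\in[n]$ are cyclically ordered if pairwise distinct and $(j-i \bmod n)<(k-i\bmod n)<(\ell-i \bmod n)$. A dissimilarity matrix $A$ is strict circular Robinson if $A(i,k)>\min\{A(j,k),A(k,\ell)\}$ for all cyclically ordered $i,j,k,\ell$. $D$ is in the pre-strict-circular-Robinson class if $D=\Pi A\Pi^T$ for a permutation matrix $\Pi$ and a strict circular Robinson $A$. $S_{\mathcal{C}_R^*}(D)$ is the set of permutations $\sigma$ of $[n]$ such that the matrix $A$ with $A(\sigma(a),\sigma(b))=D(a,b)$ is strict circular Robinson. $\operatorname{Dih}_n$ is the group generated by $\pi_r(i)=n-1-i$ and $\pi_s(i)=i+1\bmod n$. A $PQ$-tree on $[n]$ is a rooted tree whose leaves are the elements of $[n]$ and whose internal nodes (with ordered children) are of type $P$ or $Q$; $S(\mathcal{T})$ is the set of left-to-right leaf sequences $(y_0,\dots,y_{n-1})$ obtainable by arbitrarily permuting children of $P$-nodes and/or reversing children of $Q$-nodes, each identified with the permutation $\pi$ with $\pi(y_k)=k$. *)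

theory Defs
  imports
    Complex_Main
    "HOL-Library.Multiset"
    "HOL-Library.Landau_Symbols"
    "HOL-Combinatorics.Permutations"
    "HOL-Algebra.Generated_Groups"
    "Jordan_Normal_Form.Matrix"
begin

section \<open>Strict circular Robinson dissimilarities\<close>

definition dissimilarity_mat :: "nat \<Rightarrow> real mat \<Rightarrow> bool" where
  "dissimilarity_mat n A \<longleftrightarrow>
     A \<in> carrier_mat n n \<and>
     (\<forall>i<n. \<forall>j<n. 0 \<le> A $$ (i, j)) \<and>
     (\<forall>i<n. \<forall>j<n. A $$ (i, j) = A $$ (j, i)) \<and>
     (\<forall>i<n. A $$ (i, i) = 0)"

text \<open>The differences are taken in \<^typ>\<open>int\<close>, where \<open>mod\<close> has values in \<open>{0..<n}\<close>.\<close>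

definition cyclically_ordered :: "nat \<Rightarrow> nat \<Rightarrow> nat \<Rightarrow> nat \<Rightarrow> nat \<Rightarrow> bool" where
  "cyclically_ordered n i j k l \<longleftrightarrow>
     i < n \<and> j < n \<and> k < n \<and> l < n \<and> distinct [i, j, k, l] \<and>
     (int j - int i) mod int n < (int k - int i) mod int n \<and>
     (int k - int i) mod int n < (int l - int i) mod int n"

definition strict_circular_robinson :: "nat \<Rightarrow> real mat \<Rightarrow> bool" where
  "strict_circular_robinson n A \<longleftrightarrow>
     dissimilarity_mat n A \<and>
     (\<forall>i j k l. cyclically_ordered n i j k l \<longrightarrow>
        A $$ (i, k) > min (A $$ (j, k)) (A $$ (k, l)))"

definition permutation_mat :: "nat \<Rightarrow> (nat \<Rightarrow> nat) \<Rightarrow> real mat" where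
  "permutation_mat n p = mat n n (\<lambda>(i, j). if i = p j then 1 else 0)"

definition pre_strict_circular_robinson :: "nat \<Rightarrow> real mat \<Rightarrow> bool" where
  "pre_strict_circular_robinson n D \<longleftrightarrow>
     (\<exists>p A. p permutes {0..<n} \<and> strict_circular_robinson n A \<and>
        D = permutation_mat n p * A * transpose_mat (permutation_mat n p))"

definition circular_orderings :: "nat \<Rightarrow> real mat \<Rightarrow> (nat \<Rightarrow> nat) set" where
  "circular_orderings n D =
     {\<sigma>. \<sigma> permutes {0..<n} \<and>
        (\<exists>A. strict_circular_robinson n A \<and>
             (\<forall>a<n. \<forall>b<n. A $$ (\<sigma> a, \<sigma> b) = D $$ (a, b)))}"


section \<open>The dihedral group on \<open>{0..<n}\<close>\<close>

text \<open>A permutation of \<open>{0..<n}\<close> is a function on \<^typ>\<open>nat\<close> that is the identity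
  outside \<open>{0..<n}\<close>, as in \<^const>\<open>permutes\<close>.\<close>

definition perm_group :: "nat \<Rightarrow> (nat \<Rightarrow> nat) monoid" where
  "perm_group n = \<lparr>carrier = {p. p permutes {0..<n}}, monoid.mult = (\<circ>), one = id\<rparr>"

definition reflection_perm :: "nat \<Rightarrow> nat \<Rightarrow> nat" where
  "reflection_perm n i = (if i < n then n - 1 - i else i)"

definition shift_perm :: "nat \<Rightarrow> nat \<Rightarrow> nat" where
  "shift_perm n i = (if i < n then (i + 1) mod n else i)"

definition Dih :: "nat \<Rightarrow> (nat \<Rightarrow> nat) set" where
  "Dih n = generate (perm_group n) {reflection_perm n, shift_perm n}"


section \<open>PQ-trees\<close>

datatype pqtree = Leaf nat | PNode "pqtree list" | QNode "pqtree list"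

fun leaf_seq :: "pqtree \<Rightarrow> nat list" where
  "leaf_seq (Leaf x) = [x]"
| "leaf_seq (PNode ts) = concat (map leaf_seq ts)"
| "leaf_seq (QNode ts) = concat (map leaf_seq ts)"

text \<open>A node without children is a leaf of the tree, so internal nodes need at least one
  child; only then are the elements listed by \<^const>\<open>leaf_seq\<close> all the leaves.\<close>

fun proper_nodes :: "pqtree \<Rightarrow> bool" where
  "proper_nodes (Leaf x) \<longleftrightarrow> True"
| "proper_nodes (PNode ts) \<longleftrightarrow> ts \<noteq> [] \<and> (\<forall>t\<in>set ts. proper_nodes t)"
| "proper_nodes (QNode ts) \<longleftrightarrow> ts \<noteq> [] \<and> (\<forall>t\<in>set ts. proper_nodes t)"

definition pqtree_on :: "nat \<Rightarrow> pqtree \<Rightarrow> bool" where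
  "pqtree_on n T \<longleftrightarrow>
     proper_nodes T \<and> distinct (leaf_seq T) \<and> set (leaf_seq T) = {0..<n}"

inductive reordering :: "pqtree \<Rightarrow> pqtree \<Rightarrow> bool" where
  Leaf: "reordering (Leaf x) (Leaf x)"
| PNode: "list_all2 reordering ts us \<Longrightarrow> mset vs = mset us \<Longrightarrow> reordering (PNode ts) (PNode vs)"
| QNode: "list_all2 reordering ts us \<Longrightarrow> vs = us \<or> vs = rev us \<Longrightarrow> reordering (QNode ts) (QNode vs)"

definition pq_perms :: "nat \<Rightarrow> pqtree \<Rightarrow> (nat \<Rightarrow> nat) set" where
  "pq_perms n T =
     {\<pi>. \<pi> permutes {0..<n} \<and>
        (\<exists>T'. reordering T T' \<and> (\<forall>k<n. \<pi> (leaf_seq T' ! k) = k))}"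


section \<open>Model of computation\<close>

text \<open>
  Algorithms are programs of a random access machine with the uniform cost measure, written
  as structured programs. The memory consists of named arrays of natural numbers, of which a
  program mentions only finitely many; a scalar variable is cell 0 of an array. The arithmetic
  operations on memory contents are addition and truncated subtraction (no multiplication or
  bit operations). The real input matrix is read-only and accessible only through comparisons
  of two of its entries, so no real arithmetic is available. Each operation, memory
  access and comparison costs one time unit.
\<close>

type_synonym memory = "string \<Rightarrow> nat \<Rightarrow> nat"

datatype aexp =
    Const nat
  | Cell string aexp
  | Plus aexp aexp
  | Minus aexp aexp

datatype bexp =
    Less aexp aexp
  | EntryLess aexp aexp aexp aexp
  | BNot bexp
  | BAnd bexp bexp

datatype com =
    Skip
  | Assign string aexp aexp
  | Seq com com
  | Cond bexp com com
  | While bexp com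

fun aval :: "aexp \<Rightarrow> memory \<Rightarrow> nat" where
  "aval (Const c) s = c"
| "aval (Cell x a) s = s x (aval a s)"
| "aval (Plus a b) s = aval a s + aval b s"
| "aval (Minus a b) s = aval a s - aval b s"

fun acost :: "aexp \<Rightarrow> nat" where
  "acost (Const c) = 1"
| "acost (Cell x a) = 1 + acost a"
| "acost (Plus a b) = 1 + acost a + acost b"
| "acost (Minus a b) = 1 + acost a + acost b"

text \<open>Positions outside the matrix read as 0.\<close>

definition entry :: "real mat \<Rightarrow> nat \<Rightarrow> nat \<Rightarrow> real" where
  "entry D i j = (if i < dim_row D \<and> j < dim_col D then D $$ (i, j) else 0)"

fun bval :: "real mat \<Rightarrow> bexp \<Rightarrow> memory \<Rightarrow> bool" where
  "bval D (Less a b) s \<longleftrightarrow> aval a s < aval b s"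
| "bval D (EntryLess i j k l) s \<longleftrightarrow>
     entry D (aval i s) (aval j s) < entry D (aval k s) (aval l s)"
| "bval D (BNot b) s \<longleftrightarrow> \<not> bval D b s"
| "bval D (BAnd b c) s \<longleftrightarrow> bval D b s \<and> bval D c s"

fun bcost :: "bexp \<Rightarrow> nat" where
  "bcost (Less a b) = 1 + acost a + acost b"
| "bcost (EntryLess i j k l) = 1 + acost i + acost j + acost k + acost l"
| "bcost (BNot b) = 1 + bcost b"
| "bcost (BAnd b c) = 1 + bcost b + bcost c"

definition store :: "memory \<Rightarrow> string \<Rightarrow> nat \<Rightarrow> nat \<Rightarrow> memory" where
  "store s x i v = s(x := (s x)(i := v))"

text \<open>\<open>exec D c s t s'\<close>: on input matrix \<open>D\<close> and memory \<open>s\<close>, the program \<open>c\<close> terminates after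
  exactly \<open>t\<close> time units with memory \<open>s'\<close>.\<close>

inductive exec :: "real mat \<Rightarrow> com \<Rightarrow> memory \<Rightarrow> nat \<Rightarrow> memory \<Rightarrow> bool" for D where
  Skip: "exec D Skip s 1 s"
| Assign: "exec D (Assign x a b) s (1 + acost a + acost b) (store s x (aval a s) (aval b s))"
| Seq: "exec D c1 s t1 s1 \<Longrightarrow> exec D c2 s1 t2 s2 \<Longrightarrow> exec D (Seq c1 c2) s (t1 + t2) s2"
| CondTrue: "bval D b s \<Longrightarrow> exec D c1 s t s' \<Longrightarrow> exec D (Cond b c1 c2) s (1 + bcost b + t) s'"
| CondFalse: "\<not> bval D b s \<Longrightarrow> exec D c2 s t s' \<Longrightarrow> exec D (Cond b c1 c2) s (1 + bcost b + t) s'"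
| WhileFalse: "\<not> bval D b s \<Longrightarrow> exec D (While b c) s (1 + bcost b) s"
| WhileTrue: "bval D b s \<Longrightarrow> exec D c s t1 s1 \<Longrightarrow> exec D (While b c) s1 t2 s2 \<Longrightarrow>
    exec D (While b c) s (1 + bcost b + t1 + t2) s2"

lemma exec_deterministic:
  "exec D c s t s' \<Longrightarrow> exec D c s u s'' \<Longrightarrow> u = t \<and> s'' = s'"
proof (induction arbitrary: u s'' rule: exec.induct)
  case (Skip s)
  then show ?case by (auto elim: exec.cases)
next
  case (Assign x a b s)
  then show ?case by (auto elim: exec.cases)
next
  case (Seq c1 s t1 s1 c2 t2 s2)
  from Seq.prems show ?case by (cases rule: exec.cases) (use Seq.IH in blast)
next
  case (CondTrue b s c1 t s' c2)
  from CondTrue.prems show ?case by (cases rule: exec.cases) (use CondTrue in blast)+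
next
  case (CondFalse b s c2 t s' c1)
  from CondFalse.prems show ?case by (cases rule: exec.cases) (use CondFalse in blast)+
next
  case (WhileFalse b s c)
  from WhileFalse.prems show ?case by (cases rule: exec.cases) (use WhileFalse in blast)+
next
  case (WhileTrue b s c t1 s1 t2 s2)
  from WhileTrue.prems show ?case by (cases rule: exec.cases) (use WhileTrue in blast)+
qed

text \<open>The dimension is given in the scalar \<open>n\<close>; all other cells are initially 0.\<close>

definition initial_memory :: "nat \<Rightarrow> memory" where
  "initial_memory n = store (\<lambda>x i. 0) ''n'' 0 n"

text \<open>
  The output tree is stored as a linked structure. The node with address \<open>v\<close> has a type
  \<open>kind[v]\<close> (0 for a leaf, 1 for a P-node, 2 for a Q-node). A leaf has its label in
  \<open>label[v]\<close>; an internal node has the address of its first child in \<open>child[v]\<close>, and the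
  children of a node are linked through \<open>next\<close>, where address 0 ends the list.
\<close>

inductive tree_at :: "memory \<Rightarrow> nat \<Rightarrow> pqtree \<Rightarrow> bool"
  and forest_at :: "memory \<Rightarrow> nat \<Rightarrow> pqtree list \<Rightarrow> bool" for s where
  Leaf: "s ''kind'' v = 0 \<Longrightarrow> tree_at s v (Leaf (s ''label'' v))"
| PNode: "s ''kind'' v = 1 \<Longrightarrow> forest_at s (s ''child'' v) ts \<Longrightarrow> tree_at s v (PNode ts)"
| QNode: "s ''kind'' v = 2 \<Longrightarrow> forest_at s (s ''child'' v) ts \<Longrightarrow> tree_at s v (QNode ts)"
| Nil: "forest_at s 0 []"
| Cons: "v \<noteq> 0 \<Longrightarrow> tree_at s v t \<Longrightarrow> forest_at s (s ''next'' v) ts \<Longrightarrow> forest_at s v (t # ts)"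

definition outputs :: "memory \<Rightarrow> pqtree \<Rightarrow> bool" where
  "outputs s T \<longleftrightarrow> tree_at s (s ''root'' 0) T"

end

theory Submission
  imports Defs
begin

text \<open>
  If \<open>x\<close> and \<open>y\<close> are not neighbours in some valid circular order, then strict unimodality of the
  rows of \<open>x\<close> and \<open>y\<close> on the two arcs between them shows that each arc lies entirely closer than
  \<open>d x y\<close> to one of the two points. For an edge \<open>x y\<close> of the minimum spanning tree found by Prim's
  algorithm the two arcs then are the two sides of the cut, so the edge is heavier than all others.
  So every edge but the heaviest joins neighbours in all valid orders, and deleting the
  heaviest one leaves two paths \<open>K\<close> and \<open>K'\<close> that occur in all valid orders up to reversal. Up to
  the dihedral group only \<open>K K'\<close> and \<open>K (rev K')\<close> remain; which of them is valid can be read off, in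
  linear time, from the distances of all points to the four endpoints.
\<close>

section \<open>Cyclic order and the dihedral group\<close>

text \<open>The input is promised to admit a valid order, and the linear tests live on this promise:
  every valid order is, up to \<open>Dih n\<close>, one of two candidates, so at least one candidate
  is valid and the tests merely have to tell which. No candidate is ever verified over all
  quadruples, and the quadratic cost is that of Prim's algorithm with one linear scan per vertex.
  Ties are the delicate point. Several tree edges may share the maximal weight. The adjacency
  argument works with any heaviest edge; the last one in visiting order is deleted because every
  later vertex then hangs on a vertex visited no earlier than the endpoint of that edge. So the two
  components are an initial and a final segment of the visiting order, and each is grown as a path
  in one pass, without any search in the tree. Short paths are the other special case: the
  equivalence of tests and validity needs two points on each path, but a path with a single point
  equals its own reverse, and then both candidates are the same circular arrangement.\<close>

definition is_dihedral :: "nat \<Rightarrow> (nat \<Rightarrow> nat) \<Rightarrow> bool" where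
  "is_dihedral n \<rho> \<longleftrightarrow> \<rho> permutes {0..<n} \<and>
     (\<exists>e s. (e = 1 \<or> e = -1) \<and> (\<forall>i<n. int (\<rho> i) = (s + e * int i) mod int n))"

lemma is_dihedral_id: "is_dihedral n id"
  unfolding is_dihedral_def
  by (intro conjI permutes_id exI[of _ 1] exI[of _ 0]) auto

lemma is_dihedral_comp:
  assumes "is_dihedral n \<rho>" "is_dihedral n \<tau>"
  shows "is_dihedral n (\<rho> \<circ> \<tau>)"
proof -
  from assms(1) obtain e s where p: "\<rho> permutes {0..<n}" and e: "e = 1 \<or> e = -1"
    and es: "\<forall>i<n. int (\<rho> i) = (s + e * int i) mod int n"
    unfolding is_dihedral_def by blast
  from assms(2) obtain f t where q: "\<tau> permutes {0..<n}" and f: "f = 1 \<or> f = -1"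
    and ft: "\<forall>i<n. int (\<tau> i) = (t + f * int i) mod int n"
    unfolding is_dihedral_def by blast
  have "int (\<rho> (\<tau> i)) = (s + e * t + (e * f) * int i) mod int n" if "i < n" for i
  proof -
    have "\<tau> i < n" using permutes_in_image[OF q, of i] that by simp
    then have "int (\<rho> (\<tau> i)) = (s + e * ((t + f * int i) mod int n)) mod int n"
      using es ft that by simp
    also have "\<dots> = (s + e * (t + f * int i)) mod int n"
      by (metis mod_add_right_eq mod_mult_right_eq)
    also have "\<dots> = (s + e * t + (e * f) * int i) mod int n" by (simp add: algebra_simps)
    finally show ?thesis .
  qed
  moreover have "e * f = 1 \<or> e * f = -1" using e f by auto
  ultimately show ?thesis
    unfolding is_dihedral_def using permutes_compose[OF q p] by (metis comp_apply)
qed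

lemma is_dihedral_inv:
  assumes "is_dihedral n \<rho>"
  shows "is_dihedral n (inv_into UNIV \<rho>)"
proof -
  from assms obtain e s where p: "\<rho> permutes {0..<n}" and e: "e = 1 \<or> e = -1"
    and es: "\<forall>i<n. int (\<rho> i) = (s + e * int i) mod int n"
    unfolding is_dihedral_def by blast
  have "int (inv_into UNIV \<rho> i) = (- e * s + e * int i) mod int n" if "i < n" for i
  proof -
    let ?j = "inv_into UNIV \<rho> i"
    have j: "?j < n" using permutes_in_image[OF permutes_inv[OF p], of i] that by simp
    have "\<rho> ?j = i" using p by (simp add: permutes_inverses)
    then have i: "int i = (s + e * int ?j) mod int n" using es j by metis
    have "(- e * s + e * int i) mod int n = (- e * s + e * (s + e * int ?j)) mod int n"
      unfolding i by (metis mod_add_right_eq mod_mult_right_eq)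
    also have "- e * s + e * (s + e * int ?j) = int ?j" using e by auto
    finally show ?thesis using j by simp
  qed
  then show ?thesis
    unfolding is_dihedral_def using permutes_inv[OF p] e by blast
qed

lemma is_dihedral_reflection: "is_dihedral n (reflection_perm n)"
proof -
  have "bij_betw (reflection_perm n) {0..<n} {0..<n}"
    by (rule bij_betw_byWitness[of _ "reflection_perm n"]) (auto simp: reflection_perm_def)
  then have "reflection_perm n permutes {0..<n}"
    by (rule bij_imp_permutes) (simp add: reflection_perm_def)
  moreover have "int (reflection_perm n i) = (int n - 1 + (- 1) * int i) mod int n" if "i < n" for i
    using that by (simp add: reflection_perm_def)
  ultimately show ?thesis unfolding is_dihedral_def by blast
qed

lemma shift_perm_permutes: "shift_perm n permutes {0..<n}"
proof -
  have "inj_on (shift_perm n) {0..<n}"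
    by (auto simp: inj_on_def shift_perm_def mod_Suc split: if_splits)
  moreover have "shift_perm n ` {0..<n} \<subseteq> {0..<n}" by (auto simp: shift_perm_def)
  ultimately have "bij_betw (shift_perm n) {0..<n} {0..<n}"
    by (simp add: bij_betw_def endo_inj_surj)
  then show ?thesis by (rule bij_imp_permutes) (simp add: shift_perm_def)
qed

lemma is_dihedral_shift: "is_dihedral n (shift_perm n)"
proof -
  have "int (shift_perm n i) = (1 + 1 * int i) mod int n" if "i < n" for i
    using that by (simp add: shift_perm_def zmod_int add.commute)
  then show ?thesis unfolding is_dihedral_def using shift_perm_permutes by blast
qed

lemma perm_group_simps [simp]:
  "carrier (perm_group n) = {p. p permutes {0..<n}}"
  "x \<otimes>\<^bsub>perm_group n\<^esub> y = x \<circ> y"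
  "\<one>\<^bsub>perm_group n\<^esub> = id"
  by (simp_all add: perm_group_def)

lemma perm_group_group: "group (perm_group n)"
proof (rule groupI)
  fix p assume "p \<in> carrier (perm_group n)"
  then have p: "p permutes {0..<n}" by simp
  show "\<exists>y\<in>carrier (perm_group n). y \<otimes>\<^bsub>perm_group n\<^esub> p = \<one>\<^bsub>perm_group n\<^esub>"
    using permutes_inv[OF p] permutes_inv_o(2)[OF p] by auto
qed (auto simp: permutes_compose comp_assoc intro: permutes_id)

lemma perm_group_inv:
  assumes "p permutes {0..<n}"
  shows "inv\<^bsub>perm_group n\<^esub> p = inv_into UNIV p"
  by (rule group.inv_equality[OF perm_group_group])
    (use assms in \<open>auto simp: permutes_inv permutes_inv_o(2)\<close>)

text \<open>Residues replace words in the generators from here on. In the harder inclusion a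
  rotation is a power of the shift, and a map i -> s - i is a power of the shift after
  \<open>reflection_perm\<close>.\<close>

lemma Dih_eq: "Dih n = {\<rho>. is_dihedral n \<rho>}"
proof
  show "Dih n \<subseteq> {\<rho>. is_dihedral n \<rho>}"
  proof
    fix \<rho> assume "\<rho> \<in> Dih n"
    then have "\<rho> \<in> generate (perm_group n) {reflection_perm n, shift_perm n}"
      by (simp add: Dih_def)
    then have "is_dihedral n \<rho>"
    proof induction
      case (inv h)
      then have "is_dihedral n h" using is_dihedral_reflection is_dihedral_shift by auto
      then show ?case
        using perm_group_inv is_dihedral_inv by (metis is_dihedral_def)
    qed (auto simp del: id_apply comp_apply simp: is_dihedral_id is_dihedral_reflection
        is_dihedral_shift is_dihedral_comp is_dihedral_id[unfolded id_def])
    then show "\<rho> \<in> {\<rho>. is_dihedral n \<rho>}" by simp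
  qed
  show "{\<rho>. is_dihedral n \<rho>} \<subseteq> Dih n"
  proof
    fix \<rho> assume "\<rho> \<in> {\<rho>. is_dihedral n \<rho>}"
    then obtain e s where p: "\<rho> permutes {0..<n}" and e: "e = 1 \<or> e = -1"
      and es: "\<And>i. i < n \<Longrightarrow> int (\<rho> i) = (s + e * int i) mod int n"
      unfolding is_dihedral_def by blast
    let ?G = "generate (perm_group n) {reflection_perm n, shift_perm n}"
    have pow: "shift_perm n ^^ k \<in> ?G" for k
    proof (induction k)
      case 0
      then show ?case using generate.one[of "perm_group n"] by (simp add: id_def)
    next
      case (Suc k)
      then show ?case
        using generate.eng[OF generate.incl[of "shift_perm n"] Suc] by (simp add: comp_def)
    qed
    have step: "int (shift_perm n j) = (int j + 1) mod int n \<and> shift_perm n j < n" if "j < n" for j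
      using that by (simp add: shift_perm_def zmod_int add.commute)
    have powv: "int ((shift_perm n ^^ k) i) = (int k + int i) mod int n
        \<and> (shift_perm n ^^ k) i < n" if "i < n" for k i
    proof (induction k)
      case 0
      then show ?case using that by simp
    next
      case (Suc k)
      then have "int ((shift_perm n ^^ Suc k) i) = (int ((shift_perm n ^^ k) i) + 1) mod int n"
        using step by simp
      also have "\<dots> = (int k + int i + 1) mod int n" using Suc by (simp add: mod_add_left_eq)
      finally show ?case using Suc step by (simp add: algebra_simps)
    qed
    have out: "(shift_perm n ^^ k) i = i" if "\<not> i < n" for k i
      by (induction k) (use that in \<open>auto simp: shift_perm_def\<close>)
    from e show "\<rho> \<in> Dih n"
    proof
      assume e1: "e = 1"
      define k where "k = nat (s mod int n)"
      have "\<rho> = shift_perm n ^^ k"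
      proof
        fix i
        show "\<rho> i = (shift_perm n ^^ k) i"
        proof (cases "i < n")
          case True
          then have "int k = s mod int n" by (simp add: k_def)
          then have "int (\<rho> i) = int ((shift_perm n ^^ k) i)"
            using es[OF True] powv[OF True, of k] e1 by (simp add: mod_add_left_eq)
          then show ?thesis by simp
        next
          case False
          then show ?thesis using out permutes_not_in[OF p] by simp
        qed
      qed
      then show ?thesis using pow by (simp add: Dih_def)
    next
      assume e1: "e = -1"
      \<comment> \<open>The extra 1 compensates for the -1 in n - 1 - i, the value of
        \<open>reflection_perm\<close>.\<close>
      define k where "k = nat ((s + 1) mod int n)"
      have "\<rho> = (shift_perm n ^^ k) \<circ> reflection_perm n"
      proof
        fix i
        show "\<rho> i = ((shift_perm n ^^ k) \<circ> reflection_perm n) i"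
        proof (cases "i < n")
          case True
          then have k: "int k = (s + 1) mod int n" by (simp add: k_def)
          have r: "reflection_perm n i < n" "int (reflection_perm n i) = int n - 1 - int i"
            using True by (auto simp: reflection_perm_def)
          have "int ((shift_perm n ^^ k) (reflection_perm n i))
              = ((s + 1) mod int n + (int n - 1 - int i)) mod int n"
            using powv[OF r(1), of k] r k by simp
          also have "\<dots> = (s + 1 + (int n - 1 - int i)) mod int n" by (simp add: mod_add_left_eq)
          also have "s + 1 + (int n - 1 - int i) = (s - int i) + int n" by simp
          also have "(s - int i + int n) mod int n = int (\<rho> i)" using es[OF True] e1 by simp
          finally show ?thesis by simp
        next
          case False
          then show ?thesis using out permutes_not_in[OF p] by (simp add: reflection_perm_def)
        qed
      qed
      then show ?thesis
        using generate.eng[OF pow generate.incl[of "reflection_perm n"]]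
        by (simp add: Dih_def comp_def)
    qed
  qed
qed

text \<open>The four disjuncts are the rotations of one increasing quadruple. Without residues,
  later case distinctions become linear arithmetic.\<close>

lemma cyclically_ordered_linear:
  "cyclically_ordered n i j k l \<longleftrightarrow> i < n \<and> j < n \<and> k < n \<and> l < n \<and>
     (i < j \<and> j < k \<and> k < l \<or> j < k \<and> k < l \<and> l < i \<or>
      k < l \<and> l < i \<and> i < j \<or> l < i \<and> i < j \<and> j < k)"
proof -
  have m: "(int y - int x) mod int n = (if x \<le> y then int y - int x else int y - int x + int n)"
    if "x < n" "y < n" for x y
  proof (cases "x \<le> y")
    case False
    have "(int y - int x) mod int n = (int y - int x + int n) mod int n" by simp
    also have "\<dots> = int y - int x + int n" using that False by (intro mod_pos_pos_trivial) auto
    finally show ?thesis using False by simp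
  qed (use that in simp)
  show ?thesis
    unfolding cyclically_ordered_def
    by (cases "i < n \<and> j < n \<and> k < n \<and> l < n") (auto simp: m)
qed

lemma cyclically_ordered_rotate:
  "cyclically_ordered n i j k l \<Longrightarrow> cyclically_ordered n j k l i"
  unfolding cyclically_ordered_linear by blast

text \<open>A reflection reverses the circle, and reversing a quadruple while keeping
  \<open>i\<close> in front exchanges \<open>j\<close> and \<open>l\<close>. For symmetric matrices
  the Robinson inequality is symmetric in these two, so both outcomes are equally good.\<close>

lemma is_dihedral_cyclically_ordered:
  assumes "is_dihedral n \<rho>" "cyclically_ordered n i j k l"
  shows "cyclically_ordered n (\<rho> i) (\<rho> j) (\<rho> k) (\<rho> l) \<or>
         cyclically_ordered n (\<rho> i) (\<rho> l) (\<rho> k) (\<rho> j)"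
proof -
  from assms(1) obtain e s where p: "\<rho> permutes {0..<n}" and e: "e = 1 \<or> e = -1"
    and es: "\<And>i. i < n \<Longrightarrow> int (\<rho> i) = (s + e * int i) mod int n"
    unfolding is_dihedral_def by blast
  have lt: "i < n" "j < n" "k < n" "l < n" and d: "distinct [i, j, k, l]"
    and c: "(int j - int i) mod int n < (int k - int i) mod int n"
      "(int k - int i) mod int n < (int l - int i) mod int n"
    using assms(2) by (auto simp: cyclically_ordered_def)
  have lt': "\<rho> i < n" "\<rho> j < n" "\<rho> k < n" "\<rho> l < n"
    using lt permutes_in_image[OF p] by (metis atLeastLessThan_iff le0)+
  have d': "distinct [\<rho> i, \<rho> j, \<rho> k, \<rho> l]"
    using d permutes_inj[OF p] by (auto dest: injD)
  have diff: "(int (\<rho> x) - int (\<rho> y)) mod int n = (e * (int x - int y)) mod int n"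
    if "x < n" "y < n" for x y
    using es that by (simp add: mod_diff_eq algebra_simps)
  from e show ?thesis
  proof
    assume "e = 1"
    then show ?thesis using lt' d' c lt by (simp add: cyclically_ordered_def diff)
  next
    assume e1: "e = -1"
    \<comment> \<open>Negating a nonzero residue r gives n - r, so the differences from
      \<open>i\<close> are compared the other way round; distinctness of the points excludes r =
      0.\<close>
    have neg: "(int y - int x) mod int n = int n - (int x - int y) mod int n"
      if "x < n" "y < n" "x \<noteq> y" for x y
    proof -
      have "\<not> int n dvd (int x - int y)"
        using that by (metis dvd_imp_le_int abs_diff_less_iff mod_eq_dvd_iff mod_pos_pos_trivial
            of_nat_0_le_iff of_nat_eq_iff of_nat_less_iff)
      then have "(int x - int y) mod int n \<noteq> 0" by (simp add: dvd_eq_mod_eq_0)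
      then have "(- (int x - int y)) mod int n = int n - (int x - int y) mod int n"
        by (metis zmod_zminus1_eq_if)
      then show ?thesis by (simp only: minus_diff_eq)
    qed
    have "(int (\<rho> l) - int (\<rho> i)) mod int n < (int (\<rho> k) - int (\<rho> i)) mod int n"
      "(int (\<rho> k) - int (\<rho> i)) mod int n < (int (\<rho> j) - int (\<rho> i)) mod int n"
      using c lt d neg[of j i] neg[of k i] neg[of l i] by (auto simp: diff e1)
    then show ?thesis using lt' d' by (auto simp: cyclically_ordered_def)
  qed
qed

section \<open>Valid orders\<close>

text \<open>Indices are positions on the circle here, but elements placed by \<sigma> in
  \<open>valid_order\<close>. The position form is the one in which paths are intervals.\<close>

definition circ_valid :: "nat \<Rightarrow> (nat \<Rightarrow> nat \<Rightarrow> real) \<Rightarrow> bool" where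
  "circ_valid n E \<longleftrightarrow>
     (\<forall>i j k l. cyclically_ordered n i j k l \<longrightarrow> min (E j k) (E k l) < E i k)"

definition valid_order :: "nat \<Rightarrow> (nat \<Rightarrow> nat \<Rightarrow> real) \<Rightarrow> (nat \<Rightarrow> nat) \<Rightarrow> bool" where
  "valid_order n d \<sigma> \<longleftrightarrow> \<sigma> permutes {0..<n} \<and>
     (\<forall>i j k l. cyclically_ordered n (\<sigma> i) (\<sigma> j) (\<sigma> k) (\<sigma> l) \<longrightarrow> min (d j k) (d k l) < d i k)"

definition dissimilarity :: "nat \<Rightarrow> (nat \<Rightarrow> nat \<Rightarrow> real) \<Rightarrow> bool" where
  "dissimilarity n d \<longleftrightarrow>
     (\<forall>i<n. \<forall>j<n. 0 \<le> d i j \<and> d i j = d j i) \<and> (\<forall>i<n. d i i = 0)"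

lemma permutes_less_iff: "\<sigma> permutes {0..<n} \<Longrightarrow> \<sigma> i < n \<longleftrightarrow> i < n" for i n :: nat
  using permutes_in_image[of \<sigma> "{0..<n}" i] by simp

text \<open>Since \<sigma> is a bijection, the matrix A of the definition is determined by \<sigma>
  and D; eliminating it leaves inequalities between entries of D.\<close>

lemma circular_orderings_eq:
  assumes "dissimilarity_mat n D"
  shows "circular_orderings n D = {\<sigma>. valid_order n (\<lambda>i j. D $$ (i, j)) \<sigma>}"
proof (intro equalityI subsetI)
  fix \<sigma> assume "\<sigma> \<in> circular_orderings n D"
  then obtain A where p: "\<sigma> permutes {0..<n}" and A: "strict_circular_robinson n A"
    and AD: "\<forall>a<n. \<forall>b<n. A $$ (\<sigma> a, \<sigma> b) = D $$ (a, b)"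
    unfolding circular_orderings_def by blast
  have "min (D $$ (j, k)) (D $$ (k, l)) < D $$ (i, k)"
    if c: "cyclically_ordered n (\<sigma> i) (\<sigma> j) (\<sigma> k) (\<sigma> l)" for i j k l
  proof -
    have "i < n" "j < n" "k < n" "l < n"
      using c permutes_less_iff[OF p] by (auto simp: cyclically_ordered_def)
    moreover have "min (A $$ (\<sigma> j, \<sigma> k)) (A $$ (\<sigma> k, \<sigma> l)) < A $$ (\<sigma> i, \<sigma> k)"
      using A c unfolding strict_circular_robinson_def by blast
    ultimately show ?thesis using AD by simp
  qed
  then show "\<sigma> \<in> {\<sigma>. valid_order n (\<lambda>i j. D $$ (i, j)) \<sigma>}"
    using p by (simp add: valid_order_def)
next
  fix \<sigma> assume "\<sigma> \<in> {\<sigma>. valid_order n (\<lambda>i j. D $$ (i, j)) \<sigma>}"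
  then have p: "\<sigma> permutes {0..<n}" and
    v: "\<And>i j k l. cyclically_ordered n (\<sigma> i) (\<sigma> j) (\<sigma> k) (\<sigma> l) \<Longrightarrow>
      min (D $$ (j, k)) (D $$ (k, l)) < D $$ (i, k)"
    unfolding valid_order_def by auto
  let ?t = "inv_into UNIV \<sigma>"
  define A where "A = mat n n (\<lambda>(i, j). D $$ (?t i, ?t j))"
  have t: "i < n \<Longrightarrow> ?t i < n" for i using permutes_less_iff[OF permutes_inv[OF p]] by simp
  have st: "\<sigma> (?t i) = i" "?t (\<sigma> i) = i" for i using permutes_inverses[OF p] by auto
  have "dissimilarity_mat n A"
    using assms t unfolding dissimilarity_mat_def A_def by auto
  moreover have "min (A $$ (j, k)) (A $$ (k, l)) < A $$ (i, k)"
    if c: "cyclically_ordered n i j k l" for i j k l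
  proof -
    have "i < n" "j < n" "k < n" "l < n" using c by (auto simp: cyclically_ordered_def)
    then show ?thesis using v[of "?t i" "?t j" "?t k" "?t l"] c by (simp add: st A_def)
  qed
  ultimately have "strict_circular_robinson n A" by (simp add: strict_circular_robinson_def)
  moreover have "\<forall>a<n. \<forall>b<n. A $$ (\<sigma> a, \<sigma> b) = D $$ (a, b)"
    using permutes_less_iff[OF p] by (simp add: A_def st)
  ultimately show "\<sigma> \<in> circular_orderings n D"
    using p unfolding circular_orderings_def by blast
qed

text \<open>Injectivity of \<open>p\<close> leaves a single nonzero term in each of the two matrix
  products.\<close>

lemma permutation_mat_conj_index:
  assumes p: "p permutes {0..<n}" and A: "A \<in> carrier_mat n n" and ij: "i < n" "j < n"
  shows "(permutation_mat n p * A * transpose_mat (permutation_mat n p)) $$ (p i, p j) = A $$ (i, j)"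
proof -
  let ?P = "permutation_mat n p"
  have lt: "p i < n" "p j < n" using ij permutes_less_iff[OF p] by auto
  have inj: "p x = p y \<longleftrightarrow> x = y" for x y using permutes_inj[OF p] by (auto dest: injD)
  have PA: "(?P * A) $$ (p i, l) = A $$ (i, l)" if "l < n" for l
  proof -
    have "(?P * A) $$ (p i, l) = (\<Sum>k = 0..<n. (if p i = p k then 1 else 0) * A $$ (k, l))"
      using that lt A by (simp add: permutation_mat_def scalar_prod_def)
    also have "\<dots> = (\<Sum>k = 0..<n. if i = k then A $$ (k, l) else 0)"
      by (intro sum.cong refl) (simp add: inj)
    also have "\<dots> = A $$ (i, l)" using ij by simp
    finally show ?thesis .
  qed
  have "(?P * A * transpose_mat ?P) $$ (p i, p j)
      = (\<Sum>k = 0..<n. (?P * A) $$ (p i, k) * (if p j = p k then 1 else 0))"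
    using lt A by (simp add: permutation_mat_def scalar_prod_def)
  also have "\<dots> = (\<Sum>k = 0..<n. if j = k then A $$ (i, k) else 0)"
    by (intro sum.cong refl) (simp add: inj PA)
  also have "\<dots> = A $$ (i, j)" using ij by simp
  finally show ?thesis .
qed

lemma pre_strict_circular_robinson_cases:
  assumes "pre_strict_circular_robinson n D"
  obtains \<sigma> where "dissimilarity_mat n D" "valid_order n (\<lambda>i j. D $$ (i, j)) \<sigma>"
proof -
  from assms obtain p A where p: "p permutes {0..<n}" and A: "strict_circular_robinson n A"
    and D: "D = permutation_mat n p * A * transpose_mat (permutation_mat n p)"
    unfolding pre_strict_circular_robinson_def by blast
  have Ad: "dissimilarity_mat n A" using A by (simp add: strict_circular_robinson_def)
  then have Ac: "A \<in> carrier_mat n n" by (simp add: dissimilarity_mat_def)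
  let ?t = "inv_into UNIV p"
  have t: "i < n \<Longrightarrow> ?t i < n" for i using permutes_less_iff[OF permutes_inv[OF p]] by simp
  have st: "p (?t i) = i" for i using permutes_inverses[OF p] by auto
  have ind: "D $$ (i, j) = A $$ (?t i, ?t j)" if "i < n" "j < n" for i j
    using permutation_mat_conj_index[OF p Ac, of "?t i" "?t j"] that t by (simp add: st D)
  have Dc: "D \<in> carrier_mat n n" unfolding D permutation_mat_def using Ac by auto
  have "dissimilarity_mat n D"
    using Ad t Dc unfolding dissimilarity_mat_def by (simp add: ind)
  \<comment> \<open>Row \<open>p i\<close> of D is row i of A, so the position of an element is its
    preimage under \<open>p\<close>.\<close>
  moreover have "valid_order n (\<lambda>i j. D $$ (i, j)) ?t"
    unfolding valid_order_def
  proof (intro conjI allI impI)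
    show "?t permutes {0..<n}" by (rule permutes_inv[OF p])
    fix i j k l assume c: "cyclically_ordered n (?t i) (?t j) (?t k) (?t l)"
    then have "i < n" "j < n" "k < n" "l < n"
      using permutes_less_iff[OF permutes_inv[OF p]] by (auto simp: cyclically_ordered_def)
    then show "min (D $$ (j, k)) (D $$ (k, l)) < D $$ (i, k)"
      using A c unfolding strict_circular_robinson_def by (simp add: ind)
  qed
  ultimately show thesis by (rule that)
qed

section \<open>Adjacent elements\<close>

text \<open>Writing \<open>1 mod int n\<close> makes this the congruence b - a = 1 or -1 for every
  n, so it survives residue manipulations without side conditions on n.\<close>

definition cyc_adjacent :: "nat \<Rightarrow> nat \<Rightarrow> nat \<Rightarrow> bool" where
  "cyc_adjacent n a b \<longleftrightarrow>
     (int b - int a) mod int n = 1 mod int n \<or> (int a - int b) mod int n = 1 mod int n"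

lemma cyc_adjacent_sym: "cyc_adjacent n a b \<longleftrightarrow> cyc_adjacent n b a"
  by (auto simp: cyc_adjacent_def)

lemma mod_diff_cancel:
  assumes "(int a - c) mod int n = (int b - c) mod int n" "a < n" "b < n"
  shows "a = b"
proof -
  have "(int a - c + c) mod int n = (int b - c + c) mod int n"
    using assms(1) by (metis mod_add_left_eq)
  then show ?thesis using assms(2,3) by simp
qed

lemma mod_diff_cancel':
  assumes "(c - int a) mod int n = (c - int b) mod int n" "a < n" "b < n"
  shows "a = b"
proof -
  have "(c - (c - int a)) mod int n = (c - (c - int b)) mod int n"
    using assms(1) by (metis mod_diff_right_eq)
  then show ?thesis using assms(2,3) by simp
qed

text \<open>A point of the circle has one successor and one predecessor, so two of any three
  neighbours coincide. This is what forbids branching when tree edges are strung together.\<close>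

lemma cyc_adjacent_three:
  assumes "cyc_adjacent n q a" "cyc_adjacent n q b" "cyc_adjacent n q c" "a < n" "b < n" "c < n"
  shows "\<not> distinct [a, b, c]"
  using assms mod_diff_cancel[of _ "int q" n] mod_diff_cancel'[of "int q" _ n]
  unfolding cyc_adjacent_def by (metis distinct_length_2_or_more)

text \<open>Seen from \<open>x\<close>, strict unimodality makes one of the two arcs between \<open>x\<close> and a
  non-neighbour \<open>y\<close> lie entirely closer to \<open>x\<close> than \<open>y\<close>; likewise seen from \<open>y\<close>.\<close>

lemma nonadjacent_split:
  assumes v: "valid_order n d \<sigma>" and xy: "x < n" "y < n" "x \<noteq> y"
    and na: "\<not> cyc_adjacent n (\<sigma> x) (\<sigma> y)"
    and sym: "\<And>i j. i < n \<Longrightarrow> j < n \<Longrightarrow> d i j = d j i"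
    and no: "\<And>u. u < n \<Longrightarrow> u \<noteq> x \<Longrightarrow> u \<noteq> y \<Longrightarrow> \<not> (d x u < d x y \<and> d y u < d x y)"
    and a: "a < n" "a \<noteq> x" "a \<noteq> y"
  shows "d x a < d x y \<or> d y a < d x y"
proof -
  have p: "\<sigma> permutes {0..<n}" using v by (simp add: valid_order_def)
  have lt: "\<sigma> u < n \<longleftrightarrow> u < n" for u using permutes_less_iff[OF p] .
  have inj: "\<sigma> u = \<sigma> w \<longleftrightarrow> u = w" for u w using permutes_inj[OF p] by (auto dest: injD)
  \<comment> \<open>The offset from \<open>x\<close> along the circle turns the two open arcs
    between \<open>x\<close> and \<open>y\<close> into the ranges of offsets below and above
    \<open>f y\<close>.\<close>
  define f where "f u = (int (\<sigma> u) - int (\<sigma> x)) mod int n" for u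
  have n: "n > 1" using xy by auto
  have finj: "f u = f w \<Longrightarrow> u = w" if "u < n" "w < n" for u w
    using mod_diff_cancel[of "\<sigma> u" "int (\<sigma> x)" n "\<sigma> w"] that lt inj by (simp add: f_def)
  have f0: "f x = 0" by (simp add: f_def)
  have fb: "0 \<le> f u" "f u < int n" for u using n by (auto simp: f_def)
  have surj: "\<exists>u<n. f u = t" if "0 \<le> t" "t < int n" for t
  proof -
    define w where "w = nat ((t + int (\<sigma> x)) mod int n)"
    have w: "int w = (t + int (\<sigma> x)) mod int n" using n by (simp add: w_def)
    have "w < n" proof -
      have "int w < int n" using n by (simp add: w)
      then show ?thesis by simp
    qed
    have "f (inv_into UNIV \<sigma> w) = t"
    proof -
      have "f (inv_into UNIV \<sigma> w) = ((t + int (\<sigma> x)) mod int n - int (\<sigma> x)) mod int n"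
        by (simp add: f_def permutes_inverses[OF p] w)
      also have "\<dots> = (t + int (\<sigma> x) - int (\<sigma> x)) mod int n" by (rule mod_diff_left_eq)
      finally show ?thesis using that by simp
    qed
    moreover have "inv_into UNIV \<sigma> w < n"
      using permutes_less_iff[OF permutes_inv[OF p]] \<open>w < n\<close> by simp
    ultimately show ?thesis by blast
  qed
  define U where "U = {u. u < n \<and> 0 < f u \<and> f u < f y}"
  define W where "W = {u. u < n \<and> f y < f u}"
  have quad: "cyclically_ordered n (\<sigma> x) (\<sigma> u) (\<sigma> y) (\<sigma> w)" if "u \<in> U" "w \<in> W" for u w
  proof -
    have "u \<noteq> x" "w \<noteq> x" using that f0 fb[of y] by (auto simp: U_def W_def)
    then show ?thesis
      using that xy f0 unfolding cyclically_ordered_def U_def W_def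
      by (auto simp: lt inj f_def[symmetric])
  qed
  \<comment> \<open>Offsets 1 and n - 1 belong to the two neighbours of \<open>x\<close>. As
    \<open>y\<close> is neither, these neighbours lie on the two arcs, and both arcs are
    nonempty.\<close>
  have fy: "f y \<noteq> 0" "f y \<noteq> 1" "f y \<noteq> int n - 1"
  proof -
    show "f y \<noteq> 0" using finj[of y x] f0 xy by auto
    show "f y \<noteq> 1" using na n by (auto simp: f_def cyc_adjacent_def)
    show "f y \<noteq> int n - 1"
    proof
      assume h: "f y = int n - 1"
      have "(int (\<sigma> x) - int (\<sigma> y)) mod int n = (- f y) mod int n"
        unfolding f_def by (simp add: mod_minus_eq)
      also have "\<dots> = (1 - int n) mod int n" by (simp add: h)
      also have "\<dots> = 1 mod int n" by (metis mod_diff_right_eq mod_self diff_zero)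
      finally show False using na by (simp add: cyc_adjacent_def)
    qed
  qed
  obtain u0 where u0: "u0 < n" "f u0 = 1" using surj[of 1] n by auto
  obtain w0 where w0: "w0 < n" "f w0 = int n - 1" using surj[of "int n - 1"] n by auto
  have u0U: "u0 \<in> U" and w0W: "w0 \<in> W"
    using u0 w0 fy fb[of y] by (auto simp: U_def W_def)
  have UW: "a \<in> U \<or> a \<in> W"
    using a fb[of a] finj[of a x] finj[of a y] f0 xy by (fastforce simp: U_def W_def)
  have ne: "b < n" "b \<noteq> x" "b \<noteq> y" if "b \<in> U \<or> b \<in> W" for b
    using that f0 fy fb[of y] by (auto simp: U_def W_def)
  have rx: "d x u < d x y \<or> d x w < d x y" and ry: "d y u < d x y \<or> d y w < d x y"
    if "u \<in> U" "w \<in> W" for u w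
  proof -
    have c: "cyclically_ordered n (\<sigma> x) (\<sigma> u) (\<sigma> y) (\<sigma> w)" using quad that .
    have "min (d u y) (d y w) < d x y" using v c unfolding valid_order_def by blast
    then show "d y u < d x y \<or> d y w < d x y"
      using sym[of u y] ne[of u] that xy by (auto simp: min_less_iff_disj)
    \<comment> \<open>The same quadruple rotated by two places, which exchanges the roles of
      \<open>x\<close> and \<open>y\<close>.\<close>
    have "min (d w x) (d x u) < d y x"
      using v cyclically_ordered_rotate[OF cyclically_ordered_rotate[OF c]]
      unfolding valid_order_def by blast
    then show "d x u < d x y \<or> d x w < d x y"
      using sym[of w x] sym[of x y] ne[of w] that xy by (auto simp: min_less_iff_disj)
  qed
  have no': "\<not> (d x b < d x y \<and> d y b < d x y)" if "b \<in> U \<or> b \<in> W" for b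
    using no ne that by blast
  \<comment> \<open>Pair \<open>a\<close> with \<open>u0\<close> or \<open>w0\<close> on the
    opposite arc. Each of \<open>x\<close> and \<open>y\<close> is close to a member of the pair; if
    \<open>a\<close> were close to neither, its partner would be close to both, which
    \<open>no'\<close> forbids.\<close>
  show ?thesis
    using UW u0U w0W rx ry no' by blast
qed

section \<open>Prim's tree\<close>

text \<open>The tree is described by the cut property of each step instead of minimal total weight,
  because later arguments compare a tree edge with a single pair crossing its cut. \<open>v\<close>
  is the visiting order, and \<open>p\<close> gives parents.\<close>

definition prim_tree :: "nat \<Rightarrow> (nat \<Rightarrow> nat \<Rightarrow> real) \<Rightarrow> (nat \<Rightarrow> nat) \<Rightarrow> (nat \<Rightarrow> nat) \<Rightarrow> bool" where
  "prim_tree n d v p \<longleftrightarrow> inj_on v {..<n} \<and> v ` {..<n} = {..<n} \<and>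
     (\<forall>i. 0 < i \<and> i < n \<longrightarrow> p (v i) \<in> v ` {..<i} \<and>
        (\<forall>a\<in>v ` {..<i}. \<forall>u\<in>v ` {i..<n}. d (p (v i)) (v i) \<le> d a u))"

text \<open>The strict last clause breaks ties in favour of the latest edge, so that deleting the
  edge cuts the visiting order into two consecutive segments.\<close>

definition last_heaviest :: "nat \<Rightarrow> (nat \<Rightarrow> nat \<Rightarrow> real) \<Rightarrow> (nat \<Rightarrow> nat) \<Rightarrow> (nat \<Rightarrow> nat) \<Rightarrow> nat \<Rightarrow> bool" where
  "last_heaviest n d v p m \<longleftrightarrow> 0 < m \<and> m < n \<and>
     (\<forall>i. 0 < i \<and> i < n \<longrightarrow> d (p (v i)) (v i) \<le> d (p (v m)) (v m)) \<and>
     (\<forall>i. m < i \<and> i < n \<longrightarrow> d (p (v i)) (v i) < d (p (v m)) (v m))"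

text \<open>If the tree edge \<open>x y\<close> is not an adjacency, then the two arcs between \<open>x\<close> and \<open>y\<close> are
  the two sides of the cut at which Prim's algorithm chose this edge, and all points of a side are
  closer than \<open>d x y\<close> to the endpoint on that side. All other edges are therefore lighter.\<close>

lemma prim_tree_adjacent:
  assumes v: "valid_order n d \<sigma>"
    and sym: "\<And>i j. i < n \<Longrightarrow> j < n \<Longrightarrow> d i j = d j i"
    and P: "prim_tree n d v p" and H: "last_heaviest n d v p m"
    and i: "0 < i" "i < n" "i \<noteq> m"
  shows "cyc_adjacent n (\<sigma> (p (v i))) (\<sigma> (v i))"
proof (rule ccontr)
  assume na: "\<not> cyc_adjacent n (\<sigma> (p (v i))) (\<sigma> (v i))"
  define x y w where "x = p (v i)" and "y = v i" and "w = d x y"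
  have vlt: "v j < n" if "j < n" for j
    using P that unfolding prim_tree_def by blast
  have vinj: "v j = v k \<Longrightarrow> j = k" if "j < n" "k < n" for j k
    using P that unfolding prim_tree_def inj_on_def by auto
  have min: "d (p (v j)) (v j) \<le> d (v a) (v u)" if "0 < j" "j < n" "a < j" "j \<le> u" "u < n" for j a u
    using P that unfolding prim_tree_def by auto
  have par: "\<exists>k<j. p (v j) = v k" if "0 < j" "j < n" for j
    using P that unfolding prim_tree_def by auto
  obtain k where k: "k < i" "x = v k" using par[OF i(1,2)] by (auto simp: x_def)
  have m: "0 < m" "m < n" and wm: "w \<le> d (p (v m)) (v m)"
    using H i by (auto simp: last_heaviest_def w_def x_def y_def)
  have mini: "w \<le> d (v a) (v u)" if "a < i" "i \<le> u" "u < n" for a u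
    using min[of i a u] that i by (simp add: w_def x_def y_def)
  have idx: "\<exists>j<n. u = v j" if "u < n" for u
    using P that unfolding prim_tree_def by (metis imageE lessThan_iff)
  have split: "d x a < w \<or> d y a < w" if "a < n" "a \<noteq> x" "a \<noteq> y" for a
    unfolding w_def
  proof (rule nonadjacent_split[OF v _ _ _ _ sym])
    show "x < n" "y < n" using k i vlt by (auto simp: y_def)
    show "x \<noteq> y" using k i vinj[of k i] by (auto simp: y_def)
    show "\<not> cyc_adjacent n (\<sigma> x) (\<sigma> y)" using na by (simp add: x_def y_def)
    fix u assume u: "u < n" "u \<noteq> x" "u \<noteq> y"
    then obtain j where j: "j < n" "u = v j" using idx by blast
    \<comment> \<open>A third point lies on one side of the cut that produced the edge, and the
      endpoint on the other side is then at distance at least \<open>w\<close> from it.\<close>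
    show "\<not> (d x u < d x y \<and> d y u < d x y)"
    proof (cases "j < i")
      case True
      then have "w \<le> d y u"
        using mini[of j i] sym[of u y] vlt[of i] u i j by (simp add: y_def)
      then show ?thesis by (simp add: w_def)
    next
      case False
      then have "w \<le> d x u" using mini[of k j] k j by simp
      then show ?thesis by (simp add: w_def)
    qed
  qed (use that in auto)
  have low: "d x (v j) < w" if "j < i" "j \<noteq> k" for j
  proof -
    have "v j \<noteq> x" "v j \<noteq> y" "v j < n"
      using vinj[of j k] vinj[of j i] that k i vlt by (auto simp: y_def)
    moreover have "w \<le> d y (v j)"
      using mini[of j i] sym[of "v j" y] vlt[of i] \<open>v j < n\<close> that i by (simp add: y_def)
    ultimately show ?thesis using split[of "v j"] by linarith
  qed
  have high: "d y (v j) < w" if "i < j" "j < n" for j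
  proof -
    have "v j \<noteq> x" "v j \<noteq> y" "v j < n"
      using vinj[of j k] vinj[of j i] that k i vlt by (auto simp: y_def)
    moreover have "w \<le> d x (v j)" using mini[of k j] that k by simp
    ultimately show ?thesis using split[of "v j"] by linarith
  qed
  show False
  \<comment> \<open>In each case a pair just shown to be closer than \<open>w\<close> crosses the
    cut of step \<open>m\<close>: \<open>v i\<close> with \<open>v m\<close>, \<open>v k\<close>
    with \<open>v m\<close>, or \<open>v 0\<close> with \<open>v k\<close>. The edge of step
    \<open>m\<close> would then be lighter than \<open>w\<close>, although its weight is
    maximal.\<close>
  proof (cases "i < m")
    case True
    then show False using high[of m] min[of m i m] m wm by (simp add: y_def)
  next
    case False
    then have mi: "m < i" using i by simp
    show False
    proof (cases "k < m")
      case True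
      then show False using low[of m] min[of m k m] m mi wm k by simp
    next
      case False
      then have "d x (v 0) < w" using low[of 0] m i by auto
      moreover have "d (p (v m)) (v m) \<le> d (v 0) (v k)" using min[of m 0 k] False m k i by simp
      ultimately show False using wm k i sym[of "v 0" "v k"] vlt by simp
    qed
  qed
qed

text \<open>A parent with index below \<open>m\<close> would make the edge cross the cut of step
  \<open>m\<close>, so it would weigh at least as much as the edge chosen there; the strict clause
  of \<open>last_heaviest\<close> excludes this. Hence the vertices from index \<open>m\<close> on
  form a tree of their own.\<close>

lemma prim_tree_parent_after:
  assumes P: "prim_tree n d v p" and H: "last_heaviest n d v p m" and i: "m < i" "i < n"
  shows "p (v i) \<in> v ` {m..<i}"
proof -
  have "p (v i) \<in> v ` {..<i}" using P i unfolding prim_tree_def by auto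
  then obtain k where k: "k < i" "p (v i) = v k" by auto
  have "\<not> k < m"
  proof
    assume "k < m"
    then have "d (p (v m)) (v m) \<le> d (v k) (v i)"
      using P H i unfolding prim_tree_def last_heaviest_def by auto
    moreover have "d (p (v i)) (v i) < d (p (v m)) (v m)"
      using H i unfolding last_heaviest_def by blast
    ultimately show False using k by simp
  qed
  then show ?thesis using k by auto
qed

text \<open>Only the last element is compared with the parent; otherwise the parent is presumed to
  be the head. \<open>successively_grow\<close> shows the presumption to be right when all tree
  edges involved are adjacencies.\<close>

primrec grow :: "(nat \<Rightarrow> nat) \<Rightarrow> (nat \<Rightarrow> nat) \<Rightarrow> nat \<Rightarrow> nat \<Rightarrow> nat list" where
  "grow v p a 0 = [v a]"
| "grow v p a (Suc k) = (let L = grow v p a k; x = v (a + Suc k)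
     in if last L = p x then L @ [x] else x # L)"

lemma length_grow [simp]: "length (grow v p a k) = Suc k"
  by (induction k) (auto simp: Let_def)

lemma grow_ne [simp]: "grow v p a k \<noteq> []"
  using length_grow[of v p a k] by fastforce

lemma set_grow: "set (grow v p a k) = v ` {a..a + k}"
  by (induction k) (auto simp: Let_def atLeastAtMostSuc_conv)

lemma distinct_grow: "inj_on v {a..a + k} \<Longrightarrow> distinct (grow v p a k)"
proof (induction k)
  case (Suc k)
  have "inj_on v {a..a + k}" using Suc.prems by (rule inj_on_subset) auto
  moreover have "v (a + Suc k) \<notin> v ` {a..a + k}"
  proof
    assume "v (a + Suc k) \<in> v ` {a..a + k}"
    then obtain j where "a \<le> j" "j \<le> a + k" "v (a + Suc k) = v j" by auto
    then show False using inj_onD[OF Suc.prems, of "a + Suc k" j] by auto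
  qed
  ultimately show ?case using Suc.IH by (auto simp: Let_def set_grow)
qed simp

abbreviation cyc_path :: "nat \<Rightarrow> (nat \<Rightarrow> nat) \<Rightarrow> nat list \<Rightarrow> bool" where
  "cyc_path n \<sigma> \<equiv> successively (\<lambda>x y. cyc_adjacent n (\<sigma> x) (\<sigma> y))"

text \<open>An inner vertex of the path has already used up its two neighbours on the circle, so the
  edge to a new vertex can start only at an end of the path.\<close>

lemma successively_grow:
  assumes p: "\<sigma> permutes {0..<n}" and inj: "inj_on v {..<n}" and vlt: "\<And>i. i < n \<Longrightarrow> v i < n"
    and adj: "\<And>i. a < i \<Longrightarrow> i \<le> a + k \<Longrightarrow> cyc_adjacent n (\<sigma> (p (v i))) (\<sigma> (v i))"
    and par: "\<And>i. a < i \<Longrightarrow> i \<le> a + k \<Longrightarrow> p (v i) \<in> v ` {a..<i}"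
    and "a + k < n"
  shows "cyc_path n \<sigma> (grow v p a k)"
  using adj par \<open>a + k < n\<close>
proof (induction k)
  case (Suc k)
  let ?adj = "\<lambda>x y. cyc_adjacent n (\<sigma> x) (\<sigma> y)"
  let ?L = "grow v p a k" and ?x = "v (a + Suc k)"
  have IH: "successively ?adj ?L" using Suc by auto
  have A: "?adj (p ?x) ?x" using Suc.prems(1)[of "a + Suc k"] by simp
  show ?case
  proof (cases "last ?L = p ?x")
    case True
    then show ?thesis using IH A by (simp add: Let_def successively_append_iff)
  next
    case False
    have "p ?x \<in> set ?L" using Suc.prems(2)[of "a + Suc k"] by (auto simp: set_grow)
    then obtain B C where BC: "?L = B @ p ?x # C" by (meson split_list)
    have "C \<noteq> []" using False BC by auto
    have "B = []"
    proof (rule ccontr)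
      assume "B \<noteq> []"
      then have h: "?adj (p ?x) (last B)" "?adj (p ?x) (hd C)"
        using IH \<open>C \<noteq> []\<close> unfolding BC
        by (cases C; auto simp: successively_append_iff cyc_adjacent_sym)+
      have "distinct ?L" by (rule distinct_grow) (use inj Suc.prems(3) in \<open>auto intro: inj_on_subset\<close>)
      then have d: "last B \<noteq> hd C" using \<open>B \<noteq> []\<close> \<open>C \<noteq> []\<close> unfolding BC
        by (metis disjoint_iff distinct_append hd_in_set last_in_set list.set_intros(2))
      have mem: "last B \<in> set ?L" "hd C \<in> set ?L" using \<open>B \<noteq> []\<close> \<open>C \<noteq> []\<close> unfolding BC by auto
      have xn: "?x \<notin> set ?L"
      proof
        assume "?x \<in> set ?L"
        then obtain j where "j \<le> a + k" "?x = v j" by (auto simp: set_grow)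
        then show False using inj_onD[OF inj, of "a + Suc k" j] Suc.prems(3) by auto
      qed
      have "z < n" if "z \<in> set ?L" for z using that vlt Suc.prems(3) by (auto simp: set_grow)
      then have "last B < n" "hd C < n" "?x < n" using mem vlt Suc.prems(3) by auto
      then have "\<not> distinct [\<sigma> (last B), \<sigma> (hd C), \<sigma> ?x]"
        using cyc_adjacent_three[OF h A] permutes_less_iff[OF p] by simp
      moreover have "last B \<noteq> ?x" "hd C \<noteq> ?x" using mem xn by metis+
      ultimately show False using d by (simp add: inj_eq[OF permutes_inj[OF p]])
    qed
    then have "hd ?L = p ?x" using BC by simp
    then show ?thesis using IH A False
      by (cases ?L) (auto simp: Let_def cyc_adjacent_sym)
  qed
qed simp

section \<open>Orders with two prescribed paths\<close>

lemma is_dihedral_cyc_adjacent: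
  assumes "is_dihedral n \<rho>" "cyc_adjacent n a b" "a < n" "b < n"
  shows "cyc_adjacent n (\<rho> a) (\<rho> b)"
proof -
  from assms(1) obtain e s where e: "e = 1 \<or> e = -1"
    and es: "\<And>i. i < n \<Longrightarrow> int (\<rho> i) = (s + e * int i) mod int n"
    unfolding is_dihedral_def by blast
  have diff: "(int (\<rho> x) - int (\<rho> y)) mod int n = (e * (int x - int y)) mod int n"
    if "x < n" "y < n" for x y
    using es that by (simp add: mod_diff_eq algebra_simps)
  from e show ?thesis
  proof
    assume "e = 1"
    then show ?thesis using assms(2-4) by (simp add: cyc_adjacent_def diff)
  next
    assume "e = -1"
    then show ?thesis using assms(2-4) by (auto simp: cyc_adjacent_def diff)
  qed
qed

lemma is_dihedral_affine:
  assumes "e = 1 \<or> e = (-1 :: int)"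
  shows "is_dihedral n (\<lambda>i. if i < n then nat ((s + e * int i) mod int n) else i)"
    (is "is_dihedral n ?r")
proof -
  have r: "int (?r i) = (s + e * int i) mod int n" if "i < n" for i using that by simp
  have "inj_on ?r {0..<n}"
  proof (rule inj_onI)
    fix x y assume xy: "x \<in> {0..<n}" "y \<in> {0..<n}" "?r x = ?r y"
    have "(s + e * int x) mod int n = int (?r x)" by (rule r[symmetric]) (use xy in simp)
    also have "\<dots> = int (?r y)" by (simp only: xy(3))
    also have "\<dots> = (s + e * int y) mod int n" by (rule r) (use xy in simp)
    finally have "(s + e * int x) mod int n = (s + e * int y) mod int n" .
    then have "(e * (s + e * int x) - e * s) mod int n = (e * (s + e * int y) - e * s) mod int n"
      by (metis mod_diff_left_eq mod_mult_right_eq)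
    then have "int x mod int n = int y mod int n" using assms by auto
    then show "x = y" using xy by simp
  qed
  moreover have "?r ` {0..<n} \<subseteq> {0..<n}" by (auto simp: nat_less_iff)
  ultimately have "?r ` {0..<n} = {0..<n}" by (intro endo_inj_surj) simp_all
  with \<open>inj_on ?r {0..<n}\<close> have "bij_betw ?r {0..<n} {0..<n}" by (simp only: bij_betw_def)
  then have "?r permutes {0..<n}" by (rule bij_imp_permutes) simp
  then show ?thesis unfolding is_dihedral_def using assms r by blast
qed

text \<open>The first step fixes the direction: turning round would lead back to the element visited
  two steps earlier, against injectivity. So the path is an arithmetic progression modulo n.\<close>

lemma path_affine:
  assumes lt: "\<And>t. t < q \<Longrightarrow> f t < n" and inj: "inj_on f {..<q}"
    and adj: "\<And>t. Suc t < q \<Longrightarrow> cyc_adjacent n (f t) (f (Suc t))"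
  shows "\<exists>e. (e = 1 \<or> e = -1) \<and> (\<forall>t<q. int (f t) = (int (f 0) + e * int t) mod int n)"
\<comment> \<open>A path without steps has no direction, so either sign would do.\<close>
proof (cases "q < 2")
  case True
  then show ?thesis
  proof (intro exI[of _ 1] conjI allI impI)
    fix t assume "t < q"
    then have "t = 0" using True by simp
    then show "int (f t) = (int (f 0) + 1 * int t) mod int n" using lt[of t] \<open>t < q\<close> by simp
  qed simp
next
  case False
  have step: "int (f (Suc t)) = (int (f t) + 1) mod int n \<or> int (f (Suc t)) = (int (f t) - 1) mod int n"
    if t: "Suc t < q" for t
  proof -
    have b: "f (Suc t) < n" using lt t by blast
    from adj[OF t] consider
      "(int (f (Suc t)) - int (f t)) mod int n = 1 mod int n" |
      "(int (f t) - int (f (Suc t))) mod int n = 1 mod int n"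
      by (auto simp: cyc_adjacent_def)
    then show ?thesis
    proof cases
      case 1
      then have "(int (f (Suc t)) - int (f t) + int (f t)) mod int n = (1 + int (f t)) mod int n"
        by (metis mod_add_left_eq)
      then show ?thesis using b by (simp add: add.commute)
    next
      case 2
      then have "(int (f t) - (int (f t) - int (f (Suc t)))) mod int n = (int (f t) - 1) mod int n"
        by (metis mod_diff_right_eq)
      then show ?thesis using b by simp
    qed
  qed
  obtain e :: int where e: "e = 1 \<or> e = -1" and e1: "int (f 1) = (int (f 0) + e) mod int n"
  proof -
    from step[of 0] False consider "int (f 1) = (int (f 0) + 1) mod int n"
      | "int (f 1) = (int (f 0) + -1) mod int n" by auto
    then show thesis by cases (use that in blast)+
  qed
  have "\<forall>t<q. int (f t) = (int (f 0) + e * int t) mod int n"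
  proof (intro allI impI)
    fix t show "t < q \<Longrightarrow> int (f t) = (int (f 0) + e * int t) mod int n"
    proof (induction t rule: less_induct)
      case (less t)
      consider "t = 0" | "t = 1" | u where "t = Suc (Suc u)" by (metis One_nat_def not0_implies_Suc)
      then show ?case
      proof cases
        case 1
        then show ?thesis using less.prems lt by simp
      next
        case 2
        then show ?thesis using e1 by simp
      next
        case 3
        have u: "int (f u) = (int (f 0) + e * int u) mod int n"
          and su: "int (f (Suc u)) = (int (f 0) + e * int (Suc u)) mod int n"
          using less.IH[of u] less.IH[of "Suc u"] less.prems 3 by auto
        have "int (f t) = (int (f (Suc u)) + e) mod int n \<or> int (f t) = (int (f (Suc u)) - e) mod int n"
          using step[of "Suc u"] e less.prems 3 by auto
        moreover have "int (f t) \<noteq> (int (f (Suc u)) - e) mod int n"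
        proof
          assume "int (f t) = (int (f (Suc u)) - e) mod int n"
          then have "int (f t) = (int (f 0) + e * int (Suc u) - e) mod int n"
            by (simp add: su mod_diff_left_eq)
          then have "int (f t) = int (f u)" using u by (simp add: algebra_simps)
          then have "f t = f u" by simp
          then show False using inj_onD[OF inj, of t u] less.prems 3 by simp
        qed
        ultimately have "int (f t) = (int (f (Suc u)) + e) mod int n" by blast
        also have "\<dots> = (int (f 0) + e * int (Suc u) + e) mod int n"
          by (simp add: su mod_add_left_eq)
        finally show ?thesis using 3 by (simp add: algebra_simps)
      qed
    qed
  qed
  then show ?thesis using e by blast
qed

text \<open>A progression starting anywhere but at the appropriate end leaves the segment before it
  has made its \<open>q\<close> visits: upwards it passes n - 1 and reaches 0, downwards it passes
  \<open>m\<close> and reaches m - 1. Both are outside because \<open>m\<close> is positive.\<close>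

lemma path_on_final_segment:
  assumes q: "q = n - m" and m: "0 < m" "m < n"
    and rng: "\<And>t. t < q \<Longrightarrow> m \<le> f t \<and> f t < n" and inj: "inj_on f {..<q}"
    and adj: "\<And>t. Suc t < q \<Longrightarrow> cyc_adjacent n (f t) (f (Suc t))"
  shows "(\<forall>t<q. f t = m + t) \<or> (\<forall>t<q. f t = n - 1 - t)"
proof -
  obtain e where e: "e = 1 \<or> e = -1"
    and fe: "\<And>t. t < q \<Longrightarrow> int (f t) = (int (f 0) + e * int t) mod int n"
    using path_affine[of q f n] rng inj adj by blast
  have f0: "m \<le> f 0" "f 0 < n" using rng[of 0] q m by auto
  from e show ?thesis
  proof
    assume e1: "e = 1"
    have "f 0 = m"
    proof (rule ccontr)
      assume "f 0 \<noteq> m"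
      then have t: "n - f 0 < q" using f0 q by auto
      have "int (f (n - f 0)) = 0" using fe[OF t] e1 f0 by simp
      then show False using rng[OF t] m by simp
    qed
    have "f t = m + t" if "t < q" for t
    proof -
      have "int (f t) = int (m + t) mod int n" using fe[OF that] e1 \<open>f 0 = m\<close> by simp
      also have "\<dots> = int (m + t)" using that q by simp
      finally show ?thesis by simp
    qed
    then show ?thesis by blast
  next
    assume e1: "e = -1"
    have "f 0 = n - 1"
    proof (rule ccontr)
      assume "f 0 \<noteq> n - 1"
      then have t: "f 0 - m + 1 < q" using f0 q m by auto
      have "int (f (f 0 - m + 1)) = (int m - 1) mod int n"
        using fe[OF t] e1 f0 m by (simp add: of_nat_diff)
      also have "\<dots> = int m - 1" using m by simp
      finally show False using rng[OF t] m by simp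
    qed
    have "f t = n - 1 - t" if "t < q" for t
    proof -
      have "int (f t) = (int (n - 1 - t)) mod int n"
        using fe[OF that] e1 \<open>f 0 = n - 1\<close> that q m by (simp add: of_nat_diff algebra_simps)
      also have "\<dots> = int (n - 1 - t)" using m by simp
      finally show ?thesis by simp
    qed
    then show ?thesis by blast
  qed
qed

lemma inj_nth_permutes:
  assumes "\<sigma> permutes {0..<n}" "distinct L"
  shows "inj_on (\<lambda>t. \<sigma> (L ! t)) {..<length L}"
  using assms by (auto simp: inj_on_def nth_eq_iff_index_eq inj_eq[OF permutes_inj[OF assms(1)]])

text \<open>The first path fixes a dihedral map that straightens it onto the positions below
  \<open>m\<close>. Pulled back along this map, the second path must fill the remaining segment,
  where it can run in two directions.\<close>

lemma two_paths_order:
  assumes p: "\<sigma> permutes {0..<n}" and dist: "distinct (K @ K')"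
    and set: "set (K @ K') = {0..<n}" and ne: "K \<noteq> []" "K' \<noteq> []"
    and sK: "cyc_path n \<sigma> K"
    and sK': "cyc_path n \<sigma> K'"
  shows "\<exists>\<rho>. is_dihedral n \<rho> \<and>
    ((\<forall>k<n. \<sigma> ((K @ K') ! k) = \<rho> k) \<or> (\<forall>k<n. \<sigma> ((K @ rev K') ! k) = \<rho> k))"
proof -
  define m where "m = length K"
  have n: "length (K @ K') = n" using distinct_card[OF dist] set by simp
  have m: "0 < m" "m < n" and K': "length K' = n - m" using ne n by (auto simp: m_def)
  have lt: "\<sigma> x < n \<longleftrightarrow> x < n" for x using permutes_less_iff[OF p] .
  have Klt: "K ! t < n" if "t < m" for t using nth_mem[of t K] that set by (auto simp: m_def)
  have K'lt: "K' ! t < n" if "t < n - m" for t using nth_mem[of t K'] that set K' by auto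
  have Kadj: "cyc_adjacent n (\<sigma> (K ! t)) (\<sigma> (K ! Suc t))" if "Suc t < m" for t
    using sK that by (auto simp: successively_conv_nth m_def)
  have K'adj: "cyc_adjacent n (\<sigma> (K' ! t)) (\<sigma> (K' ! Suc t))" if "Suc t < n - m" for t
    using sK' that by (auto simp: successively_conv_nth K')
  have "inj_on (\<lambda>t. \<sigma> (K ! t)) {..<m}"
    using inj_nth_permutes[OF p, of K] dist by (simp add: m_def)
  then obtain e s where e: "e = 1 \<or> e = (-1::int)"
    and es: "\<And>t. t < m \<Longrightarrow> int (\<sigma> (K ! t)) = (s + e * int t) mod int n"
    using path_affine[of m "\<lambda>t. \<sigma> (K ! t)" n] Klt lt Kadj by blast
  define \<rho> where "\<rho> i = (if i < n then nat ((s + e * int i) mod int n) else i)" for i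
  have dih: "is_dihedral n \<rho>" unfolding \<rho>_def using is_dihedral_affine[OF e] by presburger
  then have \<rho>p: "\<rho> permutes {0..<n}" by (simp add: is_dihedral_def)
  have KR: "\<sigma> (K ! t) = \<rho> t" if "t < m" for t
    using es[OF that] that m by (simp add: \<rho>_def)
  let ?i = "inv_into UNIV \<rho>"
  have dihi: "is_dihedral n ?i" using is_dihedral_inv[OF dih] .
  have ip: "?i permutes {0..<n}" using permutes_inv[OF \<rho>p] .
  have ri: "?i (\<rho> x) = x" "\<rho> (?i x) = x" for x using permutes_inverses[OF \<rho>p] by auto
  define f where "f t = ?i (\<sigma> (K' ! t))" for t
  have "(\<forall>t<n - m. f t = m + t) \<or> (\<forall>t<n - m. f t = n - 1 - t)"
  proof (rule path_on_final_segment)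
    fix t assume t: "t < n - m"
    have "f t < n" using K'lt[OF t] lt permutes_less_iff[OF ip] by (simp add: f_def)
    moreover have "m \<le> f t"
    proof (rule ccontr)
      assume h: "\<not> m \<le> f t"
      then have "\<sigma> (K ! f t) = \<sigma> (K' ! t)" using KR[of "f t"] by (simp add: f_def ri)
      then have "K ! f t = K' ! t" by (simp add: inj_eq[OF permutes_inj[OF p]])
      moreover have "K ! f t \<in> set K" "K' ! t \<in> set K'" using h t K' by (auto simp: m_def)
      ultimately show False using dist by auto
    qed
    ultimately show "m \<le> f t \<and> f t < n" by simp
  next
    have "inj_on (\<lambda>t. (?i \<circ> \<sigma>) (K' ! t)) {..<length K'}"
      by (rule inj_nth_permutes[OF permutes_compose[OF p ip]]) (use dist in simp)
    then show "inj_on f {..<n - m}" by (simp add: K' f_def[abs_def])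
  next
    fix t assume t: "Suc t < n - m"
    then show "cyc_adjacent n (f t) (f (Suc t))"
      unfolding f_def using is_dihedral_cyc_adjacent[OF dihi K'adj[OF t]] K'lt lt by simp
  qed (use m in auto)
  moreover have R: "\<sigma> (K' ! t) = \<rho> (f t)" for t by (simp add: f_def ri)
  ultimately consider "\<forall>t<n - m. \<sigma> (K' ! t) = \<rho> (m + t)" | "\<forall>t<n - m. \<sigma> (K' ! t) = \<rho> (n - 1 - t)"
    by auto
  then show ?thesis
  proof cases
    case 1
    have "\<sigma> ((K @ K') ! k) = \<rho> k" if "k < n" for k
      using 1 KR that by (simp add: nth_append m_def[symmetric])
    then show ?thesis using dih by blast
  next
    case 2
    have "\<sigma> ((K @ rev K') ! k) = \<rho> k" if "k < n" for k
    proof (cases "k < m")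
      case True
      then show ?thesis using KR by (simp add: nth_append m_def[symmetric])
    next
      case False
      then have "(K @ rev K') ! k = K' ! (n - 1 - k)"
        using that by (simp add: nth_append m_def[symmetric] rev_nth K')
      then show ?thesis using 2 False that by simp
    qed
    then show ?thesis using dih by blast
  qed
qed

section \<open>Reversing one of two paths\<close>

text \<open>Position in \<open>K @ K'\<close> of the entry that \<open>K @ rev K'\<close> has at
  position \<open>t\<close>, where \<open>m = length K\<close>; an involution on the positions below
  n.\<close>

definition flip :: "nat \<Rightarrow> nat \<Rightarrow> nat \<Rightarrow> nat" where
  "flip n m t = (if t < m then t else n - 1 + m - t)"

text \<open>The tests are the unimodality conditions that involve two endpoints of the other path and the
  endpoints of the own path; \<open>b\<close> and \<open>a\<close> are skipped where they coincide with \<open>j\<close>. One test alone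
  does not imply validity, but passing both forces each path to be closer to its points than the
  other path, and then both orders have the same status.\<close>

definition endpoint_test ::
  "(nat \<Rightarrow> nat \<Rightarrow> real) \<Rightarrow> nat \<Rightarrow> nat \<Rightarrow> nat \<Rightarrow> nat \<Rightarrow> bool" where
  "endpoint_test E a b c e \<longleftrightarrow> (\<forall>j. a \<le> j \<and> j \<le> b \<longrightarrow>
     (j < b \<longrightarrow> min (E j b) (E j e) < E j c) \<and> (a < j \<longrightarrow> min (E j c) (E j a) < E j e))"

definition straight_test :: "nat \<Rightarrow> nat \<Rightarrow> (nat \<Rightarrow> nat \<Rightarrow> real) \<Rightarrow> bool" where
  "straight_test n m E \<longleftrightarrow>
     endpoint_test E 0 (m - 1) m (n - 1) \<and> endpoint_test E m (n - 1) 0 (m - 1)"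

text \<open>Reversing one path exchanges which far endpoint follows each own endpoint on the circle,
  hence the last two arguments of each \<open>endpoint_test\<close> are swapped.\<close>

definition flipped_test :: "nat \<Rightarrow> nat \<Rightarrow> (nat \<Rightarrow> nat \<Rightarrow> real) \<Rightarrow> bool" where
  "flipped_test n m E \<longleftrightarrow>
     endpoint_test E 0 (m - 1) (n - 1) m \<and> endpoint_test E m (n - 1) (m - 1) 0"

section \<open>Validity in terms of increasing quadruples\<close>

lemma circ_valid_quadD:
  assumes "circ_valid n E" "w < x" "x < y" "y < z" "z < n"
  shows "min (E x y) (E y z) < E w y" "min (E y z) (E z w) < E x z"
    "min (E z w) (E w x) < E y w" "min (E w x) (E x y) < E z x"
  using assms unfolding circ_valid_def cyclically_ordered_linear by simp_all

lemma circ_validI: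
  assumes "\<And>w x y z. w < x \<Longrightarrow> x < y \<Longrightarrow> y < z \<Longrightarrow> z < n \<Longrightarrow>
    min (E x y) (E y z) < E w y \<and> min (E y z) (E z w) < E x z \<and>
    min (E z w) (E w x) < E y w \<and> min (E w x) (E x y) < E z x"
  shows "circ_valid n E"
  unfolding circ_valid_def cyclically_ordered_linear using assms by blast

text \<open>Every inequality tested belongs to a quadruple consisting of \<open>j\<close> and three
  of the four path endpoints 0, m - 1, m, n - 1.\<close>

lemma circ_valid_straight_test:
  assumes v: "circ_valid n E" and s: "dissimilarity n E" and m: "2 \<le> m" "m + 2 \<le> n"
  shows "straight_test n m E"
proof -
  have sym: "E i j = E j i" if "i < n" "j < n" for i j
    using s that unfolding dissimilarity_def by blast
  have "min (E j (m - 1)) (E j (n - 1)) < E j m" if "j < m - 1" for j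
    using circ_valid_quadD(3)[OF v, of j "m - 1" m "n - 1"] that m
      sym[of "n - 1" j] sym[of m j] by (simp add: min.commute)
  moreover have "min (E j m) (E j 0) < E j (n - 1)" if "0 < j" "j < m" for j
    using circ_valid_quadD(4)[OF v, of 0 j m "n - 1"] that m
      sym[of 0 j] sym[of "n - 1" j] by (simp add: min.commute)
  moreover have "min (E j (n - 1)) (E j (m - 1)) < E j 0" if "m \<le> j" "j < n - 1" for j
    using circ_valid_quadD(1)[OF v, of 0 "m - 1" j "n - 1"] that m
      sym[of "m - 1" j] sym[of 0 j] by (simp add: min.commute)
  moreover have "min (E j 0) (E j m) < E j (m - 1)" if "m < j" "j < n" for j
    using circ_valid_quadD(2)[OF v, of 0 "m - 1" m j] that m
      sym[of m j] sym[of "m - 1" j] by (simp add: min.commute)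
  ultimately show ?thesis
    using m unfolding straight_test_def endpoint_test_def by auto
qed

text \<open>Let x be the distance from \<open>j\<close> to an own endpoint and y, z those to the far
  endpoints. The straight test yields min x z < y and the flipped test min x y < z, or the same with
  y and z exchanged; read at the smaller of y and z this gives x < min y z. If \<open>j\<close> is
  itself an endpoint, its own distance is 0, and the other own endpoint, distinct because each path
  has two points, supplies the strict bound.\<close>

lemma two_tests_separate:
  assumes s: "dissimilarity n E" and m: "2 \<le> m" "m + 2 \<le> n"
    and t: "straight_test n m E" "flipped_test n m E"
  shows "j < m \<Longrightarrow> max (E j 0) (E j (m - 1)) < min (E j m) (E j (n - 1))"
    and "m \<le> j \<Longrightarrow> j < n \<Longrightarrow> max (E j m) (E j (n - 1)) < min (E j 0) (E j (m - 1))"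
proof -
  have nn: "0 \<le> E i j" if "i < n" "j < n" for i j
    using s that unfolding dissimilarity_def by blast
  have z: "E i i = 0" if "i < n" for i using s that unfolding dissimilarity_def by blast
  show "max (E j 0) (E j (m - 1)) < min (E j m) (E j (n - 1))" if j: "j < m"
  proof -
    have a: "j < m - 1 \<Longrightarrow> min (E j (m - 1)) (E j (n - 1)) < E j m"
      "0 < j \<Longrightarrow> min (E j m) (E j 0) < E j (n - 1)"
      "j < m - 1 \<Longrightarrow> min (E j (m - 1)) (E j m) < E j (n - 1)"
      "0 < j \<Longrightarrow> min (E j (n - 1)) (E j 0) < E j m"
      using t j unfolding straight_test_def flipped_test_def endpoint_test_def by auto
    consider "j = 0" | "j = m - 1" "j \<noteq> 0" | "0 < j" "j < m - 1" using j m by linarith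
    then show ?thesis
    proof cases
      case 1
      then have "E j 0 = 0" "0 \<le> E j (m - 1)" using z nn m by auto
      moreover have c: "j < m - 1" using 1 m by simp
      ultimately show ?thesis using a(1)[OF c] a(3)[OF c] 1 by (auto simp: min_def max_def split: if_splits)
    next
      case 2
      then have "E j (m - 1) = 0" "0 \<le> E j 0" using z nn m by auto
      moreover have c: "0 < j" using 2 j m by simp
      ultimately show ?thesis using a(2)[OF c] a(4)[OF c] 2 by (auto simp: min_def max_def split: if_splits)
    next
      case 3
      then show ?thesis using a by (auto simp: min_def max_def split: if_splits)
    qed
  qed
  show "max (E j m) (E j (n - 1)) < min (E j 0) (E j (m - 1))" if j: "m \<le> j" "j < n"
  proof -
    have a: "j < n - 1 \<Longrightarrow> min (E j (n - 1)) (E j (m - 1)) < E j 0"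
      "m < j \<Longrightarrow> min (E j 0) (E j m) < E j (m - 1)"
      "j < n - 1 \<Longrightarrow> min (E j (n - 1)) (E j 0) < E j (m - 1)"
      "m < j \<Longrightarrow> min (E j (m - 1)) (E j m) < E j 0"
      using t j unfolding straight_test_def flipped_test_def endpoint_test_def by auto
    consider "j = m" | "j = n - 1" "j \<noteq> m" | "m < j" "j < n - 1" using j m by linarith
    then show ?thesis
    proof cases
      case 1
      then have "E j m = 0" "0 \<le> E j (n - 1)" using z nn m by auto
      moreover have c: "j < n - 1" using 1 m by simp
      ultimately show ?thesis using a(1)[OF c] a(3)[OF c] 1 by (auto simp: min_def max_def split: if_splits)
    next
      case 2
      then have "E j (n - 1) = 0" "0 \<le> E j m" using z nn m by auto
      moreover have c: "m < j" using 2 j m by simp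
      ultimately show ?thesis using a(2)[OF c] a(4)[OF c] 2 by (auto simp: min_def max_def split: if_splits)
    next
      case 3
      then show ?thesis using a by (auto simp: min_def max_def split: if_splits)
    qed
  qed
qed

text \<open>Unimodality spreads the separation from the endpoints to all points: in the row of
  \<open>i\<close>, the other path has no value below the smaller of its end values, and the own
  path none above the larger of its end values.\<close>

lemma circ_valid_separate:
  assumes v: "circ_valid n E" and s: "dissimilarity n E" and m: "2 \<le> m" "m + 2 \<le> n"
    and sep1: "\<And>j. j < m \<Longrightarrow> max (E j 0) (E j (m - 1)) < min (E j m) (E j (n - 1))"
    and sep2: "\<And>j. m \<le> j \<Longrightarrow> j < n \<Longrightarrow> max (E j m) (E j (n - 1)) < min (E j 0) (E j (m - 1))"
  shows "i < m \<Longrightarrow> j < m \<Longrightarrow> m \<le> k \<Longrightarrow> k < n \<Longrightarrow> E i j < E i k"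
    and "m \<le> i \<Longrightarrow> i < n \<Longrightarrow> m \<le> j \<Longrightarrow> j < n \<Longrightarrow> k < m \<Longrightarrow> E i j < E i k"
proof -
  have sym: "E i j = E j i" if "i < n" "j < n" for i j
    using s that unfolding dissimilarity_def by blast
  have nn: "0 \<le> E i j" if "i < n" "j < n" for i j
    using s that unfolding dissimilarity_def by blast
  have z: "E i i = 0" if "i < n" for i using s that unfolding dissimilarity_def by blast
  show "E i j < E i k" if h: "i < m" "j < m" "m \<le> k" "k < n"
  proof -
    have S: "E x i = E i x" if "x < n" for x using sym that h m by simp
    have "min (E i m) (E i (n - 1)) \<le> E i k"
    proof (cases "k = m \<or> k = n - 1")
      case False
      then have "m < k" "k < n - 1" using h by linarith+
      then have "min (E i (n - 1)) (E i m) < E i k"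
        using circ_valid_quadD(3)[OF v, of i m k "n - 1"] h m by (simp add: S)
      then show ?thesis by (simp add: min.commute)
    qed auto
    moreover have "E i j \<le> max (E i 0) (E i (m - 1))"
    proof -
      consider "j = i" | "j = 0" | "j = m - 1" | "0 < j" "j < i" | "i < j" "j < m - 1"
        using h by linarith
      then show ?thesis
      proof cases
        case 1
        then show ?thesis using z[of i] nn[of i 0] h m by auto
      next
        case 4
        then have "min (E i j) (E i m) < E i 0"
          using circ_valid_quadD(1)[OF v, of 0 j i m] h m by (simp add: S)
        then show ?thesis using sep1[of i] h by auto
      next
        case 5
        then have "min (E i m) (E i j) < E i (m - 1)"
          using circ_valid_quadD(3)[OF v, of i j "m - 1" m] h m by (simp add: S)
        then show ?thesis using sep1[of i] h by auto
      qed auto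
    qed
    ultimately show ?thesis using sep1[of i] h by auto
  qed
  show "E i j < E i k" if h: "m \<le> i" "i < n" "m \<le> j" "j < n" "k < m"
  proof -
    have S: "E x i = E i x" if "x < n" for x using sym that h m by simp
    have "min (E i 0) (E i (m - 1)) \<le> E i k"
    proof (cases "k = 0 \<or> k = m - 1")
      case False
      then have "0 < k" "k < m - 1" using h by linarith+
      then have "min (E i (m - 1)) (E i 0) < E i k"
        using circ_valid_quadD(2)[OF v, of 0 k "m - 1" i] h m by (simp add: S)
      then show ?thesis by (simp add: min.commute)
    qed auto
    moreover have "E i j \<le> max (E i m) (E i (n - 1))"
    proof -
      consider "j = i" | "j = m" | "j = n - 1" | "m < j" "j < i" | "i < j" "j < n - 1"
        using h by linarith
      then show ?thesis
      proof cases
        case 1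
        then show ?thesis using z[of i] nn[of i m] h m by auto
      next
        case 4
        then have "min (E i j) (E i (m - 1)) < E i m"
          using circ_valid_quadD(2)[OF v, of "m - 1" m j i] h m by (simp add: S)
        then show ?thesis using sep2[of i] h by auto
      next
        case 5
        then have "min (E i 0) (E i j) < E i (n - 1)"
          using circ_valid_quadD(4)[OF v, of 0 i j "n - 1"] h m by (simp add: S)
        then show ?thesis using sep2[of i] h by auto
      qed auto
    qed
    ultimately show ?thesis using sep2[of i] h by auto
  qed
qed

text \<open>With at most one point in one of the paths, a quadruple stays in cyclic order up to
  reversal, so its inequalities are old ones. What remains are the quadruples with two points in
  each path; there every inequality compares a distance across with one inside a path and follows
  from separation.\<close>

lemma circ_valid_flip:
  assumes v: "circ_valid n E" and s: "dissimilarity n E" and m: "2 \<le> m" "m + 2 \<le> n"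
    and t: "straight_test n m E" "flipped_test n m E"
  shows "circ_valid n (\<lambda>i j. E (flip n m i) (flip n m j))"
proof (rule circ_validI)
  fix w x y z assume o: "w < x" "x < y" "y < z" "z < n"
  let ?f = "flip n m"
  note sep = circ_valid_separate[OF v s m two_tests_separate[OF s m t]]
  have sym: "E i j = E j i" if "i < n" "j < n" for i j
    using s that unfolding dissimilarity_def by blast
  have lt: "?f w < n" "?f x < n" "?f y < n" "?f z < n"
    using o m by (auto simp: flip_def)
  note S = sym[OF lt(2) lt(1)] sym[OF lt(3) lt(1)] sym[OF lt(4) lt(1)] sym[OF lt(3) lt(2)]
    sym[OF lt(4) lt(2)] sym[OF lt(4) lt(3)]
  have lo: "?f i = i" if "i < m" for i using that by (simp add: flip_def)
  have hi: "m \<le> ?f i" if "m \<le> i" "i < n" for i using that by (simp add: flip_def)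
  have rev: "?f j < ?f i" if "m \<le> i" "i < j" "j < n" for i j using that by (simp add: flip_def)
  consider "y < m" | "x < m" "m \<le> y" | "w < m" "m \<le> x" | "m \<le> w" by linarith
  then show "min (E (?f x) (?f y)) (E (?f y) (?f z)) < E (?f w) (?f y) \<and>
      min (E (?f y) (?f z)) (E (?f z) (?f w)) < E (?f x) (?f z) \<and>
      min (E (?f z) (?f w)) (E (?f w) (?f x)) < E (?f y) (?f w) \<and>
      min (E (?f w) (?f x)) (E (?f x) (?f y)) < E (?f z) (?f x)"
  proof cases
    case 1
    have "?f y < ?f z"
      using 1 o hi[of z] lo[of y] lo[of z] by (cases "z < m") auto
    then show ?thesis
      using circ_valid_quadD[OF v, of "?f w" "?f x" "?f y" "?f z"] 1 o lo lt by simp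
  next
    case 2
    have f: "?f w < m" "?f x < m" "m \<le> ?f y" "m \<le> ?f z" using 2 o lo hi by auto
    show ?thesis
      using sep(2)[of "?f y" "?f z" "?f w"] sep(2)[of "?f z" "?f y" "?f x"]
        sep(1)[of "?f w" "?f x" "?f y"] sep(1)[of "?f x" "?f w" "?f z"] f lt
      by (auto simp: S min_less_iff_disj)
  next
    case 3
    have "?f w < ?f z" using 3 o hi[of z] lo[of w] by auto
    then show ?thesis
      using circ_valid_quadD[OF v, of "?f w" "?f z" "?f y" "?f x"] rev[of x y] rev[of y z] 3 o lt
      by (auto simp: S min_less_iff_disj)
  next
    case 4
    then show ?thesis
      using circ_valid_quadD[OF v, of "?f z" "?f y" "?f x" "?f w"] rev[of w x] rev[of x y]
        rev[of y z] o lt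
      by (auto simp: S min_less_iff_disj)
  qed
qed

section \<open>Behaviour of the tests under reversal of the second path\<close>

lemma all_reflect_interval:
  fixes m n :: nat
  shows "(\<forall>j. m \<le> j \<and> j \<le> n \<longrightarrow> P (n + m - j)) \<longleftrightarrow> (\<forall>j. m \<le> j \<and> j \<le> n \<longrightarrow> P j)"
proof (intro iffI allI impI)
  fix j assume h: "\<forall>j. m \<le> j \<and> j \<le> n \<longrightarrow> P (n + m - j)" and j: "m \<le> j \<and> j \<le> n"
  have "m \<le> n + m - j" "n + m - j \<le> n" "n + m - (n + m - j) = j" using j by auto
  then show "P j" using h[rule_format, of "n + m - j"] by simp
next
  fix j assume h: "\<forall>j. m \<le> j \<and> j \<le> n \<longrightarrow> P j" and j: "m \<le> j \<and> j \<le> n"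
  then have "m \<le> n + m - j" "n + m - j \<le> n" by auto
  then show "P (n + m - j)" using h by blast
qed

lemma straight_test_flip:
  assumes m: "2 \<le> m" "m + 2 \<le> n"
  shows "straight_test n m (\<lambda>i j. E (flip n m i) (flip n m j)) \<longleftrightarrow> flipped_test n m E"
proof -
  let ?F = "\<lambda>i j. E (flip n m i) (flip n m j)"
  have f: "flip n m 0 = 0" "flip n m (m - 1) = m - 1" "flip n m m = n - 1" "flip n m (n - 1) = m"
    "flip n m (m - Suc 0) = m - 1" "flip n m (n - Suc 0) = m"
    using m by (auto simp: flip_def)
  have "endpoint_test ?F 0 (m - 1) m (n - 1) \<longleftrightarrow> endpoint_test E 0 (m - 1) (n - 1) m"
  proof -
    have "flip n m j = j" if "j \<le> m - 1" for j using that m by (simp add: flip_def)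
    then show ?thesis unfolding endpoint_test_def f by auto
  qed
  moreover have "endpoint_test ?F m (n - 1) 0 (m - 1) \<longleftrightarrow> endpoint_test E m (n - 1) (m - 1) 0"
  proof -
    let ?P = "\<lambda>j. (m < j \<longrightarrow> min (E j m) (E j (m - 1)) < E j 0) \<and>
      (j < n - 1 \<longrightarrow> min (E j 0) (E j (n - 1)) < E j (m - 1))"
    have "endpoint_test ?F m (n - 1) 0 (m - 1) \<longleftrightarrow>
        (\<forall>j. m \<le> j \<and> j \<le> n - 1 \<longrightarrow> ?P (n - 1 + m - j))"
      unfolding endpoint_test_def f
    proof (intro all_cong1 imp_cong refl)
      fix j assume j: "m \<le> j \<and> j \<le> n - 1"
      then have "flip n m j = n - 1 + m - j" "(m < n - 1 + m - j) = (j < n - 1)"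
        "(n - 1 + m - j < n - 1) = (m < j)"
        by (auto simp: flip_def)
      then show "((j < n - 1 \<longrightarrow> min (E (flip n m j) m) (E (flip n m j) (m - 1)) < E (flip n m j) 0) \<and>
          (m < j \<longrightarrow> min (E (flip n m j) 0) (E (flip n m j) (n - 1)) < E (flip n m j) (m - 1))) =
          ?P (n - 1 + m - j)"
        by simp
    qed
    also have "\<dots> \<longleftrightarrow> (\<forall>j. m \<le> j \<and> j \<le> n - 1 \<longrightarrow> ?P j)" by (rule all_reflect_interval)
    also have "\<dots> \<longleftrightarrow> endpoint_test E m (n - 1) (m - 1) 0"
      unfolding endpoint_test_def by (auto simp: min.commute)
    finally show ?thesis .
  qed
  ultimately show ?thesis unfolding straight_test_def flipped_test_def by blast
qed

lemma circ_valid_cong: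
  assumes "\<And>i j. i < n \<Longrightarrow> j < n \<Longrightarrow> E i j = F i j"
  shows "circ_valid n E \<longleftrightarrow> circ_valid n F"
  unfolding circ_valid_def by (auto simp: cyclically_ordered_def assms)

lemma straight_test_cong:
  assumes "\<And>i j. i < n \<Longrightarrow> j < n \<Longrightarrow> E i j = F i j" "0 < m" "m < n"
  shows "straight_test n m E \<longleftrightarrow> straight_test n m F"
  unfolding straight_test_def endpoint_test_def using assms(2,3) by (auto simp: assms(1))

text \<open>A valid order always passes its own test, and by \<open>circ_valid_flip\<close> the
  other test then decides whether the other order is valid. As \<open>flip\<close> is an involution
  that exchanges the tests, either order can be taken as the one known to be valid.\<close>

lemma tests_iff_valid:
  assumes s: "dissimilarity n E" and m: "2 \<le> m" "m + 2 \<le> n"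
    and v: "circ_valid n E \<or> circ_valid n (\<lambda>i j. E (flip n m i) (flip n m j))"
  shows "straight_test n m E \<longleftrightarrow> circ_valid n E"
    and "flipped_test n m E \<longleftrightarrow> circ_valid n (\<lambda>i j. E (flip n m i) (flip n m j))"
proof -
  let ?flip = "\<lambda>E i j. E (flip n m i) (flip n m j)"
  have lt: "flip n m i < n" if "i < n" for i using that by (auto simp: flip_def)
  have ff: "flip n m (flip n m i) = i" if "i < n" for i using that m by (auto simp: flip_def)
  have s': "dissimilarity n (?flip E)" using s lt unfolding dissimilarity_def by simp
  have e: "?flip (?flip E) i j = E i j" if "i < n" "j < n" for i j using that by (simp add: ff)
  have main: "straight_test n m F" "flipped_test n m F \<longleftrightarrow> circ_valid n (?flip F)"
    if "dissimilarity n F" "circ_valid n F" "dissimilarity n (?flip F)" for F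
  proof -
    show st: "straight_test n m F" using circ_valid_straight_test that m by blast
    show "flipped_test n m F \<longleftrightarrow> circ_valid n (?flip F)"
      using circ_valid_flip[OF that(2,1) m st] circ_valid_straight_test[OF _ that(3) m]
        straight_test_flip[OF m] by blast
  qed
  have f: "flipped_test n m (?flip E) \<longleftrightarrow> straight_test n m E"
    "circ_valid n (?flip (?flip E)) \<longleftrightarrow> circ_valid n E" "dissimilarity n (?flip (?flip E))"
  proof -
    show "flipped_test n m (?flip E) \<longleftrightarrow> straight_test n m E"
      using straight_test_flip[OF m, of "?flip E"] straight_test_cong[of n "?flip (?flip E)" E m] e m
      by auto
    show "circ_valid n (?flip (?flip E)) \<longleftrightarrow> circ_valid n E" by (rule circ_valid_cong) (rule e)
    show "dissimilarity n (?flip (?flip E))" using s unfolding dissimilarity_def by (simp add: e ff)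
  qed
  show "straight_test n m E \<longleftrightarrow> circ_valid n E"
    using v main[OF s _ s'] main[OF s' _ f(3)] f by blast
  show "flipped_test n m E \<longleftrightarrow> circ_valid n (?flip E)"
    using v main[OF s _ s'] main[OF s' _ f(3)] f straight_test_flip[OF m, of E] by blast
qed

section \<open>The orders represented by the tree\<close>

definition leaf_lists :: "pqtree \<Rightarrow> nat list set" where
  "leaf_lists T = {leaf_seq T' | T'. reordering T T'}"

lemma pq_perms_leaf_lists:
  "pq_perms n T = {\<pi>. \<pi> permutes {0..<n} \<and> (\<exists>L\<in>leaf_lists T. \<forall>k<n. \<pi> (L ! k) = k)}"
  unfolding pq_perms_def leaf_lists_def by blast

inductive_simps reordering_Leaf_iff: "reordering (Leaf x) T"
inductive_simps reordering_QNode_iff: "reordering (QNode ts) T"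

lemma list_all2_reordering_Leaf: "list_all2 reordering (map Leaf xs) us \<longleftrightarrow> us = map Leaf xs"
  by (induction xs arbitrary: us) (auto simp: list_all2_Cons1 reordering_Leaf_iff)

lemma leaf_seq_QNode_Leaf [simp]: "leaf_seq (QNode (map Leaf xs)) = xs"
  by (induction xs) auto

lemma reordering_flat_iff:
  "reordering (QNode (map Leaf xs)) T \<longleftrightarrow> T = QNode (map Leaf xs) \<or> T = QNode (map Leaf (rev xs))"
  by (auto simp: reordering_QNode_iff list_all2_reordering_Leaf rev_map)

lemma leaf_lists_image: "leaf_lists T = leaf_seq ` {T'. reordering T T'}"
  unfolding leaf_lists_def by blast

lemma leaf_lists_flat: "leaf_lists (QNode (map Leaf xs)) = {xs, rev xs}"
proof -
  have "{T'. reordering (QNode (map Leaf xs)) T'} = {QNode (map Leaf xs), QNode (map Leaf (rev xs))}"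
    using reordering_flat_iff by blast
  then show ?thesis unfolding leaf_lists_image by (simp del: leaf_seq.simps)
qed

text \<open>For two children, reversal is the only nontrivial permutation, so a Q-node at the root
  is as free as a P-node. The eight sequences are the two orders of the blocks with independent
  reversals inside.\<close>

lemma leaf_lists_two_level:
  "leaf_lists (QNode [QNode (map Leaf xs), QNode (map Leaf ys)]) =
     {xs @ ys, xs @ rev ys, rev xs @ ys, rev xs @ rev ys,
      ys @ xs, rev ys @ xs, ys @ rev xs, rev ys @ rev xs}" (is "leaf_lists ?T = _")
proof -
  let ?Q = "\<lambda>xs. QNode (map Leaf xs)"
  have two: "reordering (QNode [A, B]) T \<longleftrightarrow>
      (\<exists>a b. reordering A a \<and> reordering B b \<and> (T = QNode [a, b] \<or> T = QNode [b, a]))" for A B T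
    unfolding reordering_QNode_iff by (fastforce simp: list_all2_Cons1)
  have "{T. reordering ?T T} =
      {QNode [?Q xs, ?Q ys], QNode [?Q xs, ?Q (rev ys)], QNode [?Q (rev xs), ?Q ys],
       QNode [?Q (rev xs), ?Q (rev ys)], QNode [?Q ys, ?Q xs], QNode [?Q (rev ys), ?Q xs],
       QNode [?Q ys, ?Q (rev xs)], QNode [?Q (rev ys), ?Q (rev xs)]}"
    unfolding two reordering_flat_iff by blast
  moreover have "leaf_seq (QNode [A, B]) = leaf_seq A @ leaf_seq B" for A B by simp
  ultimately show ?thesis unfolding leaf_lists_image
    by (simp only: image_insert image_empty leaf_seq_QNode_Leaf)
qed

lemma pqtree_on_flat:
  "xs \<noteq> [] \<Longrightarrow> distinct xs \<Longrightarrow> set xs = {0..<n} \<Longrightarrow> pqtree_on n (QNode (map Leaf xs))"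
  unfolding pqtree_on_def leaf_seq_QNode_Leaf by simp

lemma pqtree_on_two_level:
  assumes "xs \<noteq> []" "ys \<noteq> []" "distinct (xs @ ys)" "set (xs @ ys) = {0..<n}"
  shows "pqtree_on n (QNode [QNode (map Leaf xs), QNode (map Leaf ys)])"
proof -
  have "leaf_seq (QNode [A, B]) = leaf_seq A @ leaf_seq B" for A B by simp
  then have "leaf_seq (QNode [QNode (map Leaf xs), QNode (map Leaf ys)]) = xs @ ys"
    by (simp only: leaf_seq_QNode_Leaf)
  then show ?thesis unfolding pqtree_on_def using assms by simp
qed

text \<open>Equality of circular arrangements up to rotation and reflection, expressed by positions
  so that it applies to lists directly.\<close>

definition dih_related :: "nat \<Rightarrow> 'a list \<Rightarrow> 'a list \<Rightarrow> bool" where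
  "dih_related n L M \<longleftrightarrow> (\<exists>\<rho>. is_dihedral n \<rho> \<and> (\<forall>k<n. M ! k = L ! \<rho> k))"

lemma dih_related_refl: "dih_related n L L"
  unfolding dih_related_def using is_dihedral_id by (metis id_apply)

lemma is_dihedral_less: "is_dihedral n \<rho> \<Longrightarrow> k < n \<Longrightarrow> \<rho> k < n"
  using permutes_less_iff unfolding is_dihedral_def by blast

lemma dih_related_sym:
  assumes "dih_related n L M"
  shows "dih_related n M L"
proof -
  obtain \<rho> where r: "is_dihedral n \<rho>" "\<And>k. k < n \<Longrightarrow> M ! k = L ! \<rho> k"
    using assms unfolding dih_related_def by blast
  then have p: "\<rho> permutes {0..<n}" by (simp add: is_dihedral_def)
  have i: "is_dihedral n (inv_into UNIV \<rho>)" using is_dihedral_inv r(1) .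
  have "L ! k = M ! inv_into UNIV \<rho> k" if "k < n" for k
    using r(2)[OF is_dihedral_less[OF i that]] by (simp add: permutes_inverses[OF p])
  then show ?thesis unfolding dih_related_def using i by blast
qed

lemma dih_related_trans:
  assumes "dih_related n L M" "dih_related n M N"
  shows "dih_related n L N"
proof -
  obtain \<rho> \<tau> where r: "is_dihedral n \<rho>" "\<And>k. k < n \<Longrightarrow> M ! k = L ! \<rho> k"
    and t: "is_dihedral n \<tau>" "\<And>k. k < n \<Longrightarrow> N ! k = M ! \<tau> k"
    using assms unfolding dih_related_def by blast
  have "N ! k = L ! (\<rho> \<circ> \<tau>) k" if "k < n" for k
    using r(2) t(2) is_dihedral_less[OF t(1)] that by simp
  then show ?thesis unfolding dih_related_def using is_dihedral_comp[OF r(1) t(1)] by blast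
qed

lemma dih_related_rev: "length L = n \<Longrightarrow> dih_related n L (rev L)"
  unfolding dih_related_def
  by (intro exI[of _ "reflection_perm n"])
    (auto simp: is_dihedral_reflection reflection_perm_def rev_nth)

lemma dih_related_append:
  assumes "length (A @ B) = n"
  shows "dih_related n (A @ B) (B @ A)"
proof -
  \<comment> \<open>Exchanging the two blocks is the rotation by \<open>length A\<close>.\<close>
  let ?r = "\<lambda>i. if i < n then nat ((int (length A) + 1 * int i) mod int n) else i"
  have "(B @ A) ! k = (A @ B) ! ?r k" if k: "k < n" for k
  proof (cases "k < length B")
    case True
    then have "?r k = length A + k" using assms by simp
    then show ?thesis using True by (simp add: nth_append)
  next
    case False
    have "(int (length A) + int k) mod int n = (int (length A) + int k - int n) mod int n" by simp
    also have "\<dots> = int (length A) + int k - int n"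
      using assms False k by (intro mod_pos_pos_trivial) auto
    finally have "?r k = k - length B" using assms False k by simp
    moreover have "k - length B < length A" using assms False k by simp
    ultimately show ?thesis using False by (simp add: nth_append)
  qed
  then show ?thesis unfolding dih_related_def using is_dihedral_affine[of 1 n "int (length A)"] by blast
qed

lemma circ_valid_dihedral:
  assumes r: "is_dihedral n \<rho>" and v: "circ_valid n E"
    and sym: "\<And>i j. i < n \<Longrightarrow> j < n \<Longrightarrow> E i j = E j i"
  shows "circ_valid n (\<lambda>i j. E (\<rho> i) (\<rho> j))"
  unfolding circ_valid_def
proof (intro allI impI)
  fix i j k l assume c: "cyclically_ordered n i j k l"
  then have lt: "\<rho> i < n" "\<rho> j < n" "\<rho> k < n" "\<rho> l < n"
    using is_dihedral_less[OF r] by (auto simp: cyclically_ordered_def)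
  from is_dihedral_cyclically_ordered[OF r c]
  show "min (E (\<rho> j) (\<rho> k)) (E (\<rho> k) (\<rho> l)) < E (\<rho> i) (\<rho> k)"
  proof
    assume "cyclically_ordered n (\<rho> i) (\<rho> j) (\<rho> k) (\<rho> l)"
    then show ?thesis using v unfolding circ_valid_def by blast
  next
    assume "cyclically_ordered n (\<rho> i) (\<rho> l) (\<rho> k) (\<rho> j)"
    then have "min (E (\<rho> l) (\<rho> k)) (E (\<rho> k) (\<rho> j)) < E (\<rho> i) (\<rho> k)"
      using v unfolding circ_valid_def by blast
    then show ?thesis
      using sym[OF lt(4) lt(3)] sym[OF lt(3) lt(2)] by (simp add: min.commute)
  qed
qed

section \<open>Validity of lists and of orders\<close>

definition list_valid :: "nat \<Rightarrow> (nat \<Rightarrow> nat \<Rightarrow> real) \<Rightarrow> nat list \<Rightarrow> bool" where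
  "list_valid n d L \<longleftrightarrow> circ_valid n (\<lambda>i j. d (L ! i) (L ! j))"

lemma dih_related_list_valid:
  assumes "dih_related n L M" "list_valid n d L" "set L = {0..<n}" "length L = n"
    and "dissimilarity n d"
  shows "list_valid n d M"
proof -
  obtain \<rho> where r: "is_dihedral n \<rho>" "\<And>k. k < n \<Longrightarrow> M ! k = L ! \<rho> k"
    using assms(1) unfolding dih_related_def by blast
  have Llt: "L ! i < n" if "i < n" for i using nth_mem[of i L] that assms(3,4) by auto
  have "circ_valid n (\<lambda>i j. d (L ! \<rho> i) (L ! \<rho> j))"
    by (rule circ_valid_dihedral[OF r(1) assms(2)[unfolded list_valid_def]])
      (use assms(5) Llt in \<open>auto simp: dissimilarity_def\<close>)
  then show ?thesis
    unfolding list_valid_def using circ_valid_cong[of n "\<lambda>i j. d (M ! i) (M ! j)"] r(2) by auto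
qed

lemma list_valid_valid_order:
  assumes v: "list_valid n d L" and L: "set L = {0..<n}" "length L = n"
    and r: "is_dihedral n \<rho>" and p: "\<pi> permutes {0..<n}" and k: "\<And>k. k < n \<Longrightarrow> \<pi> (L ! k) = k"
    and d: "dissimilarity n d"
  shows "valid_order n d (\<rho> \<circ> \<pi>)"
proof -
  have rp: "\<rho> permutes {0..<n}" using r by (simp add: is_dihedral_def)
  let ?i = "inv_into UNIV \<rho>"
  have i: "is_dihedral n ?i" by (rule is_dihedral_inv[OF r])
  have Lp: "L ! \<pi> x = x" if "x < n" for x
  proof -
    have "x \<in> set L" using that L by simp
    then obtain t where "t < n" "L ! t = x" unfolding in_set_conv_nth using L(2) by blast
    then show ?thesis using k by auto
  qed
  have sym: "d (L ! x) (L ! y) = d (L ! y) (L ! x)" if "x < n" "y < n" for x y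
    using nth_mem[of x L] nth_mem[of y L] that L d by (auto simp: dissimilarity_def)
  have "circ_valid n (\<lambda>x y. d (L ! ?i x) (L ! ?i y))"
    by (rule circ_valid_dihedral[OF i v[unfolded list_valid_def]]) (rule sym)
  then have "min (d j k) (d k l) < d i k"
    if c: "cyclically_ordered n (\<rho> (\<pi> i)) (\<rho> (\<pi> j)) (\<rho> (\<pi> k)) (\<rho> (\<pi> l))" for i j k l
  proof -
    have "i < n" "j < n" "k < n" "l < n"
      using c permutes_less_iff[OF p] permutes_less_iff[OF rp] by (auto simp: cyclically_ordered_def)
    moreover have "min (d (L ! ?i (\<rho> (\<pi> j))) (L ! ?i (\<rho> (\<pi> k)))) (d (L ! ?i (\<rho> (\<pi> k))) (L ! ?i (\<rho> (\<pi> l))))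
        < d (L ! ?i (\<rho> (\<pi> i))) (L ! ?i (\<rho> (\<pi> k)))"
      using \<open>circ_valid n (\<lambda>x y. d (L ! ?i x) (L ! ?i y))\<close> c unfolding circ_valid_def by blast
    ultimately show ?thesis by (simp add: permutes_inverses[OF rp] Lp)
  qed
  then show ?thesis unfolding valid_order_def using permutes_compose[OF p rp] by simp
qed

lemma valid_order_list_valid:
  assumes v: "valid_order n d \<sigma>" and r: "is_dihedral n \<rho>" and k: "\<And>k. k < n \<Longrightarrow> \<sigma> (L ! k) = \<rho> k"
    and L: "set L = {0..<n}" "length L = n" and d: "dissimilarity n d"
  shows "list_valid n d L"
  unfolding list_valid_def circ_valid_def
proof (intro allI impI)
  fix i j k' l assume c: "cyclically_ordered n i j k' l"
  then have lt: "i < n" "j < n" "k' < n" "l < n" by (auto simp: cyclically_ordered_def)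
  have sym: "d (L ! x) (L ! y) = d (L ! y) (L ! x)" if "x < n" "y < n" for x y
    using nth_mem[of x L] nth_mem[of y L] that L d by (auto simp: dissimilarity_def)
  from is_dihedral_cyclically_ordered[OF r c]
  show "min (d (L ! j) (L ! k')) (d (L ! k') (L ! l)) < d (L ! i) (L ! k')"
  proof
    assume "cyclically_ordered n (\<rho> i) (\<rho> j) (\<rho> k') (\<rho> l)"
    then show ?thesis using v lt unfolding valid_order_def by (simp flip: k)
  next
    assume "cyclically_ordered n (\<rho> i) (\<rho> l) (\<rho> k') (\<rho> j)"
    then have "min (d (L ! l) (L ! k')) (d (L ! k') (L ! j)) < d (L ! i) (L ! k')"
      using v lt unfolding valid_order_def by (simp flip: k)
    then show ?thesis using sym[OF lt(4) lt(3)] sym[OF lt(3) lt(2)] by (simp add: min.commute)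
  qed
qed

text \<open>The eight leaf sequences of the two-level tree split into two dihedral classes, those of
  \<open>K @ K'\<close> and of \<open>K @ rev K'\<close>, and a flat tree yields sequences of one
  class. It therefore suffices that every leaf sequence is related to a valid candidate
  (\<open>good\<close>) and every valid candidate to a leaf sequence (\<open>reach\<close>).\<close>

lemma two_paths_tree:
  assumes d: "dissimilarity n d" and v0: "valid_order n d \<sigma>0"
    and dist: "distinct (K @ K')" and set: "set (K @ K') = {0..<n}" and ne: "K \<noteq> []" "K' \<noteq> []"
    and sK: "\<And>\<sigma>. valid_order n d \<sigma> \<Longrightarrow> cyc_path n \<sigma> K"
    and sK': "\<And>\<sigma>. valid_order n d \<sigma> \<Longrightarrow> cyc_path n \<sigma> K'"
    and E: "E = (\<lambda>i j. d ((K @ K') ! i) ((K @ K') ! j))" and m: "m = length K"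
    and T: "T = (if straight_test n m E then
        if flipped_test n m E then QNode [QNode (map Leaf K), QNode (map Leaf K')]
        else QNode (map Leaf (K @ K'))
      else QNode (map Leaf (K @ rev K')))"
  shows "pqtree_on n T"
    and "{\<sigma>. valid_order n d \<sigma>} = {\<rho> \<circ> \<pi> | \<rho> \<pi>. \<rho> \<in> Dih n \<and> \<pi> \<in> pq_perms n T}"
proof -
  let ?L = "K @ K'" and ?M = "K @ rev K'"
  have MK: "distinct ?M" "set ?M = {0..<n}" using dist set by auto
  show "pqtree_on n T"
    unfolding T using ne pqtree_on_two_level[OF ne dist set] pqtree_on_flat[OF _ dist set]
      pqtree_on_flat[OF _ MK] by simp
  have n: "length ?L = n" using distinct_card[OF dist] set by simp
  have mn: "0 < m" "m < n" using ne n by (auto simp: m)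
  have lenM: "length ?M = n" and setM: "set ?M = {0..<n}" using n set by auto
  have nthM: "?M ! i = ?L ! flip n m i" if "i < n" for i
    using that n m by (auto simp: nth_append flip_def rev_nth add.commute)
  have lM: "list_valid n d ?M \<longleftrightarrow> circ_valid n (\<lambda>i j. E (flip n m i) (flip n m j))"
    unfolding list_valid_def E by (rule circ_valid_cong) (simp add: nthM)
  have lL: "list_valid n d ?L \<longleftrightarrow> circ_valid n E" by (simp add: list_valid_def E)
  have Llt: "?L ! i < n" if "i < n" for i using nth_mem[of i ?L] that set n by auto
  have dE: "dissimilarity n E" using d Llt unfolding dissimilarity_def E by auto
  have cases: "\<exists>\<rho>. is_dihedral n \<rho> \<and> (\<exists>X\<in>{?L, ?M}. list_valid n d X \<and> (\<forall>k<n. \<sigma> (X ! k) = \<rho> k))"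
    if v: "valid_order n d \<sigma>" for \<sigma>
  proof -
    have p: "\<sigma> permutes {0..<n}" using v by (simp add: valid_order_def)
    obtain \<rho> where r: "is_dihedral n \<rho>"
      and or: "(\<forall>k<n. \<sigma> (?L ! k) = \<rho> k) \<or> (\<forall>k<n. \<sigma> (?M ! k) = \<rho> k)"
      using two_paths_order[OF p dist set ne sK[OF v] sK'[OF v]] by blast
    from or obtain X where X: "X \<in> {?L, ?M}" "\<forall>k<n. \<sigma> (X ! k) = \<rho> k" by blast
    then have "list_valid n d X"
      using valid_order_list_valid[OF v r, of X] d n set lenM setM by auto
    then show ?thesis using r X by blast
  qed
  have some: "list_valid n d ?L \<or> list_valid n d ?M" using cases[OF v0] by blast
  have swap: "dih_related n ?L ?M" if "\<not> (2 \<le> m \<and> m + 2 \<le> n)"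
  proof (cases "m = 1")
    case True
    then have "rev K = K" using m by (cases K) auto
    then have "?M = rev (K' @ K)" by simp
    then show ?thesis
      using dih_related_trans[OF dih_related_append dih_related_rev, of K K' n] n by simp
  next
    case False
    then have "length K' = 1" using that mn n m by auto
    then have "rev K' = K'" by (cases K') auto
    then show ?thesis using dih_related_refl by simp
  qed
  have both: "list_valid n d ?L \<and> list_valid n d ?M" if "\<not> (2 \<le> m \<and> m + 2 \<le> n)"
    using some dih_related_list_valid[OF swap[OF that] _ set n d]
      dih_related_list_valid[OF dih_related_sym[OF swap[OF that]] _ setM lenM d] by blast
  have tests: "straight_test n m E \<longleftrightarrow> list_valid n d ?L" "flipped_test n m E \<longleftrightarrow> list_valid n d ?M"
    if "2 \<le> m \<and> m + 2 \<le> n"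
    using tests_iff_valid[OF dE, of m] that some lL lM by auto
  have relL: "\<forall>Y\<in>{K @ K', K' @ K, rev K @ rev K', rev K' @ rev K}. dih_related n ?L Y"
  proof -
    have 1: "dih_related n ?L (K' @ K)" by (rule dih_related_append[OF n])
    have "dih_related n (K' @ K) (rev (K' @ K))" by (rule dih_related_rev) (use n in simp)
    then have "dih_related n ?L (rev K @ rev K')" using dih_related_trans[OF 1] by simp
    moreover have "dih_related n ?L (rev K' @ rev K)" using dih_related_rev[OF n] by simp
    ultimately show ?thesis using 1 dih_related_refl by auto
  qed
  have relM: "\<forall>Y\<in>{K @ rev K', rev K' @ K, rev K @ K', K' @ rev K}. dih_related n ?M Y"
  proof -
    have 1: "dih_related n ?M (rev K' @ K)" by (rule dih_related_append[OF lenM])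
    have "dih_related n (rev K' @ K) (rev (rev K' @ K))" by (rule dih_related_rev) (use n in simp)
    then have "dih_related n ?M (rev K @ K')" using dih_related_trans[OF 1] by simp
    moreover have "dih_related n ?M (K' @ rev K)" using dih_related_rev[OF lenM] by simp
    ultimately show ?thesis using 1 dih_related_refl by auto
  qed
  have good: "\<exists>X\<in>{?L, ?M}. list_valid n d X \<and> dih_related n X Y" if "Y \<in> leaf_lists T" for Y
  proof -
    consider "straight_test n m E" "flipped_test n m E" | "straight_test n m E" "\<not> flipped_test n m E"
      | "\<not> straight_test n m E" by blast
    then show ?thesis
    proof cases
      case 1
      have "Y \<in> {K @ K', K' @ K, rev K @ rev K', rev K' @ rev K} \<union>
          {K @ rev K', rev K' @ K, rev K @ K', K' @ rev K}"
        using that 1 unfolding T by (simp add: leaf_lists_two_level) blast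
      then have "dih_related n ?L Y \<or> dih_related n ?M Y" using relL relM by blast
      moreover have "list_valid n d ?L" "list_valid n d ?M"
        using 1 tests both by blast+
      ultimately show ?thesis by blast
    next
      case 2
      then have "Y \<in> {?L, rev ?L}" using that by (simp add: T leaf_lists_flat del: map_append rev_append)
      then have "dih_related n ?L Y" using dih_related_rev[OF n] dih_related_refl by auto
      moreover have "list_valid n d ?L" using 2 tests both by blast
      ultimately show ?thesis by blast
    next
      case 3
      then have "Y \<in> {?M, rev ?M}" using that by (simp add: T leaf_lists_flat del: map_append rev_append)
      then have "dih_related n ?M Y" using dih_related_rev[OF lenM] dih_related_refl by auto
      moreover have "list_valid n d ?M" using 3 tests both some by blast
      ultimately show ?thesis by blast
    qed
  qed
  have reach: "\<exists>Y\<in>leaf_lists T. dih_related n X Y" if X: "X \<in> {?L, ?M}" and vX: "list_valid n d X" for X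
  proof -
    consider "straight_test n m E" "flipped_test n m E" | "straight_test n m E" "\<not> flipped_test n m E"
      | "\<not> straight_test n m E" by blast
    then show ?thesis
    proof cases
      case 1
      then have "X \<in> leaf_lists T" using X by (auto simp: T leaf_lists_two_level)
      then show ?thesis using dih_related_refl by blast
    next
      case 2
      then have "?L \<in> leaf_lists T" by (simp add: T leaf_lists_flat del: map_append)
      moreover have "dih_related n X ?L"
        using X vX 2 tests swap dih_related_sym dih_related_refl by blast
      ultimately show ?thesis by blast
    next
      case 3
      then have "?M \<in> leaf_lists T" by (simp add: T leaf_lists_flat del: map_append)
      moreover have "dih_related n X ?M"
        using X vX 3 tests swap dih_related_refl by blast
      ultimately show ?thesis by blast
    qed
  qed
  show "{\<sigma>. valid_order n d \<sigma>} = {\<rho> \<circ> \<pi> | \<rho> \<pi>. \<rho> \<in> Dih n \<and> \<pi> \<in> pq_perms n T}"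
  proof (intro equalityI subsetI)
    fix \<sigma> assume "\<sigma> \<in> {\<sigma>. valid_order n d \<sigma>}"
    then have v: "valid_order n d \<sigma>" by simp
    then obtain \<rho> X where r: "is_dihedral n \<rho>" and X: "X \<in> {?L, ?M}" "list_valid n d X"
      and k: "\<And>k. k < n \<Longrightarrow> \<sigma> (X ! k) = \<rho> k" using cases by blast
    obtain Y where Y: "Y \<in> leaf_lists T" "dih_related n X Y" using reach[OF X] by blast
    then obtain \<tau> where t: "is_dihedral n \<tau>" "\<And>k. k < n \<Longrightarrow> Y ! k = X ! \<tau> k"
      unfolding dih_related_def by blast
    have rt: "is_dihedral n (\<rho> \<circ> \<tau>)" by (rule is_dihedral_comp[OF r t(1)])
    then have rtp: "(\<rho> \<circ> \<tau>) permutes {0..<n}" by (simp add: is_dihedral_def)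
    \<comment> \<open>\<sigma> sends the j-th entry of Y to the image of j under \<rho> \<circ>
      \<tau>; dividing by that map leaves the position map of Y.\<close>
    let ?\<pi> = "inv_into UNIV (\<rho> \<circ> \<tau>) \<circ> \<sigma>"
    have "?\<pi> permutes {0..<n}"
      using v permutes_compose permutes_inv[OF rtp] unfolding valid_order_def by blast
    moreover have "?\<pi> (Y ! j) = j" if "j < n" for j
    proof -
      have "\<sigma> (Y ! j) = (\<rho> \<circ> \<tau>) j" using t(2)[OF that] k is_dihedral_less[OF t(1) that] by simp
      then show ?thesis using permutes_inverses(2)[OF rtp, of j] by simp
    qed
    ultimately have "?\<pi> \<in> pq_perms n T" using Y(1) by (auto simp: pq_perms_leaf_lists)
    moreover have "\<sigma> = (\<rho> \<circ> \<tau>) \<circ> ?\<pi>"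
      using permutes_inverses(1)[OF rtp] by (auto simp: fun_eq_iff)
    moreover have "\<rho> \<circ> \<tau> \<in> Dih n" using rt by (simp add: Dih_eq)
    ultimately show "\<sigma> \<in> {\<rho> \<circ> \<pi> | \<rho> \<pi>. \<rho> \<in> Dih n \<and> \<pi> \<in> pq_perms n T}" by blast
  next
    fix \<sigma> assume "\<sigma> \<in> {\<rho> \<circ> \<pi> | \<rho> \<pi>. \<rho> \<in> Dih n \<and> \<pi> \<in> pq_perms n T}"
    then obtain \<rho> \<pi> Y where s: "\<sigma> = \<rho> \<circ> \<pi>" and r: "is_dihedral n \<rho>" and p: "\<pi> permutes {0..<n}"
      and Y: "Y \<in> leaf_lists T" "\<And>k. k < n \<Longrightarrow> \<pi> (Y ! k) = k"
      by (auto simp: Dih_eq pq_perms_leaf_lists)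
    obtain X where X: "X \<in> {?L, ?M}" "list_valid n d X" "dih_related n X Y" using good[OF Y(1)] by blast
    obtain \<tau> where t: "is_dihedral n \<tau>" "\<And>k. k < n \<Longrightarrow> Y ! k = X ! \<tau> k"
      using X(3) unfolding dih_related_def by blast
    then have tp: "\<tau> permutes {0..<n}" by (simp add: is_dihedral_def)
    let ?t = "inv_into UNIV \<tau>"
    have it: "is_dihedral n ?t" by (rule is_dihedral_inv[OF t(1)])
    have tp': "(\<tau> \<circ> \<pi>) permutes {0..<n}" by (rule permutes_compose[OF p tp])
    have "(\<tau> \<circ> \<pi>) (X ! j) = j" if "j < n" for j
    proof -
      have "X ! j = Y ! ?t j"
        using t(2)[OF is_dihedral_less[OF it that]] by (simp add: permutes_inverses[OF tp])
      then show ?thesis using Y(2)[OF is_dihedral_less[OF it that]] by (simp add: permutes_inverses[OF tp])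
    qed
    \<comment> \<open>The inserted \<tau> and its inverse cancel; \<tau> \<circ> \<pi> is the
      position map of X, the list known to be valid.\<close>
    then have "valid_order n d ((\<rho> \<circ> ?t) \<circ> (\<tau> \<circ> \<pi>))"
      using list_valid_valid_order[OF X(2) _ _ is_dihedral_comp[OF r it] tp' _ d] X(1) set n setM lenM by auto
    moreover have "(\<rho> \<circ> ?t) \<circ> (\<tau> \<circ> \<pi>) = \<sigma>" by (simp add: s fun_eq_iff permutes_inverses[OF tp])
    ultimately show "\<sigma> \<in> {\<sigma>. valid_order n d \<sigma>}" by simp
  qed
qed

section \<open>Reasoning about programs\<close>

text \<open>A total-correctness triple in predicate-transformer form. The time is handed to the
  postcondition, so costs add up along a sequence; by determinism, exhibiting one run describes
  every run.\<close>

definition run :: "real mat \<Rightarrow> com \<Rightarrow> memory \<Rightarrow> (nat \<Rightarrow> memory \<Rightarrow> bool) \<Rightarrow> bool" where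
  "run D c s Q \<longleftrightarrow> (\<exists>t s'. exec D c s t s' \<and> Q t s')"

inductive_simps exec_Skip_iff: "exec D Skip s t s'"
inductive_simps exec_Assign_iff: "exec D (Assign x a b) s t s'"
inductive_simps exec_Seq_iff: "exec D (Seq c1 c2) s t s'"
inductive_simps exec_Cond_iff: "exec D (Cond b c1 c2) s t s'"

lemma run_Skip: "run D Skip s Q \<longleftrightarrow> Q 1 s"
  by (auto simp: run_def exec_Skip_iff)

lemma run_Assign: "run D (Assign x a b) s Q \<longleftrightarrow> Q (1 + acost a + acost b) (store s x (aval a s) (aval b s))"
  by (auto simp: run_def exec_Assign_iff)

lemma run_Seq: "run D (Seq c1 c2) s Q \<longleftrightarrow> run D c1 s (\<lambda>t1 s1. run D c2 s1 (\<lambda>t2. Q (t1 + t2)))"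
  unfolding run_def exec_Seq_iff by blast

lemma run_Cond: "run D (Cond b c1 c2) s Q \<longleftrightarrow>
    (if bval D b s then run D c1 s (\<lambda>t. Q (1 + bcost b + t)) else run D c2 s (\<lambda>t. Q (1 + bcost b + t)))"
  unfolding run_def exec_Cond_iff by (auto simp: exec_Cond_iff)

lemmas run_simps = run_Skip run_Assign run_Seq run_Cond

lemma run_mono: "run D c s P \<Longrightarrow> (\<And>t s'. P t s' \<Longrightarrow> Q t s') \<Longrightarrow> run D c s Q"
  unfolding run_def by blast

text \<open>Indexing the invariant by the loop counter fixes the number of rounds as b - a; each
  costs at most \<open>T\<close> plus the guard, and the last summand pays for the failing guard.
  The induction goes backwards from the exit value.\<close>

lemma run_While:
  assumes "I a s" "a \<le> b"
    and step: "\<And>k s. a \<le> k \<Longrightarrow> k < b \<Longrightarrow> I k s \<Longrightarrow>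
      bval D g s \<and> run D c s (\<lambda>t s'. t \<le> T \<and> I (Suc k) s')"
    and exit: "\<And>s. I b s \<Longrightarrow> \<not> bval D g s"
    and post: "\<And>t s. I b s \<Longrightarrow> t \<le> (b - a) * (T + 1 + bcost g) + 1 + bcost g \<Longrightarrow> Q t s"
  shows "run D (While g c) s Q"
proof -
  have "\<exists>t s'. exec D (While g c) s t s' \<and> t \<le> (b - a) * (T + 1 + bcost g) + 1 + bcost g \<and> I b s'"
    using assms(2,1) step
  proof (induction arbitrary: s rule: inc_induct)
    case base
    then show ?case using exec.WhileFalse[OF exit] by fastforce
  next
    case (step k)
    obtain t1 s1 where 1: "bval D g s" "exec D c s t1 s1" "t1 \<le> T" "I (Suc k) s1"
      using step.prems(2)[OF le_refl step.hyps(2) step.prems(1)] unfolding run_def by blast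
    obtain t2 s2 where 2: "exec D (While g c) s1 t2 s2"
      "t2 \<le> (b - Suc k) * (T + 1 + bcost g) + 1 + bcost g" "I b s2"
      using step.IH[OF 1(4)] step.prems(2) Suc_leD by blast
    have "b - k = Suc (b - Suc k)" using step.hyps by simp
    then have "1 + bcost g + t1 + t2 \<le> (b - k) * (T + 1 + bcost g) + 1 + bcost g"
      using 1(3) 2(2) by simp
    then show ?case using exec.WhileTrue[OF 1(1,2) 2(1)] 2(3) by blast
  qed
  then show ?thesis unfolding run_def using post by blast
qed

abbreviation same_except :: "string set \<Rightarrow> memory \<Rightarrow> memory \<Rightarrow> bool" where
  "same_except X s s' \<equiv> \<forall>x. x \<notin> X \<longrightarrow> s' x = s x"

abbreviation seq_com :: "com \<Rightarrow> com \<Rightarrow> com" (infixr ";;" 60) where "c ;; c' \<equiv> Seq c c'"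
abbreviation scalar :: "string \<Rightarrow> aexp" where "scalar x \<equiv> Cell x (Const 0)"
abbreviation set_scalar :: "string \<Rightarrow> aexp \<Rightarrow> com" (infix "::=" 61) where "x ::= a \<equiv> Assign x (Const 0) a"
abbreviation incr :: "string \<Rightarrow> com" where "incr x \<equiv> x ::= Plus (scalar x) (Const 1)"

section \<open>Prim's algorithm\<close>

text \<open>In \<open>prim\<close> the search starts with \<open>b\<close> = 0, a vertex already in
  the tree, which thus means "no candidate yet": any free vertex replaces a \<open>b\<close> inside
  the tree, and a lighter one replaces a free \<open>b\<close>.\<close>

abbreviation closer_than_best :: bexp where
  "closer_than_best \<equiv> BAnd (Less (Cell ''in'' (scalar ''j'')) (Const 1))
             (BNot (BAnd (Less (Cell ''in'' (scalar ''b'')) (Const 1))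
               (BNot (EntryLess (Cell ''par'' (scalar ''j'')) (scalar ''j'')
                                (Cell ''par'' (scalar ''b'')) (scalar ''b'')))))"

definition find_next :: com where
  "find_next = ''b'' ::= Const 0 ;; ''j'' ::= Const 0 ;;
   While (Less (scalar ''j'') (scalar ''n''))
     (Cond closer_than_best
        (''b'' ::= scalar ''j'') Skip ;;
      incr ''j'')"

text \<open>Leaving \<open>m\<close> unchanged requires the new edge to be strictly lighter, so ties
  move \<open>m\<close> to the later edge, as \<open>last_heaviest\<close> demands.\<close>

definition record_next :: com where
  "record_next = Assign ''in'' (scalar ''b'') (Const 1) ;; Assign ''seq'' (scalar ''i'') (scalar ''b'') ;;
   Cond (EntryLess (Cell ''par'' (scalar ''b'')) (scalar ''b'')
          (Cell ''par'' (Cell ''seq'' (scalar ''m''))) (Cell ''seq'' (scalar ''m'')))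
     Skip (''m'' ::= scalar ''i'')"

abbreviation closer_to_new :: bexp where
  "closer_to_new \<equiv> BAnd (Less (Cell ''in'' (scalar ''j'')) (Const 1))
             (EntryLess (scalar ''b'') (scalar ''j'') (Cell ''par'' (scalar ''j'')) (scalar ''j''))"

definition update_parents :: com where
  "update_parents = ''j'' ::= Const 0 ;;
   While (Less (scalar ''j'') (scalar ''n''))
     (Cond closer_to_new
        (Assign ''par'' (scalar ''j'') (scalar ''b'')) Skip ;;
      incr ''j'')"

definition prim :: com where
  "prim = Assign ''in'' (Const 0) (Const 1) ;; ''i'' ::= Const 1 ;;
   While (Less (scalar ''i'') (scalar ''n''))
     (find_next ;; record_next ;; update_parents ;; incr ''i'')"

section \<open>Correctness of the stages of one round\<close>

lemma run_find_next:
  fixes D :: "real mat" and s :: memory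
  assumes n: "s ''n'' 0 = n" "0 < n" and free: "\<exists>u<n. s ''in'' u = 0"
  defines "w \<equiv> (\<lambda>u. entry D (s ''par'' u) u)"
  shows "run D find_next s (\<lambda>t s'. t \<le> 50 * n + 50 \<and> same_except {''b'', ''j''} s s' \<and>
    s' ''b'' 0 < n \<and> s ''in'' (s' ''b'' 0) = 0 \<and> (\<forall>u<n. s ''in'' u = 0 \<longrightarrow> w (s' ''b'' 0) \<le> w u))"
proof -
  define I where "I k s' \<longleftrightarrow> same_except {''b'', ''j''} s s' \<and> s' ''j'' 0 = k \<and> s' ''b'' 0 < n \<and>
    (if s ''in'' (s' ''b'' 0) = 0 then \<forall>u<k. s ''in'' u = 0 \<longrightarrow> w (s' ''b'' 0) \<le> w u
     else \<forall>u<k. s ''in'' u \<noteq> 0)" for k s'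
  show ?thesis
    unfolding find_next_def run_Seq run_Assign
  proof (rule run_While[where I = I and a = 0 and b = n and T = 40])
    fix k s' assume k: "k < n" and I: "I k s'"
    then have s': "s' ''n'' = s ''n''" "s' ''in'' = s ''in''" "s' ''par'' = s ''par''" "s' ''j'' 0 = k"
      by (auto simp: I_def)
    let ?b = "s' ''b'' 0"
    define C where "C \<longleftrightarrow> s ''in'' k = 0 \<and> (s ''in'' ?b = 0 \<longrightarrow> w k < w ?b)"
    have c: "bval D closer_than_best s' \<longleftrightarrow> C"
      by (auto simp: s' w_def C_def)
    have I': "I (Suc k) s''" if "\<And>x. x \<notin> {''b'', ''j''} \<Longrightarrow> s'' x = s' x" "s'' ''j'' 0 = Suc k"
      "s'' ''b'' 0 = (if C then k else ?b)" for s''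
    proof -
      have b: "?b < n" and less: "s ''in'' ?b = 0 \<Longrightarrow> u < k \<Longrightarrow> s ''in'' u = 0 \<Longrightarrow> w ?b \<le> w u"
        and none: "s ''in'' ?b \<noteq> 0 \<Longrightarrow> u < k \<Longrightarrow> s ''in'' u \<noteq> 0" for u
        using I by (auto simp: I_def split: if_splits)
      have fr: "same_except {''b'', ''j''} s s''" using I that(1) by (simp add: I_def)
      show ?thesis
      proof (cases C)
        case True
        then have k0: "s ''in'' k = 0" "s ''in'' ?b = 0 \<Longrightarrow> w k < w ?b" by (simp_all only: C_def)
        have "w k \<le> w u" if "u < Suc k" "s ''in'' u = 0" for u
          using that k0 less[of u] none[of u] by (cases "u = k") fastforce+
        then show ?thesis using True fr that(2,3) k k0 by (simp add: I_def)
      next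
        case False
        show ?thesis
        proof (cases "s ''in'' ?b = 0")
          case in0: True
          have "w ?b \<le> w u" if "u < Suc k" "s ''in'' u = 0" for u
            using that False in0 less[of u] unfolding C_def by (cases "u = k") auto
          then show ?thesis using False fr that(2,3) b in0 by (simp add: I_def)
        next
          case in1: False
          have "s ''in'' u \<noteq> 0" if "u < Suc k" for u
            using that False in1 none[of u] unfolding C_def by (cases "u = k") auto
          then show ?thesis using False fr that(2,3) b in1 by (simp add: I_def)
        qed
      qed
    qed
    have "run D (Cond closer_than_best (''b'' ::= scalar ''j'') Skip ;; incr ''j'') s' (\<lambda>t s''. t \<le> 40 \<and>
      same_except {''b'', ''j''} s' s'' \<and> s'' ''j'' 0 = Suc k \<and>
      s'' ''b'' 0 = (if C then k else ?b))"
      unfolding run_simps c by (simp add: store_def s')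
    then show "bval D (Less (scalar ''j'') (scalar ''n'')) s' \<and>
      run D (Cond closer_than_best (''b'' ::= scalar ''j'') Skip ;; incr ''j'') s' (\<lambda>t s'. t \<le> 40 \<and> I (Suc k) s')"
      using k n I' by (auto simp: s' elim!: run_mono)
  qed (use n free in \<open>auto simp: I_def store_def split: if_splits\<close>)
qed

lemma run_record_next:
  fixes D :: "real mat" and s :: memory
  defines "b \<equiv> s ''b'' 0"
  defines "v \<equiv> (s ''seq'')(s ''i'' 0 := b)"
  defines "w \<equiv> (\<lambda>u. entry D (s ''par'' u) u)"
  shows "run D record_next s (\<lambda>t s'. t \<le> 40 \<and> same_except {''in'', ''seq'', ''m''} s s' \<and>
    s' ''in'' = (s ''in'')(b := 1) \<and> s' ''seq'' = v \<and>
    s' ''m'' 0 = (if w b < w (v (s ''m'' 0)) then s ''m'' 0 else s ''i'' 0))"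
  unfolding record_next_def run_simps
  by (auto simp: store_def v_def w_def b_def)

lemma run_update_parents:
  assumes n: "s ''n'' 0 = n"
  defines "b \<equiv> s ''b'' 0"
  shows "run D update_parents s (\<lambda>t s'. t \<le> 40 * n + 40 \<and> same_except {''par'', ''j''} s s' \<and>
    (\<forall>u. s' ''par'' u =
      (if u < n \<and> s ''in'' u = 0 \<and> entry D b u < entry D (s ''par'' u) u then b else s ''par'' u)))"
proof -
  define I where "I k s' \<longleftrightarrow> same_except {''par'', ''j''} s s' \<and> s' ''j'' 0 = k \<and>
    (\<forall>u. s' ''par'' u =
      (if u < k \<and> s ''in'' u = 0 \<and> entry D b u < entry D (s ''par'' u) u then b else s ''par'' u))" for k s'
  show ?thesis
    unfolding update_parents_def run_Seq run_Assign
  proof (rule run_While[where I = I and a = 0 and b = n and T = 30])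
    fix k s' assume k: "k < n" and I: "I k s'"
    then have s': "s' ''n'' = s ''n''" "s' ''in'' = s ''in''" "s' ''b'' = s ''b''" "s' ''j'' 0 = k"
      by (auto simp: I_def)
    show "bval D (Less (scalar ''j'') (scalar ''n'')) s' \<and> run D
     (Cond closer_to_new
        (Assign ''par'' (scalar ''j'') (scalar ''b'')) Skip ;;
      incr ''j'') s' (\<lambda>t s'. t \<le> 30 \<and> I (Suc k) s')"
      using k I n unfolding run_simps
      by (auto simp: s' I_def store_def less_Suc_eq b_def)
  qed (use n in \<open>auto simp: I_def store_def\<close>)
qed

text \<open>For an unvisited vertex \<open>p\<close> is a nearest visited one; for a visited vertex
  it is frozen. The clauses \<open>v 0 = 0\<close> and \<open>p 0 = 0\<close> give index 0 a dummy
  edge of weight \<open>d 0 0\<close>, which is 0 for a dissimilarity, so that \<open>m\<close> = 0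
  is a meaningful start value.\<close>

definition prim_inv ::
  "nat \<Rightarrow> (nat \<Rightarrow> nat \<Rightarrow> real) \<Rightarrow> nat \<Rightarrow> (nat \<Rightarrow> nat) \<Rightarrow> (nat \<Rightarrow> nat) \<Rightarrow> nat \<Rightarrow> bool" where
  "prim_inv n d i v p m \<longleftrightarrow>
     0 < i \<and> i \<le> n \<and> v 0 = 0 \<and> p 0 = 0 \<and> inj_on v {..<i} \<and> v ` {..<i} \<subseteq> {..<n} \<and>
     (\<forall>u<n. u \<notin> v ` {..<i} \<longrightarrow> p u \<in> v ` {..<i} \<and> (\<forall>a\<in>v ` {..<i}. d (p u) u \<le> d a u)) \<and>
     (\<forall>k. 0 < k \<and> k < i \<longrightarrow> p (v k) \<in> v ` {..<k} \<and>
        (\<forall>a\<in>v ` {..<k}. \<forall>u<n. u \<notin> v ` {..<k} \<longrightarrow> d (p (v k)) (v k) \<le> d a u)) \<and>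
     m < i \<and> (1 < i \<longrightarrow> 0 < m) \<and>
     (\<forall>k. 0 < k \<and> k < i \<longrightarrow> d (p (v k)) (v k) \<le> d (p (v m)) (v m)) \<and>
     (\<forall>k. m < k \<and> k < i \<longrightarrow> d (p (v k)) (v k) < d (p (v m)) (v m))"

lemma prim_inv_step:
  assumes inv: "prim_inv n d i v p m" and i: "i < n" and d: "dissimilarity n d"
    and b: "b < n" "b \<notin> v ` {..<i}"
    and min: "\<And>u. u < n \<Longrightarrow> u \<notin> v ` {..<i} \<Longrightarrow> d (p b) b \<le> d (p u) u"
    and v': "v' = v(i := b)"
    and p': "\<And>u. p' u = (if u < n \<and> u \<notin> v' ` {..<Suc i} \<and> d b u < d (p u) u then b else p u)"
    and m': "m' = (if d (p b) b < d (p (v m)) (v m) then m else i)"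
  shows "prim_inv n d (Suc i) v' p' m'"
proof -
  have I: "0 < i" "v 0 = 0" "p 0 = 0" "inj_on v {..<i}" "v ` {..<i} \<subseteq> {..<n}"
    and par: "\<And>u. u < n \<Longrightarrow> u \<notin> v ` {..<i} \<Longrightarrow> p u \<in> v ` {..<i} \<and> (\<forall>a\<in>v ` {..<i}. d (p u) u \<le> d a u)"
    and tree: "\<And>k. 0 < k \<Longrightarrow> k < i \<Longrightarrow> p (v k) \<in> v ` {..<k} \<and>
        (\<forall>a\<in>v ` {..<k}. \<forall>u<n. u \<notin> v ` {..<k} \<longrightarrow> d (p (v k)) (v k) \<le> d a u)"
    and m: "m < i" "1 < i \<Longrightarrow> 0 < m"
    and heavy: "\<And>k. 0 < k \<Longrightarrow> k < i \<Longrightarrow> d (p (v k)) (v k) \<le> d (p (v m)) (v m)"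
    and heavy': "\<And>k. m < k \<Longrightarrow> k < i \<Longrightarrow> d (p (v k)) (v k) < d (p (v m)) (v m)"
    using inv unfolding prim_inv_def by auto
  have img: "v' ` {..<k} = v ` {..<k}" if "k \<le> i" for k using that by (auto simp: v')
  have imgS: "v' ` {..<Suc i} = insert b (v ` {..<i})"
    unfolding lessThan_Suc image_insert using img[of i] v' by simp
  have vk: "v' k = v k" if "k < i" for k using that by (simp add: v')
  have vi: "v' i = b" by (simp add: v')
  have pk: "p' (v' k) = p (v' k)" if "k < Suc i" for k
    using that by (auto simp: p')
  have pv: "p' (v' k) = p (v k)" if "k < i" for k using pk[of k] vk[of k] that by simp
  have pb: "p' (v' i) = p b" using pk[of i] vi by simp
  have z: "d (p (v 0)) (v 0) = 0" using I d i by (auto simp: dissimilarity_def)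
  have nn: "0 \<le> d x y" if "x < n" "y < n" for x y using d that by (auto simp: dissimilarity_def)
  have pbn: "p b < n" using par[OF b] I(5) by auto
  \<comment> \<open>The dummy edge has weight 0 and no edge is lighter, so the first real edge takes
    over \<open>m\<close>.\<close>
  have m'0: "m' = i \<or> m' = m \<and> 0 < m"
  proof (cases "m = 0")
    case True
    then show ?thesis using z nn[OF pbn b(1)] by (auto simp: m')
  qed (auto simp: m')
  have wm': "d (p' (v' m')) (v' m') = max (d (p b) b) (d (p (v m)) (v m))"
    using m pv[of m] vk[of m] pb vi by (auto simp: m')
  show ?thesis
    unfolding prim_inv_def
  proof (intro conjI allI impI)
    show "v' 0 = 0" "p' 0 = 0"
    proof -
      show "v' 0 = 0" using I vk by simp
      then show "p' 0 = 0" using pk[of 0] I by simp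
    qed
    show "inj_on v' {..<Suc i}"
      using I(4) b(2) img[of i] by (auto simp: lessThan_Suc v' inj_on_fun_updI)
    show "v' ` {..<Suc i} \<subseteq> {..<n}" using imgS I b by auto
    show "m' < Suc i" using m'0 m by auto
    show "0 < m'" using m'0 I by auto
    show "Suc i \<le> n" using i by simp
    fix u assume u: "u < n" "u \<notin> v' ` {..<Suc i}"
    then have uo: "u \<notin> v ` {..<i}" by (auto simp: imgS)
    show "p' u \<in> v' ` {..<Suc i}" using par[OF u(1) uo] by (auto simp: p' imgS)
    show "\<forall>a\<in>v' ` {..<Suc i}. d (p' u) u \<le> d a u"
    proof -
      have "d (p' u) u \<le> d b u" "d (p' u) u \<le> d (p u) u" using u by (auto simp: p')
      then show ?thesis using par[OF u(1) uo] unfolding imgS by (auto intro: order_trans)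
    qed
  next
    fix k assume k: "0 < k \<and> k < Suc i"
    show "p' (v' k) \<in> v' ` {..<k}"
      using k tree[of k] par[OF b] pv[of k] pb img[of k] by (cases "k = i") auto
    show "d (p' (v' k)) (v' k) \<le> d (p' (v' m')) (v' m')"
      unfolding wm' using k heavy[of k] pv[of k] vk[of k] pb vi by (cases "k = i") auto
  next
    fix k assume k: "0 < k \<and> k < Suc i"
    show "\<forall>a\<in>v' ` {..<k}. \<forall>u<n. u \<notin> v' ` {..<k} \<longrightarrow> d (p' (v' k)) (v' k) \<le> d a u"
    proof (cases "k = i")
      case True
      \<comment> \<open>Two comparisons: with the stored edge of \<open>u\<close>, by the choice of
        \<open>b\<close>, and from there with \<open>a\<close>, since the parent of \<open>u\<close>
        is its nearest visited vertex.\<close>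
      have "d (p b) b \<le> d a u" if "a \<in> v ` {..<i}" "u < n" "u \<notin> v ` {..<i}" for a u
        using min[OF that(2,3)] par[OF that(2,3)] that(1) by (meson order_trans)
      then show ?thesis using True pb vi img[of i] by simp
    next
      case False
      then show ?thesis using k tree[of k] pv[of k] vk[of k] img[of k] by auto
    qed
  next
    fix k assume k: "m' < k \<and> k < Suc i"
    then have "m' = m" "d (p b) b < d (p (v m)) (v m)" by (auto simp: m' split: if_splits)
    then show "d (p' (v' k)) (v' k) < d (p' (v' m')) (v' m')"
      unfolding wm' using k heavy'[of k] pv[of k] vk[of k] pb vi by (cases "k = i") auto
  qed (use I in auto)
qed

lemma prim_inv_final:
  assumes inv: "prim_inv n d n v p m" and n: "1 < n"
  shows "prim_tree n d v p" "last_heaviest n d v p m"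
proof -
  have inj: "inj_on v {..<n}" and sub: "v ` {..<n} \<subseteq> {..<n}"
    using inv by (auto simp: prim_inv_def)
  then have img: "v ` {..<n} = {..<n}" by (simp add: endo_inj_surj)
  have out: "u < n \<and> u \<notin> v ` {..<i}" if u: "u \<in> v ` {i..<n}" and i: "i < n" for u i
  proof -
    obtain j where j: "i \<le> j" "j < n" "u = v j" using u by auto
    have "u \<noteq> v k" if "k < i" for k using inj_onD[OF inj, of j k] j that by auto
    then show ?thesis using j sub by auto
  qed
  have tree: "p (v k) \<in> v ` {..<k} \<and>
        (\<forall>a\<in>v ` {..<k}. \<forall>u<n. u \<notin> v ` {..<k} \<longrightarrow> d (p (v k)) (v k) \<le> d a u)"
    if "0 < k \<and> k < n" for k
    using inv that by (auto simp: prim_inv_def)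
  show "prim_tree n d v p"
    unfolding prim_tree_def
  proof (intro conjI allI impI ballI)
    fix i a u assume "0 < i \<and> i < n" "a \<in> v ` {..<i}" "u \<in> v ` {i..<n}"
    then show "d (p (v i)) (v i) \<le> d a u" using tree[of i] out[of u i] by blast
  qed (use inj img tree in blast)+
  show "last_heaviest n d v p m" using inv n unfolding last_heaviest_def prim_inv_def by blast
qed

text \<open>Later phases rely on zero cells left from the start: the write position
  \<open>t\<close>, the failure flag \<open>f\<close>, and the arrays \<open>kind\<close> and
  \<open>next\<close> of the output.\<close>

abbreviation zero_except_prim :: "memory \<Rightarrow> bool" where
  "zero_except_prim s \<equiv> \<forall>x. x \<notin> {''n'', ''in'', ''i'', ''j'', ''b'', ''m'', ''par'', ''seq''} \<longrightarrow> s x = (\<lambda>i. 0)"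

lemma run_prim:
  assumes n: "1 < n" and d: "dissimilarity n (entry D)"
  shows "run D prim (initial_memory n) (\<lambda>t s. t \<le> 300 * n * n \<and>
    prim_tree n (entry D) (s ''seq'') (s ''par'') \<and> last_heaviest n (entry D) (s ''seq'') (s ''par'') (s ''m'' 0) \<and>
    s ''n'' 0 = n \<and> zero_except_prim s)"
proof -
  define I where "I k s \<longleftrightarrow> prim_inv n (entry D) k (s ''seq'') (s ''par'') (s ''m'' 0) \<and> s ''i'' 0 = k \<and>
    (\<forall>u. s ''in'' u = (if u \<in> s ''seq'' ` {..<k} then 1 else 0)) \<and> s ''n'' 0 = n \<and>
    zero_except_prim s" for k s
  show ?thesis
    unfolding prim_def run_Seq run_Assign aval.simps(1)
  proof (rule run_While[where I = I and a = 1 and b = n and T = "90 * n + 150"])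
    \<comment> \<open>Zero-filled memory already encodes the start: the first entry of
      \<open>seq\<close> is vertex 0, and every parent is 0, the only visited vertex.\<close>
    show "I 1 (store (store (initial_memory n) ''in'' 0 1) ''i'' 0 1)"
      using n by (auto simp: I_def prim_inv_def initial_memory_def store_def lessThan_Suc)
    show "1 \<le> n" using n by simp
  next
    fix k s assume k: "1 \<le> k" "k < n" and I: "I k s"
    then have inv: "prim_inv n (entry D) k (s ''seq'') (s ''par'') (s ''m'' 0)"
      and s: "s ''i'' 0 = k" "s ''n'' 0 = n" "\<And>u. s ''in'' u = (if u \<in> s ''seq'' ` {..<k} then 1 else 0)"
      and other: "\<And>x. x \<notin> {''n'', ''in'', ''i'', ''j'', ''b'', ''m'', ''par'', ''seq''} \<Longrightarrow> s x = (\<lambda>i. 0)"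
      by (auto simp: I_def)
    have "\<exists>u<n. u \<notin> s ''seq'' ` {..<k}"
    proof (rule ccontr)
      assume "\<not> ?thesis"
      then have "{..<n} \<subseteq> s ''seq'' ` {..<k}" by auto
      then have "n \<le> card (s ''seq'' ` {..<k})" using card_mono[of "s ''seq'' ` {..<k}" "{..<n}"] by simp
      also have "\<dots> \<le> k" using card_image_le[of "{..<k}" "s ''seq''"] by simp
      finally show False using k by simp
    qed
    then have free: "\<exists>u<n. s ''in'' u = 0" using s(3) by metis
    have mk: "s ''m'' 0 < k" using inv by (simp add: prim_inv_def)
    have "run D (find_next ;; record_next ;; update_parents ;; incr ''i'') s
      (\<lambda>t s'. t \<le> 90 * n + 150 \<and> I (Suc k) s')"
      unfolding run_Seq
    proof (rule run_mono[OF run_find_next[OF s(2) _ free]])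
      show "0 < n" using n by simp
      fix t1 :: nat and s1 :: memory
      let ?b = "s1 ''b'' 0"
      assume "t1 \<le> 50 * n + 50 \<and> same_except {''b'', ''j''} s s1 \<and>
        ?b < n \<and> s ''in'' ?b = 0 \<and>
        (\<forall>u<n. s ''in'' u = 0 \<longrightarrow> entry D (s ''par'' ?b) ?b \<le> entry D (s ''par'' u) u)"
      then have t1: "t1 \<le> 50 * n + 50" and s1: "\<And>x. x \<notin> {''b'', ''j''} \<Longrightarrow> s1 x = s x"
        and b: "?b < n" "?b \<notin> s ''seq'' ` {..<k}"
        and min: "\<And>u. u < n \<Longrightarrow> u \<notin> s ''seq'' ` {..<k} \<Longrightarrow>
          entry D (s ''par'' ?b) ?b \<le> entry D (s ''par'' u) u"
        by (auto simp: s split: if_splits)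
      show "run D record_next s1 (\<lambda>t2 s2. run D update_parents s2 (\<lambda>t3 s3. run D (incr ''i'') s3
          (\<lambda>t4 s'. t1 + (t2 + (t3 + t4)) \<le> 90 * n + 150 \<and> I (Suc k) s')))"
      proof (rule run_mono[OF run_record_next])
        fix t2 :: nat and s2 :: memory
        assume "t2 \<le> 40 \<and> same_except {''in'', ''seq'', ''m''} s1 s2 \<and>
          s2 ''in'' = (s1 ''in'')(?b := 1) \<and> s2 ''seq'' = (s1 ''seq'')(s1 ''i'' 0 := ?b) \<and>
          s2 ''m'' 0 = (if entry D (s1 ''par'' ?b) ?b <
              entry D (s1 ''par'' (((s1 ''seq'')(s1 ''i'' 0 := ?b)) (s1 ''m'' 0)))
                (((s1 ''seq'')(s1 ''i'' 0 := ?b)) (s1 ''m'' 0))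
            then s1 ''m'' 0 else s1 ''i'' 0)"
        then have t2: "t2 \<le> 40" and s2: "\<And>x. x \<notin> {''in'', ''seq'', ''m''} \<Longrightarrow> s2 x = s1 x"
          and in2: "s2 ''in'' = (s ''in'')(?b := 1)" and seq2: "s2 ''seq'' = (s ''seq'')(k := ?b)"
          and m2: "s2 ''m'' 0 = (if entry D (s ''par'' ?b) ?b <
              entry D (s ''par'' (s ''seq'' (s ''m'' 0))) (s ''seq'' (s ''m'' 0)) then s ''m'' 0 else k)"
          using mk by (auto simp: s1 s(1))
        have n2: "s2 ''n'' 0 = n" and b2: "s2 ''b'' = s1 ''b''" and par2: "s2 ''par'' = s ''par''"
          by (auto simp: s2 s1 s)
        have in2': "s2 ''in'' u = (if u \<in> s2 ''seq'' ` {..<Suc k} then 1 else 0)" for u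
          by (auto simp: in2 seq2 s lessThan_Suc)
        show "run D update_parents s2 (\<lambda>t3 s3. run D (incr ''i'') s3
            (\<lambda>t4 s'. t1 + (t2 + (t3 + t4)) \<le> 90 * n + 150 \<and> I (Suc k) s'))"
        proof (rule run_mono[OF run_update_parents[where s = s2 and n = n, OF n2]])
          fix t3 :: nat and s3 :: memory
          assume "t3 \<le> 40 * n + 40 \<and> same_except {''par'', ''j''} s2 s3 \<and>
            (\<forall>u. s3 ''par'' u = (if u < n \<and> s2 ''in'' u = 0 \<and>
              entry D (s2 ''b'' 0) u < entry D (s2 ''par'' u) u then s2 ''b'' 0 else s2 ''par'' u))"
          then have t3: "t3 \<le> 40 * n + 40" and s3: "\<And>x. x \<notin> {''par'', ''j''} \<Longrightarrow> s3 x = s2 x"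
            and par3: "\<And>u. s3 ''par'' u = (if u < n \<and> u \<notin> s3 ''seq'' ` {..<Suc k} \<and>
              entry D ?b u < entry D (s ''par'' u) u then ?b else s ''par'' u)"
            by (auto simp: in2' b2 par2)
          have "prim_inv n (entry D) (Suc k) (s3 ''seq'') (s3 ''par'') (s3 ''m'' 0)"
            by (rule prim_inv_step[OF inv k(2) d b min _ par3]) (auto simp: s3 seq2 m2)
          moreover have "s3 ''in'' u = (if u \<in> s3 ''seq'' ` {..<Suc k} then 1 else 0)" for u
            using in2' by (simp add: s3)
          moreover have "s3 x = (\<lambda>i. 0)"
            if "x \<notin> {''n'', ''in'', ''i'', ''j'', ''b'', ''m'', ''par'', ''seq''}" for x
            using that s3[of x] s2[of x] s1[of x] other[of x] by auto
          ultimately show "run D (incr ''i'') s3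
              (\<lambda>t4 s'. t1 + (t2 + (t3 + t4)) \<le> 90 * n + 150 \<and> I (Suc k) s')"
            unfolding run_Assign using t1 t2 t3
            by (auto simp: I_def store_def s3 s2 s1 s)
        qed
      qed
    qed
    then show "bval D (Less (scalar ''i'') (scalar ''n'')) s \<and>
      run D (find_next ;; record_next ;; update_parents ;; incr ''i'') s
        (\<lambda>t s'. t \<le> 90 * n + 150 \<and> I (Suc k) s')"
      using k by (simp add: s)
  next
    fix t s assume I: "I n s"
      and t: "t \<le> (n - 1) * (90 * n + 150 + 1 + bcost (Less (scalar ''i'') (scalar ''n''))) + 1 +
        bcost (Less (scalar ''i'') (scalar ''n''))"
    have "t \<le> (n - 1) * (90 * n + 160) + 10" using t by (simp add: algebra_simps)
    also have "\<dots> \<le> n * (90 * n + 160 * n) + 10" by (intro add_mono mult_mono) (use n in auto)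
    finally have "t \<le> 250 * (n * n) + 10" by (simp add: algebra_simps)
    moreover have "1 \<le> n * n" using n by simp
    ultimately have "t + 10 \<le> 300 * (n * n)" by linarith
    moreover have "prim_inv n (entry D) n (s ''seq'') (s ''par'') (s ''m'' 0)"
      using I by (simp add: I_def)
    note prim_inv_final[OF this n]
    ultimately show "1 + acost (Const 0) + acost (Const 1) + (1 + acost (Const 0) + acost (Const 1) + t)
        \<le> 300 * n * n \<and> prim_tree n (entry D) (s ''seq'') (s ''par'') \<and>
      last_heaviest n (entry D) (s ''seq'') (s ''par'') (s ''m'' 0) \<and> s ''n'' 0 = n \<and>
      zero_except_prim s"
      using I by (simp add: I_def mult.assoc)
  qed (auto simp: I_def)
qed

section \<open>Assembling the two paths\<close>

text \<open>Equality is not a primitive test, so it is expressed by two negated comparisons.\<close>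

definition place_next :: com where
  "place_next =
     Cond (BAnd (BNot (Less (Cell ''q'' (scalar ''hi'')) (Cell ''par'' (Cell ''seq'' (scalar ''i'')))))
                (BNot (Less (Cell ''par'' (Cell ''seq'' (scalar ''i''))) (Cell ''q'' (scalar ''hi'')))))
       (incr ''hi'' ;; Assign ''q'' (scalar ''hi'') (Cell ''seq'' (scalar ''i'')))
       (''lo'' ::= Minus (scalar ''lo'') (Const 1) ;;
        Assign ''q'' (scalar ''lo'') (Cell ''seq'' (scalar ''i'')))"

text \<open>The path occupies \<open>lo\<close> to \<open>hi\<close> in \<open>q\<close> and may
  grow at both ends. Starting at index n leaves room below for every possible insertion at the
  front, at most n - 1 of them.\<close>

definition build_path :: com where
  "build_path =
     ''lo'' ::= scalar ''n'' ;; ''hi'' ::= scalar ''n'' ;;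
     Assign ''q'' (scalar ''n'') (Cell ''seq'' (scalar ''i'')) ;; incr ''i'' ;;
     While (Less (scalar ''i'') (scalar ''e'')) (place_next ;; incr ''i'')"

abbreviation copy_step :: com where
  "copy_step \<equiv> Assign ''w'' (scalar ''t'') (Cell ''q'' (scalar ''j'')) ;; incr ''t'' ;; incr ''j''"

definition copy_path :: com where
  "copy_path =
     ''j'' ::= scalar ''lo'' ;;
     While (Less (scalar ''j'') (Plus (scalar ''hi'') (Const 1))) copy_step"

lemma run_place_next:
  fixes s :: memory
  defines "x \<equiv> s ''seq'' (s ''i'' 0)"
  shows "run D (place_next ;; incr ''i'') s (\<lambda>t s'. t \<le> 50 \<and>
    same_except {''lo'', ''hi'', ''q'', ''i''} s s' \<and> s' ''i'' 0 = Suc (s ''i'' 0) \<and>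
    (if s ''q'' (s ''hi'' 0) = s ''par'' x
     then s' ''hi'' 0 = Suc (s ''hi'' 0) \<and> s' ''lo'' 0 = s ''lo'' 0 \<and> s' ''q'' = (s ''q'')(Suc (s ''hi'' 0) := x)
     else s' ''hi'' 0 = s ''hi'' 0 \<and> s' ''lo'' 0 = s ''lo'' 0 - 1 \<and> s' ''q'' = (s ''q'')(s ''lo'' 0 - 1 := x)))"
  unfolding place_next_def run_simps by (simp add: store_def x_def)

lemma run_build_path:
  fixes s :: memory
  assumes s: "s ''n'' 0 = n" "s ''i'' 0 = a" "s ''e'' 0 = b" and ab: "a < b" "b \<le> n"
  defines "g \<equiv> grow (s ''seq'') (s ''par'') a"
  shows "run D build_path s (\<lambda>t s'. t \<le> 70 * n + 70 \<and>
    same_except {''lo'', ''hi'', ''q'', ''i''} s s' \<and> s' ''i'' 0 = b \<and>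
    s' ''hi'' 0 = s' ''lo'' 0 + (b - a - 1) \<and>
    (\<forall>y<b - a. s' ''q'' (s' ''lo'' 0 + y) = g (b - a - 1) ! y))"
proof -
  define I where "I k s' \<longleftrightarrow> same_except {''lo'', ''hi'', ''q'', ''i''} s s' \<and>
    s' ''i'' 0 = k \<and> n \<le> s' ''lo'' 0 + (k - a - 1) \<and> s' ''hi'' 0 = s' ''lo'' 0 + (k - a - 1) \<and>
    (\<forall>y<k - a. s' ''q'' (s' ''lo'' 0 + y) = g (k - a - 1) ! y)" for k and s' :: memory
  show ?thesis
    unfolding build_path_def run_Seq[of D "Assign _ _ _"] run_Assign
  proof (rule run_While[where I = I and a = "Suc a" and b = b and T = 50])
    fix k s' assume k: "Suc a \<le> k" "k < b" and I: "I k s'"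
    define r where "r = k - a - 1"
    have kr: "k - a = Suc r" "k = a + Suc r" "Suc k - a - 1 = Suc r" "Suc k - a = Suc (Suc r)" "r < n"
      using k ab by (auto simp: r_def)
    have fr: "\<And>x. x \<notin> {''lo'', ''hi'', ''q'', ''i''} \<Longrightarrow> s' x = s x" and ik: "s' ''i'' 0 = k"
      and lo: "n \<le> s' ''lo'' 0 + r" and hi: "s' ''hi'' 0 = s' ''lo'' 0 + r"
      and q: "\<And>y. y < Suc r \<Longrightarrow> s' ''q'' (s' ''lo'' 0 + y) = g r ! y"
      using I by (auto simp: I_def kr simp flip: r_def)
    let ?x = "s ''seq'' k"
    have len: "length (g r) = Suc r" "g r \<noteq> []" by (simp_all add: g_def)
    have last: "last (g r) = s' ''q'' (s' ''hi'' 0)"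
      using q[of r] len by (simp add: hi last_conv_nth)
    have gS: "g (Suc r) = (if last (g r) = s ''par'' ?x then g r @ [?x] else ?x # g r)"
      using kr(2) by (simp add: g_def Let_def)
    \<comment> \<open>Positivity makes the truncated subtraction in \<open>place_next\<close> an
      ordinary one.\<close>
    have lo0: "0 < s' ''lo'' 0" using lo kr(5) by linarith
    have I': "I (Suc k) s''" if f: "\<And>y. y \<notin> {''lo'', ''hi'', ''q'', ''i''} \<Longrightarrow> s'' y = s' y"
      "s'' ''i'' 0 = Suc k"
      and c: "if s' ''q'' (s' ''hi'' 0) = s ''par'' ?x
       then s'' ''hi'' 0 = Suc (s' ''hi'' 0) \<and> s'' ''lo'' 0 = s' ''lo'' 0 \<and> s'' ''q'' = (s' ''q'')(Suc (s' ''hi'' 0) := ?x)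
       else s'' ''hi'' 0 = s' ''hi'' 0 \<and> s'' ''lo'' 0 = s' ''lo'' 0 - 1 \<and> s'' ''q'' = (s' ''q'')(s' ''lo'' 0 - 1 := ?x)"
      for s'' :: memory
    proof (cases "s' ''q'' (s' ''hi'' 0) = s ''par'' ?x")
      case True
      then have c': "s'' ''hi'' 0 = Suc (s' ''hi'' 0)" "s'' ''lo'' 0 = s' ''lo'' 0"
        "s'' ''q'' = (s' ''q'')(Suc (s' ''hi'' 0) := ?x)" using c by auto
      have "s'' ''q'' (s'' ''lo'' 0 + y) = g (Suc r) ! y" if "y < Suc (Suc r)" for y
        using that q[of y] True by (cases "y = Suc r") (auto simp: c' gS last hi nth_append len)
      then show ?thesis using lo by (simp add: I_def kr f fr c' hi)
    next
      case False
      then have c': "s'' ''hi'' 0 = s' ''hi'' 0" "s'' ''lo'' 0 = s' ''lo'' 0 - 1"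
        "s'' ''q'' = (s' ''q'')(s' ''lo'' 0 - 1 := ?x)" using c by auto
      have "s'' ''q'' (s'' ''lo'' 0 + y) = g (Suc r) ! y" if "y < Suc (Suc r)" for y
      proof (cases y)
        case (Suc z)
        then have "s' ''lo'' 0 - 1 + y = s' ''lo'' 0 + z" using lo0 by simp
        then show ?thesis using Suc that q[of z] False lo0 by (auto simp: c' gS last)
      qed (use False in \<open>simp add: c' gS last\<close>)
      then show ?thesis using lo lo0 by (simp add: I_def kr f fr c' hi)
    qed
    have "run D (place_next ;; incr ''i'') s' (\<lambda>t s''. t \<le> 50 \<and> I (Suc k) s'')"
      by (rule run_mono[OF run_place_next]) (use I' fr ik in auto)
    then show "bval D (Less (scalar ''i'') (scalar ''e'')) s' \<and>
      run D (place_next ;; incr ''i'') s' (\<lambda>t s''. t \<le> 50 \<and> I (Suc k) s'')"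
      using k s by (simp add: fr ik)
  next
    fix t s' assume I: "I b s'"
      and t: "t \<le> (b - Suc a) * (50 + 1 + bcost (Less (scalar ''i'') (scalar ''e''))) + 1 +
        bcost (Less (scalar ''i'') (scalar ''e''))"
    have "t \<le> (b - Suc a) * 60 + 10" using t by simp
    also have "\<dots> \<le> n * 60 + 10" using ab by (intro add_mono mult_mono) auto
    finally have t': "t \<le> n * 60 + 10" .
    have "s' x = s x" if "x \<notin> {''lo'', ''hi'', ''q'', ''i''}" for x using I that by (simp add: I_def)
    then show "1 + acost (Const 0) + acost (scalar ''n'') + (1 + acost (Const 0) + acost (scalar ''n'') +
        (1 + acost (scalar ''n'') + acost (Cell ''seq'' (scalar ''i'')) +
          (1 + acost (Const 0) + acost (Plus (scalar ''i'') (Const 1)) + t))) \<le> 70 * n + 70 \<and>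
      same_except {''lo'', ''hi'', ''q'', ''i''} s s' \<and> s' ''i'' 0 = b \<and>
      s' ''hi'' 0 = s' ''lo'' 0 + (b - a - 1) \<and>
      (\<forall>y<b - a. s' ''q'' (s' ''lo'' 0 + y) = g (b - a - 1) ! y)"
      using I t' by (simp add: I_def)
  qed (use s ab in \<open>auto simp: I_def store_def g_def\<close>)
qed

lemma run_copy_path:
  fixes s :: memory
  assumes hi: "s ''hi'' 0 = s ''lo'' 0 + r"
  shows "run D copy_path s (\<lambda>t s'. t \<le> 40 * r + 80 \<and>
    same_except {''j'', ''t'', ''w''} s s' \<and> s' ''t'' 0 = s ''t'' 0 + Suc r \<and>
    (\<forall>k. s' ''w'' k = (if s ''t'' 0 \<le> k \<and> k < s ''t'' 0 + Suc r
      then s ''q'' (s ''lo'' 0 + (k - s ''t'' 0)) else s ''w'' k)))"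
proof -
  define I where "I k s' \<longleftrightarrow> same_except {''j'', ''t'', ''w''} s s' \<and>
    s' ''j'' 0 = k \<and> s' ''t'' 0 = s ''t'' 0 + (k - s ''lo'' 0) \<and>
    (\<forall>y. s' ''w'' y = (if s ''t'' 0 \<le> y \<and> y < s ''t'' 0 + (k - s ''lo'' 0)
      then s ''q'' (s ''lo'' 0 + (y - s ''t'' 0)) else s ''w'' y))" for k and s' :: memory
  let ?b = "Suc (s ''hi'' 0)"
  show ?thesis
    unfolding copy_path_def run_Seq[of D "Assign _ _ _"] run_Assign
  proof (rule run_While[where I = I and a = "s ''lo'' 0" and b = ?b and T = 30])
    fix k s' assume k: "s ''lo'' 0 \<le> k" "k < ?b" and I: "I k s'"
    have fr: "\<And>x. x \<notin> {''j'', ''t'', ''w''} \<Longrightarrow> s' x = s x" and j: "s' ''j'' 0 = k"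
      and t: "s' ''t'' 0 = s ''t'' 0 + (k - s ''lo'' 0)"
      and w: "\<And>y. s' ''w'' y = (if s ''t'' 0 \<le> y \<and> y < s ''t'' 0 + (k - s ''lo'' 0)
      then s ''q'' (s ''lo'' 0 + (y - s ''t'' 0)) else s ''w'' y)"
      using I by (auto simp: I_def)
    have "run D copy_step s' (\<lambda>t s''. t \<le> 30 \<and> same_except {''j'', ''t'', ''w''} s' s'' \<and> s'' ''j'' 0 = Suc k \<and>
        s'' ''t'' 0 = Suc (s' ''t'' 0) \<and> s'' ''w'' = (s' ''w'')(s' ''t'' 0 := s ''q'' k))"
      unfolding run_simps by (simp add: store_def fr j)
    moreover have "I (Suc k) s''" if f: "\<And>x. x \<notin> {''j'', ''t'', ''w''} \<Longrightarrow> s'' x = s' x" "s'' ''j'' 0 = Suc k"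
        "s'' ''t'' 0 = Suc (s' ''t'' 0)" "s'' ''w'' = (s' ''w'')(s' ''t'' 0 := s ''q'' k)" for s'' :: memory
      unfolding I_def
    proof (intro conjI allI impI)
      fix y
      have "k = s ''lo'' 0 + (k - s ''lo'' 0)" using k by simp
      then show "s'' ''w'' y = (if s ''t'' 0 \<le> y \<and> y < s ''t'' 0 + (Suc k - s ''lo'' 0)
        then s ''q'' (s ''lo'' 0 + (y - s ''t'' 0)) else s ''w'' y)"
        using k by (auto simp: f(4) t w Suc_diff_le)
    qed (use f fr t k in \<open>auto simp: Suc_diff_le\<close>)
    ultimately show "bval D (Less (scalar ''j'') (Plus (scalar ''hi'') (Const 1))) s' \<and>
      run D copy_step s' (\<lambda>t s''. t \<le> 30 \<and> I (Suc k) s'')"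
      using k by (auto simp: fr j elim!: run_mono)
  next
    fix t s' assume I: "I ?b s'"
      and t: "t \<le> (?b - s ''lo'' 0) * (30 + 1 + bcost (Less (scalar ''j'') (Plus (scalar ''hi'') (Const 1)))) + 1 +
        bcost (Less (scalar ''j'') (Plus (scalar ''hi'') (Const 1)))"
    have br: "?b - s ''lo'' 0 = Suc r" using hi by simp
    have "t \<le> 40 * r + 60" using t unfolding br by simp
    then show "1 + acost (Const 0) + acost (scalar ''lo'') + t \<le> 40 * r + 80 \<and>
    same_except {''j'', ''t'', ''w''} s s' \<and> s' ''t'' 0 = s ''t'' 0 + Suc r \<and>
    (\<forall>k. s' ''w'' k = (if s ''t'' 0 \<le> k \<and> k < s ''t'' 0 + Suc r
      then s ''q'' (s ''lo'' 0 + (k - s ''t'' 0)) else s ''w'' k))"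
      using I unfolding I_def br by simp
  qed (use hi in \<open>auto simp: I_def store_def\<close>)
qed

section \<open>The endpoint tests\<close>

text \<open>The negation of "minimum less than", spelled out as two failed entry comparisons. Note
  that \<open>a\<close>, \<open>z\<close>, \<open>j\<close> hold positions in \<open>w\<close>,
  whereas \<open>c\<close> and \<open>d\<close> hold elements.\<close>

abbreviation fails_first :: bexp where
  "fails_first \<equiv> BAnd (Less (scalar ''j'') (scalar ''z''))
          (BAnd (BNot (EntryLess (Cell ''w'' (scalar ''j'')) (Cell ''w'' (scalar ''z''))
                                 (Cell ''w'' (scalar ''j'')) (scalar ''c'')))
                (BNot (EntryLess (Cell ''w'' (scalar ''j'')) (scalar ''d'')
                                 (Cell ''w'' (scalar ''j'')) (scalar ''c''))))"

abbreviation fails_second :: bexp where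
  "fails_second \<equiv> BAnd (Less (scalar ''a'') (scalar ''j''))
          (BAnd (BNot (EntryLess (Cell ''w'' (scalar ''j'')) (scalar ''c'')
                                 (Cell ''w'' (scalar ''j'')) (scalar ''d'')))
                (BNot (EntryLess (Cell ''w'' (scalar ''j'')) (Cell ''w'' (scalar ''a''))
                                 (Cell ''w'' (scalar ''j'')) (scalar ''d''))))"

definition check_loop :: com where
  "check_loop = ''j'' ::= scalar ''a'' ;;
     While (Less (scalar ''j'') (Plus (scalar ''z'') (Const 1)))
       (Cond fails_first
          (''f'' ::= Const 1) Skip ;;
        Cond fails_second
          (''f'' ::= Const 1) Skip ;;
        incr ''j'')"

text \<open>The flag \<open>f\<close> is never cleared here, so consecutive checks accumulate: it
  stays 0 exactly if it was 0 and nothing failed.\<close>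

definition check :: "aexp \<Rightarrow> aexp \<Rightarrow> aexp \<Rightarrow> aexp \<Rightarrow> com" where
  "check A Z C E = ''a'' ::= A ;; ''z'' ::= Z ;; ''c'' ::= C ;; ''d'' ::= E ;; check_loop"

lemma run_check_loop:
  fixes D :: "real mat" and s :: memory
  assumes s: "s ''a'' 0 = a" "s ''z'' 0 = z" "s ''c'' 0 = s ''w'' c" "s ''d'' 0 = s ''w'' e"
    and az: "a \<le> z" "z < n"
  defines "E \<equiv> (\<lambda>i j. entry D (s ''w'' i) (s ''w'' j))"
  shows "run D check_loop s (\<lambda>t s'. t \<le> 100 * n + 100 \<and>
    same_except {''j'', ''f''} s s' \<and>
    (s' ''f'' 0 = 0 \<longleftrightarrow> s ''f'' 0 = 0 \<and> endpoint_test E a z c e))"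
proof -
  define good1 where "good1 y \<longleftrightarrow> (y < z \<longrightarrow> min (E y z) (E y e) < E y c)" for y
  define good2 where "good2 y \<longleftrightarrow> (a < y \<longrightarrow> min (E y c) (E y a) < E y e)" for y
  define I where "I k s' \<longleftrightarrow> same_except {''j'', ''f''} s s' \<and> s' ''j'' 0 = k \<and>
    (s' ''f'' 0 = 0 \<longleftrightarrow> s ''f'' 0 = 0 \<and> (\<forall>y. a \<le> y \<and> y < k \<longrightarrow> good1 y \<and> good2 y))" for k and s' :: memory
  let ?body = "Cond fails_first (''f'' ::= Const 1) Skip ;; Cond fails_second (''f'' ::= Const 1) Skip ;; incr ''j''"
  show ?thesis
    unfolding check_loop_def run_Seq[of D "Assign _ _ _"] run_Assign
  proof (rule run_While[where I = I and a = a and b = "Suc z" and T = 80])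
    fix k s' assume k: "a \<le> k" "k < Suc z" and I: "I k s'"
    have fr: "\<And>x. x \<notin> {''j'', ''f''} \<Longrightarrow> s' x = s x" and j: "s' ''j'' 0 = k"
      and f: "s' ''f'' 0 = 0 \<longleftrightarrow> s ''f'' 0 = 0 \<and> (\<forall>y. a \<le> y \<and> y < k \<longrightarrow> good1 y \<and> good2 y)"
      using I by (auto simp: I_def)
    have b1: "bval D fails_first s'' \<longleftrightarrow> \<not> good1 k" and b2: "bval D fails_second s'' \<longleftrightarrow> \<not> good2 k"
      if "same_except {''j'', ''f''} s s''" "s'' ''j'' 0 = k" for s''
      using that by (simp_all add: s good1_def good2_def E_def min_less_iff_disj)
    have fj: "same_except {''j'', ''f''} s s'" "s' ''j'' 0 = k"
      "same_except {''j'', ''f''} s (store s' ''f'' 0 1)" "store s' ''f'' 0 1 ''j'' 0 = k"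
      using fr j by (auto simp: store_def)
    have c: "aval (Const i) s'' = i" for i s'' by simp
    have "run D ?body s' (\<lambda>t s''. t \<le> 80 \<and> same_except {''j'', ''f''} s' s'' \<and>
        s'' ''j'' 0 = Suc k \<and> s'' ''f'' 0 = (if good1 k \<and> good2 k then s' ''f'' 0 else 1))"
      unfolding run_Seq run_Cond run_Assign run_Skip c b1[OF fj(1,2)] b2[OF fj(1,2)] b2[OF fj(3,4)]
      by (simp add: store_def fr j)
    moreover have "I (Suc k) s''" if "\<And>x. x \<notin> {''j'', ''f''} \<Longrightarrow> s'' x = s' x" "s'' ''j'' 0 = Suc k"
        "s'' ''f'' 0 = (if good1 k \<and> good2 k then s' ''f'' 0 else 1)" for s'' :: memory
    proof -
      have "(\<forall>y. a \<le> y \<and> y < Suc k \<longrightarrow> good1 y \<and> good2 y) \<longleftrightarrow>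
          (\<forall>y. a \<le> y \<and> y < k \<longrightarrow> good1 y \<and> good2 y) \<and> good1 k \<and> good2 k"
        using k(1) by (auto simp: less_Suc_eq)
      then show ?thesis using that fr f by (simp add: I_def)
    qed
    ultimately show "bval D (Less (scalar ''j'') (Plus (scalar ''z'') (Const 1))) s' \<and>
      run D ?body s' (\<lambda>t s''. t \<le> 80 \<and> I (Suc k) s'')"
      using k s by (auto simp: fr j elim!: run_mono)
  next
    fix t s' assume I: "I (Suc z) s'"
      and t: "t \<le> (Suc z - a) * (80 + 1 + bcost (Less (scalar ''j'') (Plus (scalar ''z'') (Const 1)))) + 1 +
        bcost (Less (scalar ''j'') (Plus (scalar ''z'') (Const 1)))"
    have "t \<le> (Suc z - a) * 90 + 20" using t by simp
    also have "\<dots> \<le> n * 90 + 20" using az by (intro add_mono mult_mono) auto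
    finally have t': "t \<le> n * 90 + 20" .
    have "endpoint_test E a z c e \<longleftrightarrow> (\<forall>y. a \<le> y \<and> y < Suc z \<longrightarrow> good1 y \<and> good2 y)"
      unfolding endpoint_test_def good1_def good2_def less_Suc_eq_le ..
    then show "1 + acost (Const 0) + acost (scalar ''a'') + t \<le> 100 * n + 100 \<and>
      same_except {''j'', ''f''} s s' \<and>
      (s' ''f'' 0 = 0 \<longleftrightarrow> s ''f'' 0 = 0 \<and> endpoint_test E a z c e)"
      using I t' by (simp add: I_def)
  qed (use s az in \<open>auto simp: I_def store_def\<close>)
qed

text \<open>The four scalars are assigned one after another; \<open>ev\<close> therefore asks that
  the argument expressions keep their values when these scalars change.\<close>

lemma run_check:
  fixes s :: memory
  assumes ev: "\<And>s'. (\<And>x. x \<notin> {''a'', ''z'', ''c'', ''d''} \<Longrightarrow> s' x = s x) \<Longrightarrow>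
      aval A s' = a \<and> aval Z s' = z \<and> aval C s' = s ''w'' c \<and> aval E s' = s ''w'' e"
    and az: "a \<le> z" "z < n" and cost: "acost A + acost Z + acost C + acost E \<le> 40"
  shows "run D (check A Z C E) s (\<lambda>t s'. t \<le> 100 * n + 150 \<and>
    same_except {''a'', ''z'', ''c'', ''d'', ''j'', ''f''} s s' \<and>
    (s' ''f'' 0 = 0 \<longleftrightarrow> s ''f'' 0 = 0 \<and>
      endpoint_test (\<lambda>i j. entry D (s ''w'' i) (s ''w'' j)) a z c e))"
proof -
  have st: "aval A s = a" "aval Z (store s ''a'' 0 a) = z"
    "aval C (store (store s ''a'' 0 a) ''z'' 0 z) = s ''w'' c"
    "aval E (store (store (store s ''a'' 0 a) ''z'' 0 z) ''c'' 0 (s ''w'' c)) = s ''w'' e"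
    by (rule ev[THEN conjunct1] ev[THEN conjunct2, THEN conjunct1]
        ev[THEN conjunct2, THEN conjunct2, THEN conjunct1]
        ev[THEN conjunct2, THEN conjunct2, THEN conjunct2]; simp add: store_def)+
  have z0: "aval (Const 0) s' = 0" for s' by simp
  show ?thesis
    unfolding check_def run_Seq[of D "Assign _ _ _"] run_Assign z0 st
    by (rule run_mono[OF run_check_loop[where a = a and z = z and c = c and e = e and n = n]])
      (use az cost in \<open>auto simp: store_def\<close>)
qed

section \<open>Writing the tree\<close>

text \<open>Since address 0 ends a list, the leaf labelled \<open>x\<close> gets address \<open>Suc x\<close>; the root has address
  \<open>n + 1\<close>, and the nodes of the two paths, if present, \<open>n + 2\<close> and \<open>n + 3\<close>.\<close>

fun chain :: "memory \<Rightarrow> nat \<Rightarrow> nat list \<Rightarrow> nat \<Rightarrow> bool" where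
  "chain s h [] e \<longleftrightarrow> h = e"
| "chain s h (x # xs) e \<longleftrightarrow> h = Suc x \<and> s ''label'' (Suc x) = x \<and> chain s (s ''next'' (Suc x)) xs e"

lemma chain_cong:
  assumes "\<And>x. x \<in> set xs \<Longrightarrow> s' ''label'' (Suc x) = s ''label'' (Suc x) \<and> s' ''next'' (Suc x) = s ''next'' (Suc x)"
  shows "chain s' h xs e \<longleftrightarrow> chain s h xs e"
  using assms by (induction xs arbitrary: h) auto

lemma chain_forest:
  assumes "chain s h xs 0" "\<And>x. x \<in> set xs \<Longrightarrow> s ''kind'' (Suc x) = 0"
  shows "forest_at s h (map Leaf xs)"
  using assms
proof (induction xs arbitrary: h)
  case Nil
  then show ?case by (simp add: tree_at_forest_at.Nil)
next
  case (Cons x xs)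
  then have "tree_at s h (Leaf (s ''label'' h))" by (intro tree_at_forest_at.Leaf) auto
  then show ?case using Cons by (auto intro!: tree_at_forest_at.Cons)
qed

definition link_body :: "aexp \<Rightarrow> com" where
  "link_body p = ''x'' ::= Cell ''w'' p ;;
     Assign ''label'' (Plus (scalar ''x'') (Const 1)) (scalar ''x'') ;;
     Assign ''next'' (Plus (scalar ''x'') (Const 1)) (scalar ''h'') ;;
     ''h'' ::= Plus (scalar ''x'') (Const 1) ;; incr ''j''"

text \<open>Each leaf is pushed to the front, which reverses the traversal: a descending scan yields
  the path itself and an ascending one its reverse. Since \<open>h\<close> is not reset, the new
  leaves are placed in front of whatever list it already points to.\<close>

definition link :: "aexp \<Rightarrow> aexp \<Rightarrow> aexp \<Rightarrow> com" where
  "link A Z p = ''a'' ::= A ;; ''z'' ::= Z ;; ''j'' ::= scalar ''a'' ;;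
     While (Less (scalar ''j'') (Plus (scalar ''z'') (Const 1))) (link_body p)"

definition ascending :: aexp where "ascending = scalar ''j''"
definition descending :: aexp where
  "descending = Minus (Plus (scalar ''a'') (scalar ''z'')) (scalar ''j'')"

lemma run_link:
  fixes s :: memory
  assumes A: "aval A s = a" and Z: "aval Z (store s ''a'' 0 a) = z" and az: "a \<le> z" "z < n"
    and p: "\<And>s'. s' ''a'' 0 = a \<Longrightarrow> s' ''z'' 0 = z \<Longrightarrow> aval p s' = f (s' ''j'' 0)"
    and cost: "acost A + acost Z \<le> 20" "acost p \<le> 10"
    and xs: "xs = map (\<lambda>j. s ''w'' (f j)) [a..<Suc z]" "distinct xs"
  shows "run D (link A Z p) s (\<lambda>t s'. t \<le> 60 * n + 100 \<and>
    same_except {''a'', ''z'', ''j'', ''x'', ''label'', ''next'', ''h''} s s' \<and>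
    chain s' (s' ''h'' 0) (rev xs) (s ''h'' 0) \<and>
    (\<forall>y. y \<notin> Suc ` set xs \<longrightarrow> s' ''next'' y = s ''next'' y \<and> s' ''label'' y = s ''label'' y))"
proof -
  define ys where "ys k = map (\<lambda>j. s ''w'' (f j)) [a..<k]" for k
  define I where "I k s' \<longleftrightarrow>
    same_except {''a'', ''z'', ''j'', ''x'', ''label'', ''next'', ''h''} s s' \<and>
    s' ''a'' 0 = a \<and> s' ''z'' 0 = z \<and> s' ''j'' 0 = k \<and>
    chain s' (s' ''h'' 0) (rev (ys k)) (s ''h'' 0) \<and>
    (\<forall>y. y \<notin> Suc ` set (ys k) \<longrightarrow> s' ''next'' y = s ''next'' y \<and> s' ''label'' y = s ''label'' y)"
    for k and s' :: memory
  have xs': "xs = ys (Suc z)" by (simp add: xs ys_def)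
  have z0: "aval (Const 0) s' = 0" for s' by simp
  show ?thesis
    unfolding link_def run_Seq[of D "Assign _ _ _"] run_Assign z0 A Z
  proof (rule run_While[where I = I and a = a and b = "Suc z" and T = 50])
    fix k s' assume k: "a \<le> k" "k < Suc z" and I: "I k s'"
    have fr: "\<And>x. x \<notin> {''a'', ''z'', ''j'', ''x'', ''label'', ''next'', ''h''} \<Longrightarrow> s' x = s x"
      and sc: "s' ''a'' 0 = a" "s' ''z'' 0 = z" "s' ''j'' 0 = k"
      and ch: "chain s' (s' ''h'' 0) (rev (ys k)) (s ''h'' 0)"
      and out: "\<And>y. y \<notin> Suc ` set (ys k) \<Longrightarrow> s' ''next'' y = s ''next'' y \<and> s' ''label'' y = s ''label'' y"
      using I unfolding I_def by blast+
    let ?x = "s ''w'' (f k)"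
    have yS: "ys (Suc k) = ys k @ [?x]" using k by (simp add: ys_def)
    have "[a..<Suc z] = [a..<Suc k] @ [Suc k..<Suc z]"
      using k upt_add_eq_append[of a "Suc k" "z - k"] by simp
    then have "distinct (ys (Suc k))" using xs(2) unfolding xs' ys_def by (simp del: upt_Suc)
    then have new: "?x \<notin> set (ys k)" by (simp add: yS)
    have pv: "aval p s' = f k" using p[of s'] sc by simp
    have w: "s' ''w'' = s ''w''" using fr by simp
    have body: "run D (link_body p) s' (\<lambda>t s''. t \<le> 50 \<and>
      same_except {''j'', ''x'', ''label'', ''next'', ''h''} s' s'' \<and> s'' ''j'' 0 = Suc k \<and>
      s'' ''h'' 0 = Suc ?x \<and> s'' ''label'' = (s' ''label'')(Suc ?x := ?x) \<and>
      s'' ''next'' = (s' ''next'')(Suc ?x := s' ''h'' 0))"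
      unfolding link_body_def run_simps using cost by (simp add: store_def pv w sc)
    have step: "I (Suc k) s''"
      if f: "same_except {''j'', ''x'', ''label'', ''next'', ''h''} s' s''"
      and j: "s'' ''j'' 0 = Suc k" and h: "s'' ''h'' 0 = Suc ?x"
      and l: "s'' ''label'' = (s' ''label'')(Suc ?x := ?x)"
      and nx: "s'' ''next'' = (s' ''next'')(Suc ?x := s' ''h'' 0)" for s'' :: memory
    proof -
      have "chain s'' (s' ''h'' 0) (rev (ys k)) (s ''h'' 0)"
        using ch by (subst chain_cong[where s = s']) (use new in \<open>auto simp: l nx\<close>)
      then have "chain s'' (s'' ''h'' 0) (rev (ys (Suc k))) (s ''h'' 0)"
        by (simp add: yS h l nx)
      moreover have "s'' ''next'' y = s ''next'' y \<and> s'' ''label'' y = s ''label'' y"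
        if "y \<notin> Suc ` set (ys (Suc k))" for y
        using that out[of y] by (simp add: yS l nx)
      moreover have "s'' x = s x" if "x \<notin> {''a'', ''z'', ''j'', ''x'', ''label'', ''next'', ''h''}" for x
        using f fr that by simp
      ultimately show ?thesis using f sc j unfolding I_def by simp
    qed
    have "run D (link_body p) s' (\<lambda>t s''. t \<le> 50 \<and> I (Suc k) s'')"
      by (rule run_mono[OF body]) (use step in blast)
    then show "bval D (Less (scalar ''j'') (Plus (scalar ''z'') (Const 1))) s' \<and>
      run D (link_body p) s' (\<lambda>t s''. t \<le> 50 \<and> I (Suc k) s'')"
      using k sc by simp
  next
    fix t s' assume I: "I (Suc z) s'"
      and t: "t \<le> (Suc z - a) * (50 + 1 + bcost (Less (scalar ''j'') (Plus (scalar ''z'') (Const 1)))) + 1 +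
        bcost (Less (scalar ''j'') (Plus (scalar ''z'') (Const 1)))"
    have "t \<le> (Suc z - a) * 60 + 20" using t by simp
    also have "\<dots> \<le> n * 60 + 20" using az by (intro add_mono mult_mono) auto
    finally have t': "t \<le> n * 60 + 20" .
    have "1 + acost (Const 0) + acost A + (1 + acost (Const 0) + acost Z +
      (1 + acost (Const 0) + acost (scalar ''a'') + t)) \<le> 60 * n + 100"
      using t' cost by simp
    then show "1 + acost (Const 0) + acost A + (1 + acost (Const 0) + acost Z +
      (1 + acost (Const 0) + acost (scalar ''a'') + t)) \<le> 60 * n + 100 \<and>
    same_except {''a'', ''z'', ''j'', ''x'', ''label'', ''next'', ''h''} s s' \<and>
    chain s' (s' ''h'' 0) (rev xs) (s ''h'' 0) \<and>
    (\<forall>y. y \<notin> Suc ` set xs \<longrightarrow> s' ''next'' y = s ''next'' y \<and> s' ''label'' y = s ''label'' y)"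
      using I unfolding I_def xs' by blast
  qed (use az in \<open>auto simp: I_def store_def ys_def\<close>)
qed

lemma rev_map_descending:
  "rev (map (\<lambda>j. g (a + z - j)) [a..<Suc z]) = map g [a..<Suc z]" for g :: "nat \<Rightarrow> 'a"
  by (rule nth_equalityI) (auto simp: rev_nth simp del: upt_Suc)

lemma run_link_descending:
  fixes s :: memory
  assumes "aval A s = a" "aval Z (store s ''a'' 0 a) = z" "a \<le> z" "z < n" "acost A + acost Z \<le> 20"
    and inj: "inj_on (s ''w'') {..<n}"
  defines "xs \<equiv> map (s ''w'') [a..<Suc z]"
  shows "run D (link A Z descending) s (\<lambda>t s'. t \<le> 60 * n + 100 \<and>
    same_except {''a'', ''z'', ''j'', ''x'', ''label'', ''next'', ''h''} s s' \<and>
    chain s' (s' ''h'' 0) xs (s ''h'' 0) \<and>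
    (\<forall>y. y \<notin> Suc ` set xs \<longrightarrow> s' ''next'' y = s ''next'' y \<and> s' ''label'' y = s ''label'' y))"
proof -
  let ?ys = "map (\<lambda>j. s ''w'' (a + z - j)) [a..<Suc z]"
  have r: "rev ?ys = xs" unfolding xs_def by (rule rev_map_descending)
  have "distinct xs"
    unfolding xs_def distinct_map using assms(4) by (auto intro: inj_on_subset[OF inj])
  then have d: "distinct ?ys" using r by (metis distinct_rev)
  have "set ?ys = set xs" using r by (metis set_rev)
  then show ?thesis
    using run_link[OF assms(1-4) _ assms(5) _ refl d, of descending D]
    by (simp only: r) (simp add: descending_def)
qed

lemma run_link_ascending:
  fixes s :: memory
  assumes "aval A s = a" "aval Z (store s ''a'' 0 a) = z" "a \<le> z" "z < n" "acost A + acost Z \<le> 20"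
    and inj: "inj_on (s ''w'') {..<n}"
  defines "xs \<equiv> map (s ''w'') [a..<Suc z]"
  shows "run D (link A Z ascending) s (\<lambda>t s'. t \<le> 60 * n + 100 \<and>
    same_except {''a'', ''z'', ''j'', ''x'', ''label'', ''next'', ''h''} s s' \<and>
    chain s' (s' ''h'' 0) (rev xs) (s ''h'' 0) \<and>
    (\<forall>y. y \<notin> Suc ` set xs \<longrightarrow> s' ''next'' y = s ''next'' y \<and> s' ''label'' y = s ''label'' y))"
proof -
  have "distinct xs"
    unfolding xs_def distinct_map using assms(4) by (auto intro: inj_on_subset[OF inj])
  then show ?thesis
    using run_link[OF assms(1-4), of ascending "\<lambda>j. j" xs D] assms(5)
    by (simp add: ascending_def xs_def)
qed

abbreviation two_level :: bexp where
  "two_level \<equiv> BAnd (Less (scalar ''g'') (Const 1)) (Less (scalar ''f'') (Const 1))"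

definition write_last :: com where
  "write_last = ''h'' ::= Const 0 ;;
     Cond (Less (scalar ''g'') (Const 1))
       (link (scalar ''m'') (Minus (scalar ''n'') (Const 1)) descending)
       (link (scalar ''m'') (Minus (scalar ''n'') (Const 1)) ascending)"

text \<open>In the two-level case clearing \<open>h\<close> makes the first path a separate list;
  otherwise it is pushed in front of the other path, giving one flat list. The \<open>next\<close>
  cell of node n + 3 is still 0 and so ends the list of the two path nodes.\<close>

definition close_last :: com where
  "close_last = Cond two_level
     (Assign ''child'' (Plus (scalar ''n'') (Const 3)) (scalar ''h'') ;;
      Assign ''kind'' (Plus (scalar ''n'') (Const 3)) (Const 2) ;;
      Assign ''kind'' (Plus (scalar ''n'') (Const 2)) (Const 2) ;;
      Assign ''next'' (Plus (scalar ''n'') (Const 2)) (Plus (scalar ''n'') (Const 3)) ;;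
      ''h'' ::= Const 0) Skip"

definition write_first :: com where
  "write_first = link (Const 0) (Minus (scalar ''m'') (Const 1)) descending"

definition write_root :: com where
  "write_root = Cond two_level
     (Assign ''child'' (Plus (scalar ''n'') (Const 2)) (scalar ''h'') ;;
      ''h'' ::= Plus (scalar ''n'') (Const 2)) Skip ;;
     ''root'' ::= Plus (scalar ''n'') (Const 1) ;;
     Assign ''kind'' (Plus (scalar ''n'') (Const 1)) (Const 2) ;;
     Assign ''child'' (Plus (scalar ''n'') (Const 1)) (scalar ''h'')"

definition write_tree :: com where
  "write_tree = write_last ;; close_last ;; write_first ;; write_root"

lemma run_write_last:
  fixes s :: memory
  assumes s: "s ''n'' 0 = n" "s ''m'' 0 = m" and m: "0 < m" "m < n" and inj: "inj_on (s ''w'') {..<n}"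
  defines "K' \<equiv> map (s ''w'') [m..<n]"
  shows "run D write_last s (\<lambda>t s'. t \<le> 60 * n + 120 \<and>
    same_except {''a'', ''z'', ''j'', ''x'', ''label'', ''next'', ''h''} s s' \<and>
    chain s' (s' ''h'' 0) (if s ''g'' 0 = 0 then K' else rev K') 0 \<and>
    (\<forall>y. y \<notin> Suc ` set K' \<longrightarrow> s' ''next'' y = s ''next'' y \<and> s' ''label'' y = s ''label'' y))"
proof -
  let ?s = "store s ''h'' 0 0"
  have u: "[m..<Suc (n - 1)] = [m..<n]" using m by simp
  have z0: "aval (Const 0) s' = 0" for s' by simp
  note d = run_link_descending[where s = ?s and A = "scalar ''m''" and a = m and n = n and D = D
      and Z = "Minus (scalar ''n'') (Const 1)" and z = "n - 1"]
  note a = run_link_ascending[where s = ?s and A = "scalar ''m''" and a = m and n = n and D = D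
      and Z = "Minus (scalar ''n'') (Const 1)" and z = "n - 1"]
  have w: "?s ''w'' = s ''w''" "?s ''h'' 0 = 0" "?s ''next'' = s ''next''" "?s ''label'' = s ''label''"
    by (simp_all add: store_def)
  have g: "bval D (Less (scalar ''g'') (Const 1)) ?s \<longleftrightarrow> s ''g'' 0 = 0" by (simp add: store_def)
  show ?thesis
  proof (cases "s ''g'' 0 = 0")
    case True
    show ?thesis
      unfolding write_last_def run_Seq run_Assign run_Cond z0 g if_P[OF True]
      by (rule run_mono[OF d, unfolded w u])
        (use s m inj in \<open>auto simp: store_def K'_def\<close>)
  next
    case False
    show ?thesis
      unfolding write_last_def run_Seq run_Assign run_Cond z0 g if_not_P[OF False]
      by (rule run_mono[OF a, unfolded w u])
        (use s m inj in \<open>auto simp: store_def K'_def\<close>)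
  qed
qed

lemma run_write_tree:
  fixes s :: memory
  assumes s: "s ''n'' 0 = n" "s ''m'' 0 = m" and m: "0 < m" "m < n"
    and inj: "inj_on (s ''w'') {..<n}" and lt: "\<And>i. i < n \<Longrightarrow> s ''w'' i < n"
    and k0: "\<And>y. s ''kind'' y = 0" and n0: "\<And>y. s ''next'' y = 0"
  defines "K \<equiv> map (s ''w'') [0..<m]" and "K' \<equiv> map (s ''w'') [m..<n]"
  shows "run D write_tree s (\<lambda>t s'. t \<le> 120 * n + 400 \<and>
    outputs s' (if s ''g'' 0 = 0 then
        if s ''f'' 0 = 0 then QNode [QNode (map Leaf K), QNode (map Leaf K')]
        else QNode (map Leaf (K @ K'))
      else QNode (map Leaf (K @ rev K'))))"
proof -
  have Klt: "x < n" if "x \<in> set K" for x using that lt m by (auto simp: K_def)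
  have K'lt: "x < n" if "x \<in> set K'" for x using that lt by (auto simp: K'_def)
  have disj: "x \<notin> set K" if x: "x \<in> set K'" for x
  proof
    assume "x \<in> set K"
    then obtain i j where "i < m" "m \<le> j" "j < n" "s ''w'' i = s ''w'' j"
      using x by (auto simp: K_def K'_def)
    then show False using inj_onD[OF inj, of i j] m by simp
  qed
  have chain_append: "chain s' h (xs @ ys) e \<longleftrightarrow> (\<exists>h'. chain s' h xs h' \<and> chain s' h' ys e)" for s' h xs ys e
    by (induction xs arbitrary: h) auto
  let ?two = "s ''g'' 0 = 0 \<and> s ''f'' 0 = 0"
  let ?T = "if s ''g'' 0 = 0 then if s ''f'' 0 = 0 then QNode [QNode (map Leaf K), QNode (map Leaf K')]
    else QNode (map Leaf (K @ K'))
    else QNode (map Leaf (K @ rev K'))"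
  let ?X = "if s ''g'' 0 = 0 then K' else rev K'"
  show ?thesis
    unfolding write_tree_def run_Seq[of D write_last]
  proof (rule run_mono[OF run_write_last[OF s m inj]])
    fix t1 :: nat and s1 :: memory
    assume "t1 \<le> 60 * n + 120 \<and>
      same_except {''a'', ''z'', ''j'', ''x'', ''label'', ''next'', ''h''} s s1 \<and>
      chain s1 (s1 ''h'' 0) (if s ''g'' 0 = 0 then map (s ''w'') [m..<n] else rev (map (s ''w'') [m..<n])) 0 \<and>
      (\<forall>y. y \<notin> Suc ` set (map (s ''w'') [m..<n]) \<longrightarrow> s1 ''next'' y = s ''next'' y \<and> s1 ''label'' y = s ''label'' y)"
    then have t1: "t1 \<le> 60 * n + 120"
      and f1: "\<And>x. x \<notin> {''a'', ''z'', ''j'', ''x'', ''label'', ''next'', ''h''} \<Longrightarrow> s1 x = s x"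
      and c1: "chain s1 (s1 ''h'' 0) ?X 0"
      and n1: "\<And>y. y \<notin> Suc ` set K' \<Longrightarrow> s1 ''next'' y = 0"
      unfolding K'_def[symmetric] n0 by auto
    have v1: "s1 ''n'' 0 = n" "s1 ''m'' 0 = m" "s1 ''g'' = s ''g''" "s1 ''f'' = s ''f''" "s1 ''w'' = s ''w''"
      "s1 ''kind'' y = 0" for y
      using f1 s k0 by auto
    \<comment> \<open>Leaf addresses are at most n, so linking the leaves leaves the cells of the
      inner nodes alone.\<close>
    have big: "y \<notin> Suc ` set K" "y \<notin> Suc ` set K'" if "n < y" for y
      using Klt K'lt that by fastforce+
    have "run D close_last s1 (\<lambda>t2 s2. t2 \<le> 60 \<and>
      same_except {''child'', ''kind'', ''next'', ''h''} s1 s2 \<and>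
      (if ?two then s2 ''child'' (n + 3) = s1 ''h'' 0 \<and> s2 ''h'' 0 = 0 \<and>
          s2 ''kind'' = (\<lambda>y. if y = n + 2 \<or> y = n + 3 then 2 else 0) \<and>
          s2 ''next'' = (s1 ''next'')(n + 2 := n + 3)
       else s2 = s1))"
      unfolding close_last_def run_simps using v1
      by (auto simp: store_def fun_eq_iff)
    then show "run D (close_last ;; write_first ;; write_root) s1 (\<lambda>t s'. t1 + t \<le> 120 * n + 400 \<and>
      outputs s' ?T)"
      unfolding run_Seq[of D close_last] run_Seq[of D write_first]
    proof (rule run_mono)
      fix t2 :: nat and s2 :: memory
      assume "t2 \<le> 60 \<and>
        same_except {''child'', ''kind'', ''next'', ''h''} s1 s2 \<and>
        (if ?two then s2 ''child'' (n + 3) = s1 ''h'' 0 \<and> s2 ''h'' 0 = 0 \<and>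
            s2 ''kind'' = (\<lambda>y. if y = n + 2 \<or> y = n + 3 then 2 else 0) \<and>
            s2 ''next'' = (s1 ''next'')(n + 2 := n + 3)
         else s2 = s1)"
      then have t2: "t2 \<le> 60"
        and f2: "\<And>x. x \<notin> {''child'', ''kind'', ''next'', ''h''} \<Longrightarrow> s2 x = s1 x"
        and c2: "if ?two then s2 ''child'' (n + 3) = s1 ''h'' 0 \<and> s2 ''h'' 0 = 0 \<and>
            s2 ''kind'' = (\<lambda>y. if y = n + 2 \<or> y = n + 3 then 2 else 0) \<and>
            s2 ''next'' = (s1 ''next'')(n + 2 := n + 3)
         else s2 = s1"
        by blast+
      have v2: "s2 ''n'' 0 = n" "s2 ''m'' 0 = m" "s2 ''g'' = s ''g''" "s2 ''f'' = s ''f''" "s2 ''w'' = s ''w''"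
        using f2 v1 by auto
      have u: "[0..<Suc (m - 1)] = [0..<m]" using m by simp
      have "run D write_first s2 (\<lambda>t3 s3. t3 \<le> 60 * n + 100 \<and>
        same_except {''a'', ''z'', ''j'', ''x'', ''label'', ''next'', ''h''} s2 s3 \<and>
        chain s3 (s3 ''h'' 0) K (s2 ''h'' 0) \<and>
        (\<forall>y. y \<notin> Suc ` set K \<longrightarrow> s3 ''next'' y = s2 ''next'' y \<and> s3 ''label'' y = s2 ''label'' y))"
        unfolding write_first_def K_def
        using run_link_descending[where s = s2 and A = "Const 0" and a = 0 and n = n and D = D
            and Z = "Minus (scalar ''m'') (Const 1)" and z = "m - 1", unfolded u v2(5)] m inj
        by (simp add: store_def v2)
      then show "run D write_first s2 (\<lambda>t3 s3. run D write_root s3 (\<lambda>t4 s'.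
          t1 + (t2 + (t3 + t4)) \<le> 120 * n + 400 \<and>
        outputs s' ?T))"
      proof (rule run_mono)
        fix t3 :: nat and s3 :: memory
        assume "t3 \<le> 60 * n + 100 \<and>
          same_except {''a'', ''z'', ''j'', ''x'', ''label'', ''next'', ''h''} s2 s3 \<and>
          chain s3 (s3 ''h'' 0) K (s2 ''h'' 0) \<and>
          (\<forall>y. y \<notin> Suc ` set K \<longrightarrow> s3 ''next'' y = s2 ''next'' y \<and> s3 ''label'' y = s2 ''label'' y)"
        then have t3: "t3 \<le> 60 * n + 100"
          and f3: "\<And>x. x \<notin> {''a'', ''z'', ''j'', ''x'', ''label'', ''next'', ''h''} \<Longrightarrow> s3 x = s2 x"
          and c3: "chain s3 (s3 ''h'' 0) K (s2 ''h'' 0)"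
          and n3: "\<And>y. y \<notin> Suc ` set K \<Longrightarrow> s3 ''next'' y = s2 ''next'' y \<and> s3 ''label'' y = s2 ''label'' y"
          by blast+
        have v3: "s3 ''n'' 0 = n" "s3 ''g'' = s ''g''" "s3 ''f'' = s ''f''" "s3 ''kind'' = s2 ''kind''"
          "s3 ''child'' = s2 ''child''"
          using f3 v2 by auto
        have l2: "s2 ''label'' = s1 ''label''" using f2 by simp
        \<comment> \<open>Linking the first path writes at leaves outside the other path, and
          \<open>close_last\<close> changes a \<open>next\<close> cell only above all leaf
          addresses, so the list built earlier survives.\<close>
        have keep: "chain s3 h ?X 0" if c: "chain s1 h ?X 0" for h
        proof -
          have e: "s3 ''label'' (Suc x) = s1 ''label'' (Suc x) \<and> s3 ''next'' (Suc x) = s1 ''next'' (Suc x)"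
            if "x \<in> set ?X" for x
          proof -
            have x: "x \<in> set K'" using that by (auto split: if_splits)
            then have "Suc x \<notin> Suc ` set K" using disj by auto
            moreover have "s2 ''next'' (Suc x) = s1 ''next'' (Suc x)"
              using c2 K'lt[OF x] by (auto split: if_splits)
            ultimately show ?thesis using n3[of "Suc x"] by (simp add: l2)
          qed
          show ?thesis using chain_cong[of ?X s3 s1, OF e] c by blast
        qed
        show "run D write_root s3 (\<lambda>t4 s'. t1 + (t2 + (t3 + t4)) \<le> 120 * n + 400 \<and>
          outputs s' ?T)"
        proof (cases ?two)
          case True
          have "run D write_root s3 (\<lambda>t4 s'. t4 \<le> 60 \<and> s' ''next'' = s3 ''next'' \<and> s' ''label'' = s3 ''label'' \<and>
            s' ''root'' 0 = n + 1 \<and> s' ''kind'' = (s3 ''kind'')(n + 1 := 2) \<and>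
            s' ''child'' = (s3 ''child'')(n + 2 := s3 ''h'' 0, n + 1 := n + 2))"
            unfolding write_root_def run_simps using True by (auto simp: store_def v3)
          then show ?thesis
          proof (rule run_mono)
            fix t4 :: nat and s' :: memory
            assume h: "t4 \<le> 60 \<and> s' ''next'' = s3 ''next'' \<and> s' ''label'' = s3 ''label'' \<and>
              s' ''root'' 0 = n + 1 \<and> s' ''kind'' = (s3 ''kind'')(n + 1 := 2) \<and>
              s' ''child'' = (s3 ''child'')(n + 2 := s3 ''h'' 0, n + 1 := n + 2)"
            have kd: "s' ''kind'' y = (if y = n + 1 \<or> y = n + 2 \<or> y = n + 3 then 2 else 0)" for y
              using h c2 True by (auto simp: v3)
            have kk: "s' ''kind'' (n + 1) = 2" "s' ''kind'' (n + 2) = 2" "s' ''kind'' (n + 3) = 2"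
              by (simp_all add: kd)
            have chd: "s' ''child'' (n + 1) = n + 2" "s' ''child'' (n + 2) = s3 ''h'' 0"
              "s' ''child'' (n + 3) = s1 ''h'' 0"
              using h c2 True by (auto simp: v3)
            have cc: "chain s' hh xs e \<longleftrightarrow> chain s3 hh xs e" for hh xs e
              by (rule chain_cong) (use h in simp)
            have "chain s' (s3 ''h'' 0) K 0" using c3 c2 True by (simp add: cc)
            then have "forest_at s' (s3 ''h'' 0) (map Leaf K)"
              by (rule chain_forest) (use Klt in \<open>force simp: kd\<close>)
            then have TK: "tree_at s' (n + 2) (QNode (map Leaf K))"
              by (intro tree_at_forest_at.QNode) (simp_all only: kk chd)
            have "chain s' (s1 ''h'' 0) K' 0" using keep[of "s1 ''h'' 0"] c1 True by (simp add: cc)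
            then have "forest_at s' (s1 ''h'' 0) (map Leaf K')"
              by (rule chain_forest) (use K'lt in \<open>force simp: kd\<close>)
            then have TK': "tree_at s' (n + 3) (QNode (map Leaf K'))"
              by (intro tree_at_forest_at.QNode) (simp_all only: kk chd)
            have nx: "s' ''next'' (n + 2) = n + 3" "s' ''next'' (n + 3) = 0"
              using h n3[of "n + 2"] n3[of "n + 3"] big[of "n + 2"] big[of "n + 3"] n1[of "n + 3"] c2 True
              by auto
            have "forest_at s' (n + 3) [QNode (map Leaf K')]"
              using tree_at_forest_at.Cons[OF _ TK', of "[]"] by (simp add: nx(2) tree_at_forest_at.Nil)
            then have "forest_at s' (n + 2) [QNode (map Leaf K), QNode (map Leaf K')]"
              using tree_at_forest_at.Cons[OF _ TK] unfolding nx(1) by simp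
            then have "tree_at s' (n + 1) (QNode [QNode (map Leaf K), QNode (map Leaf K')])"
              by (intro tree_at_forest_at.QNode) (simp_all only: kk chd)
            then show "t1 + (t2 + (t3 + t4)) \<le> 120 * n + 400 \<and>
              outputs s' ?T"
              using h t1 t2 t3 True by (simp add: outputs_def)
          qed
        next
          case False
          then have s21: "s2 = s1" using c2 by auto
          have "run D write_root s3 (\<lambda>t4 s'. t4 \<le> 60 \<and> s' ''next'' = s3 ''next'' \<and> s' ''label'' = s3 ''label'' \<and>
            s' ''root'' 0 = n + 1 \<and> s' ''kind'' = (s3 ''kind'')(n + 1 := 2) \<and>
            s' ''child'' = (s3 ''child'')(n + 1 := s3 ''h'' 0))"
            unfolding write_root_def run_simps using False by (auto simp: store_def v3)
          then show ?thesis
          proof (rule run_mono)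
            fix t4 :: nat and s' :: memory
            assume h: "t4 \<le> 60 \<and> s' ''next'' = s3 ''next'' \<and> s' ''label'' = s3 ''label'' \<and>
              s' ''root'' 0 = n + 1 \<and> s' ''kind'' = (s3 ''kind'')(n + 1 := 2) \<and>
              s' ''child'' = (s3 ''child'')(n + 1 := s3 ''h'' 0)"
            have kd: "s' ''kind'' y = (if y = n + 1 then 2 else 0)" for y
              using h v1 by (auto simp: v3 s21)
            have cc: "chain s' hh xs e \<longleftrightarrow> chain s3 hh xs e" for hh xs e
              by (rule chain_cong) (use h in simp)
            have "chain s3 (s1 ''h'' 0) ?X 0" using keep c1 by blast
            then have "chain s3 (s3 ''h'' 0) (K @ ?X) 0"
              using c3 unfolding chain_append s21 by blast
            then have "chain s' (s3 ''h'' 0) (K @ ?X) 0" by (simp only: cc)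
            then have "forest_at s' (s3 ''h'' 0) (map Leaf (K @ ?X))"
              by (rule chain_forest) (use Klt K'lt in \<open>force simp: kd split: if_splits\<close>)
            moreover have "s' ''kind'' (n + 1) = 2" by (simp add: kd)
            moreover have "s' ''child'' (n + 1) = s3 ''h'' 0" using h by simp
            ultimately have "tree_at s' (n + 1) (QNode (map Leaf (K @ ?X)))"
              by (intro tree_at_forest_at.QNode) (simp_all only:)
            then show "t1 + (t2 + (t3 + t4)) \<le> 120 * n + 400 \<and>
              outputs s' ?T"
              using h t1 t2 t3 False by (auto simp: outputs_def simp del: map_append split: if_splits)
          qed
        qed
      qed
    qed
  qed
qed

section \<open>The algorithm\<close>

text \<open>\<open>i\<close> and \<open>t\<close> carry over from the first path to the second: both
  equal \<open>m\<close> then, so the second build continues the visiting order and the second copy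
  continues filling \<open>w\<close>.\<close>

definition assemble_paths :: com where
  "assemble_paths = ''e'' ::= scalar ''m'' ;; ''i'' ::= Const 0 ;; build_path ;; copy_path ;;
     ''e'' ::= scalar ''n'' ;; build_path ;; copy_path"

text \<open>\<open>g\<close> saves the outcome of the straight test before \<open>f\<close> is
  cleared for the flipped one; in both, 0 means passed.\<close>

definition run_tests :: com where
  "run_tests =
     check (Const 0) (Minus (scalar ''m'') (Const 1))
       (Cell ''w'' (scalar ''m'')) (Cell ''w'' (Minus (scalar ''n'') (Const 1))) ;;
     check (scalar ''m'') (Minus (scalar ''n'') (Const 1))
       (Cell ''w'' (Const 0)) (Cell ''w'' (Minus (scalar ''m'') (Const 1))) ;;
     ''g'' ::= scalar ''f'' ;; ''f'' ::= Const 0 ;;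
     check (Const 0) (Minus (scalar ''m'') (Const 1))
       (Cell ''w'' (Minus (scalar ''n'') (Const 1))) (Cell ''w'' (scalar ''m'')) ;;
     check (scalar ''m'') (Minus (scalar ''n'') (Const 1))
       (Cell ''w'' (Minus (scalar ''m'') (Const 1))) (Cell ''w'' (Const 0))"

text \<open>For \<open>n = 1\<close> the initial memory already represents the tree \<open>Leaf 0\<close>.\<close>

definition seriate :: com where
  "seriate = Cond (Less (Const 1) (scalar ''n''))
     (prim ;; assemble_paths ;; run_tests ;; write_tree) Skip"

lemma run_assemble_paths:
  fixes s :: memory
  assumes s: "s ''n'' 0 = n" "s ''m'' 0 = m" "s ''t'' 0 = 0" and m: "0 < m" "m < n"
  defines "L \<equiv> grow (s ''seq'') (s ''par'') 0 (m - 1) @ grow (s ''seq'') (s ''par'') m (n - m - 1)"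
  shows "run D assemble_paths s (\<lambda>t s'. t \<le> 220 * n + 400 \<and>
    same_except {''e'', ''i'', ''lo'', ''hi'', ''q'', ''j'', ''t'', ''w''} s s' \<and>
    (\<forall>k<n. s' ''w'' k = L ! k))"
proof -
  let ?K = "grow (s ''seq'') (s ''par'') 0 (m - 1)" and ?K' = "grow (s ''seq'') (s ''par'') m (n - m - 1)"
  define s0 where "s0 = store (store s ''e'' 0 m) ''i'' 0 0"
  have f0: "\<And>x. x \<notin> {''e'', ''i''} \<Longrightarrow> s0 x = s x" and v0: "s0 ''e'' 0 = m" "s0 ''i'' 0 = 0"
    by (auto simp: s0_def store_def)
  have first: "run D build_path s0 (\<lambda>t s'. t \<le> 70 * n + 70 \<and>
    same_except {''lo'', ''hi'', ''q'', ''i''} s0 s' \<and> s' ''i'' 0 = m \<and>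
    s' ''hi'' 0 = s' ''lo'' 0 + (m - 1) \<and>
    (\<forall>y<m. s' ''q'' (s' ''lo'' 0 + y) = ?K ! y))"
    using run_build_path[of s0 n 0 m D] f0 v0 s m by simp
  \<comment> \<open>The two initial assignments cost 4 + 3 = 7 units.\<close>
  have e0: "run D assemble_paths s Q \<longleftrightarrow>
    run D (build_path ;; copy_path ;; ''e'' ::= scalar ''n'' ;; build_path ;; copy_path) s0 (\<lambda>t. Q (7 + t))" for Q
    unfolding assemble_paths_def run_Seq[of D "Assign _ _ _"] run_Assign s0_def
    by (simp add: s store_def eval_nat_numeral)
  show ?thesis
    unfolding e0 run_Seq[of D build_path] run_Seq[of D copy_path]
  proof (rule run_mono[OF first])
    fix t1 :: nat and s1 :: memory
    assume "t1 \<le> 70 * n + 70 \<and>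
      same_except {''lo'', ''hi'', ''q'', ''i''} s0 s1 \<and> s1 ''i'' 0 = m \<and>
      s1 ''hi'' 0 = s1 ''lo'' 0 + (m - 1) \<and>
      (\<forall>y<m. s1 ''q'' (s1 ''lo'' 0 + y) = ?K ! y)"
    then have t1: "t1 \<le> 70 * n + 70" and f1: "\<And>x. x \<notin> {''lo'', ''hi'', ''q'', ''i''} \<Longrightarrow> s1 x = s0 x"
      and i1: "s1 ''i'' 0 = m" and hi1: "s1 ''hi'' 0 = s1 ''lo'' 0 + (m - 1)"
      and q1: "\<And>y. y < m \<Longrightarrow> s1 ''q'' (s1 ''lo'' 0 + y) = ?K ! y"
      by blast+
    have tt: "s1 ''t'' 0 = 0" using f1 f0 s by simp
    have mm: "Suc (m - 1) = m" using m by simp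
    show "run D copy_path s1 (\<lambda>t2 s2. run D (''e'' ::= scalar ''n'' ;; build_path ;; copy_path) s2
      (\<lambda>t3 s'. 7 + (t1 + (t2 + t3)) \<le> 220 * n + 400 \<and>
        same_except {''e'', ''i'', ''lo'', ''hi'', ''q'', ''j'', ''t'', ''w''} s s' \<and>
        (\<forall>k<n. s' ''w'' k = L ! k)))"
    proof (rule run_mono[OF run_copy_path[where s = s1 and r = "m - 1", OF hi1]])
      fix t2 :: nat and s2 :: memory
      assume "t2 \<le> 40 * (m - 1) + 80 \<and>
        same_except {''j'', ''t'', ''w''} s1 s2 \<and> s2 ''t'' 0 = s1 ''t'' 0 + Suc (m - 1) \<and>
        (\<forall>k. s2 ''w'' k = (if s1 ''t'' 0 \<le> k \<and> k < s1 ''t'' 0 + Suc (m - 1)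
          then s1 ''q'' (s1 ''lo'' 0 + (k - s1 ''t'' 0)) else s1 ''w'' k))"
      then have t2: "t2 \<le> 40 * (m - 1) + 80" and f2: "\<And>x. x \<notin> {''j'', ''t'', ''w''} \<Longrightarrow> s2 x = s1 x"
        and tt2: "s2 ''t'' 0 = m" and w2: "\<And>k. k < m \<Longrightarrow> s2 ''w'' k = ?K ! k"
        unfolding tt mm using q1 by auto
      define s3 where "s3 = store s2 ''e'' 0 n"
      have n2: "s2 ''n'' 0 = n" using f2 f1 f0 s by simp
      have f3: "\<And>x. x \<noteq> ''e'' \<Longrightarrow> s3 x = s2 x" and e3: "s3 ''e'' 0 = n" by (auto simp: s3_def store_def)
      have e: "run D (''e'' ::= scalar ''n'' ;; build_path ;; copy_path) s2 Q \<longleftrightarrow>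
        run D (build_path ;; copy_path) s3 (\<lambda>t. Q (4 + t))" for Q
        unfolding run_Seq[of D "Assign _ _ _"] run_Assign s3_def by (simp add: n2 eval_nat_numeral)
      have pre: "s3 ''n'' 0 = n" "s3 ''i'' 0 = m" "s3 ''seq'' = s ''seq''" "s3 ''par'' = s ''par''"
        "s3 ''t'' 0 = m" "s3 ''w'' = s2 ''w''"
        using f3 f2 f1 f0 n2 i1 tt2 by auto
      have second: "run D build_path s3 (\<lambda>t s'. t \<le> 70 * n + 70 \<and>
        same_except {''lo'', ''hi'', ''q'', ''i''} s3 s' \<and> s' ''i'' 0 = n \<and>
        s' ''hi'' 0 = s' ''lo'' 0 + (n - m - 1) \<and>
        (\<forall>y<n - m. s' ''q'' (s' ''lo'' 0 + y) = ?K' ! y))"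
        using run_build_path[of s3 n m n D] pre e3 m by simp
      show "run D (''e'' ::= scalar ''n'' ;; build_path ;; copy_path) s2
        (\<lambda>t3 s'. 7 + (t1 + (t2 + t3)) \<le> 220 * n + 400 \<and>
        same_except {''e'', ''i'', ''lo'', ''hi'', ''q'', ''j'', ''t'', ''w''} s s' \<and>
        (\<forall>k<n. s' ''w'' k = L ! k))"
        unfolding e unfolding run_Seq
      proof (rule run_mono[OF second])
        fix t4 :: nat and s4 :: memory
        assume "t4 \<le> 70 * n + 70 \<and>
          same_except {''lo'', ''hi'', ''q'', ''i''} s3 s4 \<and> s4 ''i'' 0 = n \<and>
          s4 ''hi'' 0 = s4 ''lo'' 0 + (n - m - 1) \<and>
          (\<forall>y<n - m. s4 ''q'' (s4 ''lo'' 0 + y) = ?K' ! y)"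
        then have t4: "t4 \<le> 70 * n + 70" and f4: "\<And>x. x \<notin> {''lo'', ''hi'', ''q'', ''i''} \<Longrightarrow> s4 x = s3 x"
          and hi4: "s4 ''hi'' 0 = s4 ''lo'' 0 + (n - m - 1)"
          and q4: "\<And>y. y < n - m \<Longrightarrow> s4 ''q'' (s4 ''lo'' 0 + y) = ?K' ! y"
          by blast+
        have tt4: "s4 ''t'' 0 = m" "s4 ''w'' = s2 ''w''" using f4 pre by auto
        have nm: "Suc (n - m - 1) = n - m" using m by simp
        show "run D copy_path s4 (\<lambda>t5 s'. 7 + (t1 + (t2 + (4 + (t4 + t5)))) \<le> 220 * n + 400 \<and>
          same_except {''e'', ''i'', ''lo'', ''hi'', ''q'', ''j'', ''t'', ''w''} s s' \<and>
          (\<forall>k<n. s' ''w'' k = L ! k))"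
        proof (rule run_mono[OF run_copy_path[where s = s4 and r = "n - m - 1", OF hi4]])
          fix t5 :: nat and s' :: memory
          assume "t5 \<le> 40 * (n - m - 1) + 80 \<and>
            same_except {''j'', ''t'', ''w''} s4 s' \<and> s' ''t'' 0 = s4 ''t'' 0 + Suc (n - m - 1) \<and>
            (\<forall>k. s' ''w'' k = (if s4 ''t'' 0 \<le> k \<and> k < s4 ''t'' 0 + Suc (n - m - 1)
              then s4 ''q'' (s4 ''lo'' 0 + (k - s4 ''t'' 0)) else s4 ''w'' k))"
          then have t5: "t5 \<le> 40 * (n - m - 1) + 80" and f5: "\<And>x. x \<notin> {''j'', ''t'', ''w''} \<Longrightarrow> s' x = s4 x"
            and w5: "\<And>k. s' ''w'' k = (if m \<le> k \<and> k < m + (n - m)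
              then s4 ''q'' (s4 ''lo'' 0 + (k - m)) else s2 ''w'' k)"
            unfolding tt4 nm by blast+
          have "s' ''w'' k = L ! k" if "k < n" for k
            using that w5[of k] w2[of k] q4[of "k - m"] m by (auto simp: L_def nth_append)
          moreover have "s' x = s x"
            if "x \<notin> {''e'', ''i'', ''lo'', ''hi'', ''q'', ''j'', ''t'', ''w''}" for x
            using that f5[of x] f4[of x] f3[of x] f2[of x] f1[of x] f0[of x] by simp
          moreover have "7 + (t1 + (t2 + (4 + (t4 + t5)))) \<le> 220 * n + 400"
            using t1 t2 t4 t5 m by simp
          ultimately show "7 + (t1 + (t2 + (4 + (t4 + t5)))) \<le> 220 * n + 400 \<and>
            same_except {''e'', ''i'', ''lo'', ''hi'', ''q'', ''j'', ''t'', ''w''} s s' \<and>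
            (\<forall>k<n. s' ''w'' k = L ! k)" by blast
        qed
      qed
    qed
  qed
qed

lemma run_run_tests:
  fixes D :: "real mat" and s :: memory
  assumes s: "s ''n'' 0 = n" "s ''m'' 0 = m" "s ''f'' 0 = 0" and m: "0 < m" "m < n"
  defines "E \<equiv> (\<lambda>i j. entry D (s ''w'' i) (s ''w'' j))"
  shows "run D run_tests s (\<lambda>t s'. t \<le> 400 * n + 700 \<and>
    same_except {''a'', ''z'', ''c'', ''d'', ''j'', ''f'', ''g''} s s' \<and>
    (s' ''g'' 0 = 0 \<longleftrightarrow> straight_test n m E) \<and> (s' ''f'' 0 = 0 \<longleftrightarrow> flipped_test n m E))"
proof -
  let ?m1 = "Minus (scalar ''m'') (Const 1)" and ?n1 = "Minus (scalar ''n'') (Const 1)"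
  let ?c3 = "check (Const 0) ?m1 (Cell ''w'' ?n1) (Cell ''w'' (scalar ''m''))"
    and ?c4 = "check (scalar ''m'') ?n1 (Cell ''w'' ?m1) (Cell ''w'' (Const 0))"
  let ?post = "\<lambda>s'. same_except {''a'', ''z'', ''c'', ''d'', ''j'', ''f'', ''g''} s s' \<and>
    (s' ''g'' 0 = 0 \<longleftrightarrow> straight_test n m E) \<and> (s' ''f'' 0 = 0 \<longleftrightarrow> flipped_test n m E)"
  let ?fr = "same_except {''a'', ''z'', ''c'', ''d'', ''j'', ''f''}"
  have step: "run D (check A Z C F) s1 (\<lambda>t s'. t \<le> 100 * n + 150 \<and> ?fr s1 s' \<and>
      (s' ''f'' 0 = 0 \<longleftrightarrow> s1 ''f'' 0 = 0 \<and> endpoint_test E a z c e))"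
    if "s1 ''n'' 0 = n" "s1 ''m'' 0 = m" "s1 ''w'' = s ''w''"
      and "(A, Z, C, F, a, z, c, e) \<in>
        {(Const 0, ?m1, Cell ''w'' (scalar ''m''), Cell ''w'' ?n1, 0, m - 1, m, n - 1),
         (scalar ''m'', ?n1, Cell ''w'' (Const 0), Cell ''w'' ?m1, m, n - 1, 0, m - 1),
         (Const 0, ?m1, Cell ''w'' ?n1, Cell ''w'' (scalar ''m''), 0, m - 1, n - 1, m),
         (scalar ''m'', ?n1, Cell ''w'' ?m1, Cell ''w'' (Const 0), m, n - 1, m - 1, 0)}"
    for A Z C F a z c e and s1 :: memory
  proof -
    have E: "E = (\<lambda>i j. entry D (s1 ''w'' i) (s1 ''w'' j))" by (simp add: E_def that(3))
    show ?thesis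
      unfolding E
    proof (rule run_check)
      fix s' :: memory
      assume fr: "\<And>x. x \<notin> {''a'', ''z'', ''c'', ''d''} \<Longrightarrow> s' x = s1 x"
      have "s' ''n'' = s1 ''n''" "s' ''m'' = s1 ''m''" "s' ''w'' = s1 ''w''" by (rule fr, simp)+
      then show "aval A s' = a \<and> aval Z s' = z \<and> aval C s' = s1 ''w'' c \<and> aval F s' = s1 ''w'' e"
        using that by auto
    qed (use that(4) m in auto)
  qed
  have T: "straight_test n m E \<longleftrightarrow> endpoint_test E 0 (m - 1) m (n - 1) \<and> endpoint_test E m (n - 1) 0 (m - 1)"
    "flipped_test n m E \<longleftrightarrow> endpoint_test E 0 (m - 1) (n - 1) m \<and> endpoint_test E m (n - 1) (m - 1) 0"
    by (simp_all add: straight_test_def flipped_test_def)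
  show ?thesis
    unfolding run_tests_def run_Seq
  proof (rule run_mono[OF step[of s _ _ _ _ 0 "m - 1" m "n - 1"]])
    fix t1 :: nat and s1 :: memory
    assume h1: "t1 \<le> 100 * n + 150 \<and> ?fr s s1 \<and>
      (s1 ''f'' 0 = 0 \<longleftrightarrow> s ''f'' 0 = 0 \<and> endpoint_test E 0 (m - 1) m (n - 1))"
    have v1: "s1 ''n'' 0 = n" "s1 ''m'' 0 = m" "s1 ''w'' = s ''w''" using h1 s by auto
    show "run D (check (scalar ''m'') ?n1 (Cell ''w'' (Const 0)) (Cell ''w'' ?m1)) s1
      (\<lambda>t2 s2. run D (''g'' ::= scalar ''f'') s2 (\<lambda>t3 s3. run D (''f'' ::= Const 0) s3 (\<lambda>t4 s4.
        run D ?c3 s4 (\<lambda>t5 s5.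
          run D ?c4 s5 (\<lambda>t6 s'.
            t1 + (t2 + (t3 + (t4 + (t5 + t6)))) \<le> 400 * n + 700 \<and>
            ?post s')))))"
    proof (rule run_mono[OF step[of s1 _ _ _ _ m "n - 1" 0 "m - 1"]])
      fix t2 :: nat and s2 :: memory
      assume h2: "t2 \<le> 100 * n + 150 \<and> ?fr s1 s2 \<and>
        (s2 ''f'' 0 = 0 \<longleftrightarrow> s1 ''f'' 0 = 0 \<and> endpoint_test E m (n - 1) 0 (m - 1))"
      have c: "1 + acost (Const 0) + acost (scalar ''f'') = 4" "1 + acost (Const 0) + acost (Const 0) = 3"
        by simp_all
      define s4 where "s4 = store (store s2 ''g'' 0 (s2 ''f'' 0)) ''f'' 0 0"
      have v4: "s4 ''n'' 0 = n" "s4 ''m'' 0 = m" "s4 ''w'' = s ''w''" using h2 v1 by (auto simp: s4_def store_def)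
      have g4: "s4 ''g'' 0 = 0 \<longleftrightarrow> straight_test n m E" and f4: "s4 ''f'' 0 = 0"
        using h1 h2 s T by (auto simp: s4_def store_def)
      have o4: "s4 x = s x" if "x \<notin> {''a'', ''z'', ''c'', ''d'', ''j'', ''f'', ''g''}" for x
        using that h1 h2 by (simp add: s4_def store_def)
      have "run D ?c3 s4 (\<lambda>t5 s5.
          run D ?c4 s5 (\<lambda>t6 s'.
            t1 + (t2 + (4 + (3 + (t5 + t6)))) \<le> 400 * n + 700 \<and>
            ?post s'))"
      proof (rule run_mono[OF step[of s4 _ _ _ _ 0 "m - 1" "n - 1" m]])
        fix t5 :: nat and s5 :: memory
        assume h5: "t5 \<le> 100 * n + 150 \<and> ?fr s4 s5 \<and>
          (s5 ''f'' 0 = 0 \<longleftrightarrow> s4 ''f'' 0 = 0 \<and> endpoint_test E 0 (m - 1) (n - 1) m)"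
        have v5: "s5 ''n'' 0 = n" "s5 ''m'' 0 = m" "s5 ''w'' = s ''w''" using h5 v4 by auto
        show "run D ?c4 s5 (\<lambda>t6 s'.
            t1 + (t2 + (4 + (3 + (t5 + t6)))) \<le> 400 * n + 700 \<and>
            ?post s')"
        proof (rule run_mono[OF step[of s5 _ _ _ _ m "n - 1" "m - 1" 0]])
          fix t6 :: nat and s' :: memory
          assume h6: "t6 \<le> 100 * n + 150 \<and> ?fr s5 s' \<and>
            (s' ''f'' 0 = 0 \<longleftrightarrow> s5 ''f'' 0 = 0 \<and> endpoint_test E m (n - 1) (m - 1) 0)"
          have "s' x = s x" if "x \<notin> {''a'', ''z'', ''c'', ''d'', ''j'', ''f'', ''g''}" for x
            using that o4[OF that] h5 h6 by simp
          moreover have "s' ''g'' = s4 ''g''" using h5 h6 by simp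
          moreover have "t1 + (t2 + (4 + (3 + (t5 + t6)))) \<le> 400 * n + 700" using h1 h2 h5 h6 by simp
          moreover have "s' ''f'' 0 = 0 \<longleftrightarrow> flipped_test n m E"
            unfolding T h6[THEN conjunct2, THEN conjunct2] h5[THEN conjunct2, THEN conjunct2]
            by (simp add: f4)
          ultimately show "t1 + (t2 + (4 + (3 + (t5 + t6)))) \<le> 400 * n + 700 \<and>
            ?post s'"
            using g4 by simp
        qed (use v5 in simp_all)
      qed (use v4 in simp_all)
      then show "run D (''g'' ::= scalar ''f'') s2 (\<lambda>t3 s3. run D (''f'' ::= Const 0) s3 (\<lambda>t4 s4.
        run D ?c3 s4 (\<lambda>t5 s5.
          run D ?c4 s5 (\<lambda>t6 s'.
            t1 + (t2 + (t3 + (t4 + (t5 + t6)))) \<le> 400 * n + 700 \<and>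
            ?post s'))))"
        unfolding run_Assign c s4_def by simp
    qed (use v1 in simp_all)
  qed (use s in simp_all)
qed

section \<open>From the program to the set of valid orders\<close>

lemma dissimilarity_entry:
  assumes "dissimilarity_mat n D"
  shows "dissimilarity n (entry D)"
  using assms unfolding dissimilarity_mat_def dissimilarity_def entry_def by auto

lemma valid_order_entry:
  assumes "dissimilarity_mat n D"
  shows "valid_order n (\<lambda>i j. D $$ (i, j)) = valid_order n (entry D)"
proof -
  have e: "entry D i j = D $$ (i, j)" if "i < n" "j < n" for i j
    using assms that unfolding dissimilarity_mat_def entry_def by auto
  have "min (D $$ (j, k)) (D $$ (k, l)) < D $$ (i, k) \<longleftrightarrow> min (entry D j k) (entry D k l) < entry D i k"
    if p: "\<sigma> permutes {0..<n}" and c: "cyclically_ordered n (\<sigma> i) (\<sigma> j) (\<sigma> k) (\<sigma> l)" for \<sigma> i j k l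
  proof -
    have "i < n" "j < n" "k < n" "l < n"
      using c permutes_less_iff[OF p] by (auto simp: cyclically_ordered_def)
    then show ?thesis by (simp add: e)
  qed
  then show ?thesis unfolding valid_order_def fun_eq_iff by blast
qed

text \<open>Growing a path requires each parent to lie earlier in the same segment. This is part of
  \<open>prim_tree\<close> for the indices below \<open>m\<close>, and
  \<open>prim_tree_parent_after\<close> provides it from \<open>m\<close> on.\<close>

lemma prim_tree_paths:
  assumes d: "dissimilarity n d" and v0: "valid_order n d \<sigma>0"
    and P: "prim_tree n d v p" and H: "last_heaviest n d v p m"
  defines "K \<equiv> grow v p 0 (m - 1)" and "K' \<equiv> grow v p m (n - m - 1)"
  shows "distinct (K @ K')" "set (K @ K') = {0..<n}"
    and "valid_order n d \<sigma> \<Longrightarrow> cyc_path n \<sigma> K"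
    and "valid_order n d \<sigma> \<Longrightarrow> cyc_path n \<sigma> K'"
proof -
  have m: "0 < m" "m < n" using H by (auto simp: last_heaviest_def)
  have inj: "inj_on v {..<n}" and img: "v ` {..<n} = {..<n}"
    using P by (auto simp: prim_tree_def)
  have vlt: "v i < n" if "i < n" for i using img that by blast
  have iK: "{0..0 + (m - 1)} = {..<m}" and iK': "{m..m + (n - m - 1)} = {m..<n}"
    using m by auto
  have sets: "set K = v ` {..<m}" "set K' = v ` {m..<n}"
    unfolding K_def K'_def set_grow iK iK' by simp_all
  have U: "{..<m} \<union> {m..<n} = {..<n}" using m by auto
  have "set (K @ K') = v ` ({..<m} \<union> {m..<n})" by (simp add: sets image_Un)
  then show "set (K @ K') = {0..<n}" unfolding U img by (simp add: lessThan_atLeast0)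
  have "distinct K" "distinct K'" unfolding K_def K'_def
    by (rule distinct_grow, rule inj_on_subset[OF inj], use m in auto)+
  moreover have "set K \<inter> set K' = {}"
  proof -
    have "{m..<n} \<subseteq> {..<n}" "{..<m} \<subseteq> {..<n}" "{..<m} \<inter> {m..<n} = {}" using m by auto
    then show ?thesis unfolding sets using inj_on_image_Int[OF inj] by (metis image_empty)
  qed
  ultimately show "distinct (K @ K')" by simp
  have sym: "d i j = d j i" if "i < n" "j < n" for i j using d that by (auto simp: dissimilarity_def)
  assume v: "valid_order n d \<sigma>"
  then have p: "\<sigma> permutes {0..<n}" by (simp add: valid_order_def)
  note adj = prim_tree_adjacent[OF v sym P H]
  show "cyc_path n \<sigma> K"
    unfolding K_def
  proof (rule successively_grow[OF p inj vlt])
    fix i assume i: "0 < i" "i \<le> 0 + (m - 1)"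
    then show "cyc_adjacent n (\<sigma> (p (v i))) (\<sigma> (v i))" using adj[of i] m by simp
    show "p (v i) \<in> v ` {0..<i}"
      using P i m unfolding prim_tree_def lessThan_atLeast0 by auto
  qed (use m in auto)
  show "cyc_path n \<sigma> K'"
    unfolding K'_def
  proof (rule successively_grow[OF p inj vlt])
    fix i assume i: "m < i" "i \<le> m + (n - m - 1)"
    then show "cyc_adjacent n (\<sigma> (p (v i))) (\<sigma> (v i))" using adj[of i] m by simp
    show "p (v i) \<in> v ` {m..<i}" using prim_tree_parent_after[OF P H] i m by simp
  qed (use m in auto)
qed

abbreviation solved :: "nat \<Rightarrow> real mat \<Rightarrow> memory \<Rightarrow> bool" where
  "solved n D s \<equiv> \<exists>T. outputs s T \<and> pqtree_on n T \<and>
    {\<sigma>. valid_order n (entry D) \<sigma>} = {\<rho> \<circ> \<pi> | \<rho> \<pi>. \<rho> \<in> Dih n \<and> \<pi> \<in> pq_perms n T}"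

lemma run_seriate:
  assumes n: "1 < n" and dm: "dissimilarity_mat n D" and v0: "valid_order n (entry D) \<sigma>0"
  shows "run D seriate (initial_memory n) (\<lambda>t s. t \<le> 4000 * (n * n) \<and> solved n D s)"
proof -
  have d: "dissimilarity n (entry D)" by (rule dissimilarity_entry[OF dm])
  have c: "bval D (Less (Const 1) (scalar ''n'')) (initial_memory n)"
    using n by (simp add: initial_memory_def store_def)
  show ?thesis
    unfolding seriate_def run_Cond if_P[OF c] run_Seq
  proof (rule run_mono[OF run_prim[OF n d]])
    fix t1 :: nat and s1 :: memory
    assume h1: "t1 \<le> 300 * n * n \<and>
      prim_tree n (entry D) (s1 ''seq'') (s1 ''par'') \<and>
      last_heaviest n (entry D) (s1 ''seq'') (s1 ''par'') (s1 ''m'' 0) \<and> s1 ''n'' 0 = n \<and>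
      zero_except_prim s1"
    let ?m = "s1 ''m'' 0"
    define K where "K = grow (s1 ''seq'') (s1 ''par'') 0 (?m - 1)"
    define K' where "K' = grow (s1 ''seq'') (s1 ''par'') ?m (n - ?m - 1)"
    have P: "prim_tree n (entry D) (s1 ''seq'') (s1 ''par'')"
      and H: "last_heaviest n (entry D) (s1 ''seq'') (s1 ''par'') ?m" using h1 by blast+
    note paths = prim_tree_paths[OF d v0 P H, folded K_def K'_def]
    have m: "0 < ?m" "?m < n" using H by (auto simp: last_heaviest_def)
    have lenK: "length K = ?m" "length K' = n - ?m" using m by (auto simp: K_def K'_def)
    have ne: "K \<noteq> []" "K' \<noteq> []" by (auto simp: K_def K'_def)
    show "run D assemble_paths s1 (\<lambda>t2 s2. run D run_tests s2 (\<lambda>t3 s3. run D write_tree s3 (\<lambda>t4 s.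
        1 + bcost (Less (Const 1) (scalar ''n'')) + (t1 + (t2 + (t3 + t4))) \<le> 4000 * (n * n) \<and>
        solved n D s)))"
    proof (rule run_mono[OF run_assemble_paths[of s1 n ?m D]])
      fix t2 :: nat and s2 :: memory
      assume "t2 \<le> 220 * n + 400 \<and>
        same_except {''e'', ''i'', ''lo'', ''hi'', ''q'', ''j'', ''t'', ''w''} s1 s2 \<and>
        (\<forall>k<n. s2 ''w'' k = (grow (s1 ''seq'') (s1 ''par'') 0 (?m - 1) @
          grow (s1 ''seq'') (s1 ''par'') ?m (n - ?m - 1)) ! k)"
      then have t2: "t2 \<le> 220 * n + 400"
        and f2: "\<And>x. x \<notin> {''e'', ''i'', ''lo'', ''hi'', ''q'', ''j'', ''t'', ''w''} \<Longrightarrow> s2 x = s1 x"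
        and w2: "\<And>k. k < n \<Longrightarrow> s2 ''w'' k = (K @ K') ! k"
        by (auto simp: K_def K'_def)
      have v2: "s2 ''n'' 0 = n" "s2 ''m'' 0 = ?m" "s2 ''f'' 0 = 0" using f2 h1 by auto
      show "run D run_tests s2 (\<lambda>t3 s3. run D write_tree s3 (\<lambda>t4 s.
        1 + bcost (Less (Const 1) (scalar ''n'')) + (t1 + (t2 + (t3 + t4))) \<le> 4000 * (n * n) \<and>
        solved n D s))"
      proof (rule run_mono[OF run_run_tests[where s = s2 and n = n and m = ?m and D = D, OF v2 m]])
        fix t3 :: nat and s3 :: memory
        let ?E = "\<lambda>i j. entry D (s2 ''w'' i) (s2 ''w'' j)"
        let ?F = "\<lambda>i j. entry D ((K @ K') ! i) ((K @ K') ! j)"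
        assume h3: "t3 \<le> 400 * n + 700 \<and>
          same_except {''a'', ''z'', ''c'', ''d'', ''j'', ''f'', ''g''} s2 s3 \<and>
          (s3 ''g'' 0 = 0 \<longleftrightarrow> straight_test n ?m ?E) \<and> (s3 ''f'' 0 = 0 \<longleftrightarrow> flipped_test n ?m ?E)"
        have f3: "s3 x = s2 x" if "x \<notin> {''a'', ''z'', ''c'', ''d'', ''j'', ''f'', ''g''}" for x
          using h3 that by blast
        \<comment> \<open>The tests read positions below n only, where \<open>w\<close> agrees with
          \<open>K @ K'\<close>.\<close>
        have "straight_test n ?m ?E \<longleftrightarrow> straight_test n ?m ?F" "flipped_test n ?m ?E \<longleftrightarrow> flipped_test n ?m ?F"
          unfolding straight_test_def flipped_test_def endpoint_test_def using m w2 by auto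
        then have g3: "s3 ''g'' 0 = 0 \<longleftrightarrow> straight_test n ?m ?F"
          and ff3: "s3 ''f'' 0 = 0 \<longleftrightarrow> flipped_test n ?m ?F" using h3 by blast+
        have v3: "s3 ''n'' 0 = n" "s3 ''m'' 0 = ?m" "s3 ''w'' = s2 ''w''"
          "\<And>y. s3 ''kind'' y = 0" "\<And>y. s3 ''next'' y = 0"
          using f3 f2 v2 h1 by auto
        have len: "length (K @ K') = n" using lenK m by simp
        have inj: "inj_on (s3 ''w'') {..<n}"
          using paths(1) len by (auto simp: v3 w2 inj_on_def nth_eq_iff_index_eq)
        have lt: "s3 ''w'' i < n" if "i < n" for i
          using nth_mem[of i "K @ K'"] paths(2) len that by (auto simp: v3 w2)
        have seg: "map (s3 ''w'') [0..<?m] = K" "map (s3 ''w'') [?m..<n] = K'"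
          using lenK m by (auto intro!: nth_equalityI simp: v3 w2 nth_append)
        define T where "T = (if straight_test n ?m ?F then
            if flipped_test n ?m ?F then QNode [QNode (map Leaf K), QNode (map Leaf K')]
            else QNode (map Leaf (K @ K'))
          else QNode (map Leaf (K @ rev K')))"
        have tree: "pqtree_on n T"
          "{\<sigma>. valid_order n (entry D) \<sigma>} = {\<rho> \<circ> \<pi> | \<rho> \<pi>. \<rho> \<in> Dih n \<and> \<pi> \<in> pq_perms n T}"
          using two_paths_tree[OF d v0 paths(1,2) ne paths(3,4) refl _ T_def] lenK by auto
        show "run D write_tree s3 (\<lambda>t4 s.
          1 + bcost (Less (Const 1) (scalar ''n'')) + (t1 + (t2 + (t3 + t4))) \<le> 4000 * (n * n) \<and>
          solved n D s)"
        proof (rule run_mono[OF run_write_tree[OF v3(1,2) m inj lt v3(4,5), unfolded seg g3 ff3, folded T_def]])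
          fix t4 :: nat and s :: memory
          assume h4: "t4 \<le> 120 * n + 400 \<and> outputs s T"
          \<comment> \<open>Linear and constant bounds are absorbed into n * n; the coefficients
            then add up to 2545.\<close>
          have "n \<le> n * n" "1 \<le> n * n" using n by simp_all
          moreover have "t1 \<le> 300 * (n * n)" "t3 \<le> 400 * n + 700" "t4 \<le> 120 * n + 400"
            using h1 h3 h4 by (simp_all only: mult.assoc)
          ultimately have "5 + (t1 + (t2 + (t3 + t4))) \<le> 4000 * (n * n)" using t2 by linarith
          then have "1 + bcost (Less (Const 1) (scalar ''n'')) + (t1 + (t2 + (t3 + t4))) \<le> 4000 * (n * n)"
            by simp
          then show "1 + bcost (Less (Const 1) (scalar ''n'')) + (t1 + (t2 + (t3 + t4))) \<le> 4000 * (n * n) \<and>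
            solved n D s"
            using h4 tree by blast
        qed
      qed
    qed (use h1 m in simp_all)
  qed
qed

text \<open>On one point the valid orders, the dihedral group and the permutations of the leaf all
  reduce to the identity.\<close>

lemma run_seriate_single:
  assumes v0: "valid_order 1 (entry D) \<sigma>0"
  shows "run D seriate (initial_memory 1) (\<lambda>t s. t \<le> 4000 \<and> solved 1 D s)"
proof -
  have S: "{0..<1::nat} = {0}" by auto
  have p: "\<sigma> permutes {0..<1::nat} \<longleftrightarrow> \<sigma> = id" for \<sigma> :: "nat \<Rightarrow> nat"
    unfolding S by (rule permutes_sing)
  have V: "{\<sigma>. valid_order 1 (entry D) \<sigma>} = {id}"
    using v0 p unfolding valid_order_def by auto
  have "\<rho> \<in> Dih 1 \<longleftrightarrow> \<rho> = id" for \<rho>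
    unfolding Dih_eq using is_dihedral_id[of 1] p by (auto simp: is_dihedral_def)
  moreover have "\<pi> \<in> pq_perms 1 (Leaf 0) \<longleftrightarrow> \<pi> = id" for \<pi>
    unfolding pq_perms_def by (auto simp: p reordering_Leaf_iff)
  ultimately have O: "{\<rho> \<circ> \<pi> | \<rho> \<pi>. \<rho> \<in> Dih 1 \<and> \<pi> \<in> pq_perms 1 (Leaf 0)} = {id}" by auto
  have "tree_at (initial_memory 1) 0 (Leaf (initial_memory 1 ''label'' 0))"
    by (rule tree_at_forest_at.Leaf) (simp add: initial_memory_def store_def)
  then have "outputs (initial_memory 1) (Leaf 0)"
    by (simp add: outputs_def initial_memory_def store_def)
  moreover have "pqtree_on 1 (Leaf 0)" by (simp add: pqtree_on_def)
  moreover have c: "\<not> bval D (Less (Const 1) (scalar ''n'')) (initial_memory 1)"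
    by (simp add: initial_memory_def store_def)
  ultimately show ?thesis
    unfolding seriate_def run_Cond if_not_P[OF c] run_Skip V using O by auto
qed

theorem theorem5p18:
  shows "\<exists>(prog :: com) (time :: nat \<Rightarrow> real).
    time \<in> O(\<lambda>n. real n ^ 2) \<and>
    (\<forall>(n :: nat) (D :: real mat). n \<ge> 1 \<longrightarrow> pre_strict_circular_robinson n D \<longrightarrow>
      (\<exists>t s T. exec D prog (initial_memory n) t s \<and> real t \<le> time n \<and>
         outputs s T \<and> pqtree_on n T \<and>
         circular_orderings n D = {\<rho> \<circ> \<pi> | \<rho> \<pi>. \<rho> \<in> Dih n \<and> \<pi> \<in> pq_perms n T}))"
proof (rule exI[of _ seriate], rule exI[of _ "\<lambda>n. 4000 * real n ^ 2"], intro conjI allI impI)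
  show "(\<lambda>n. 4000 * real n ^ 2) \<in> O(\<lambda>n. real n ^ 2)" by simp
  fix n :: nat and D :: "real mat"
  assume n: "n \<ge> 1" and ps: "pre_strict_circular_robinson n D"
  \<comment> \<open>Besides the dissimilarity axioms, membership in the class supplies one valid
    order; this is the promise that makes one of the two candidates valid.\<close>
  obtain \<sigma>0 where dm: "dissimilarity_mat n D" and v: "valid_order n (\<lambda>i j. D $$ (i, j)) \<sigma>0"
    using pre_strict_circular_robinson_cases[OF ps] by blast
  have v0: "valid_order n (entry D) \<sigma>0" using v valid_order_entry[OF dm] by simp
  have co: "circular_orderings n D = {\<sigma>. valid_order n (entry D) \<sigma>}"
    using circular_orderings_eq[OF dm] valid_order_entry[OF dm] by simp
  have "run D seriate (initial_memory n) (\<lambda>t s. t \<le> 4000 * (n * n) \<and> solved n D s)"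
  proof (cases "n = 1")
    case True
    then show ?thesis using run_seriate_single[of D \<sigma>0] v0 by simp
  next
    case False
    then show ?thesis using run_seriate[OF _ dm v0] n by simp
  qed
  then obtain t s T where "exec D seriate (initial_memory n) t s" "t \<le> 4000 * (n * n)" "outputs s T"
    "pqtree_on n T"
    "{\<sigma>. valid_order n (entry D) \<sigma>} = {\<rho> \<circ> \<pi> | \<rho> \<pi>. \<rho> \<in> Dih n \<and> \<pi> \<in> pq_perms n T}"
    unfolding run_def by blast
  moreover from this(2) have "real t \<le> 4000 * real n ^ 2"
    by (metis (mono_tags) of_nat_le_iff of_nat_mult of_nat_numeral power2_eq_square)
  ultimately show "\<exists>t s T. exec D seriate (initial_memory n) t s \<and> real t \<le> 4000 * real n ^ 2 \<and>
         outputs s T \<and> pqtree_on n T \<and>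
         circular_orderings n D = {\<rho> \<circ> \<pi> | \<rho> \<pi>. \<rho> \<in> Dih n \<and> \<pi> \<in> pq_perms n T}"
    unfolding co by blast
qed

end
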